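(* Let $\mathcal{P}_s(z)=\sum_{k=0}^s a_k z^k$ ($a_k\in\mathbb{R}$, $a_s\neq 0$) be the polynomial of an $s$-stage explicit Runge-Kutta method, with region of absolute stability $\mathscr{A}_s=\{z\in\mathbb{C} : |\mathcal{P}_s(z)|\leq 1\}$. Let $\mathbb{L}_N$ be an $N\times N$ real matrix, let $\mathbb{H}_N$ be an $N\times N$ real symmetric matrix with $0<K_{\mathbb{H}}^{-1}\leq \mathbb{H}_N\leq K_{\mathbb{H}}$, where the constant $K_{\mathbb{H}}$ is independent of $N$, and let $\Delta t>0$. If the CFL condition $$\Delta t\, W_{\mathbb{H}_N}(\mathbb{L}_N)\subset \mathscr{A}_s$$ holds, then the Runge-Kutta scheme $$\mathbf{u}_{n+1}=\mathcal{P}_s(\Delta t\,\mathbb{L}_N)\mathbf{u}_n,\qquad n=0,1,2,\ldots,$$ is stable: for arbitrary initial data $\mathbf{u}_0$, $$|\mathbf{u}_n|_{\ell^2}\leq (1+\sqrt{2})\,K_{\mathbb{H}}\,|\mathbf{u}_0|_{\ell^2},\qquad n=1,2,\ldots.$$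
   Context: For a positive definite $N\times N$ matrix $H$, let $\langle \mathbf{x},\mathbf{y}\rangle_H:=\mathbf{x}^*H\mathbf{y}$ and $|\mathbf{x}|_H^2:=\langle \mathbf{x},\mathbf{x}\rangle_H$ on $\mathbb{C}^N$. The $H$-weighted numerical range of $A\in M_N(\mathbb{C})$ is $W_H(A):=\{\langle A\mathbf{x},\mathbf{x}\rangle_H : \mathbf{x}\in\mathbb{C}^N,\ |\mathbf{x}|_H=1\}$. $|\cdot|_{\ell^2}$ is the Euclidean norm. Matrix inequalities are in the sense of quadratic forms, with a scalar $c$ standing for $c\,\mathbb{I}$. For $c>0$ and $S\subset\mathbb{C}$, $cS=\{cz : z\in S\}$. *)

theory Defs
  imports "HOL-Analysis.Analysis"
begin

definition H_inner :: "complex^'n^'n \<Rightarrow> complex^'n \<Rightarrow> complex^'n \<Rightarrow> complex" where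
  "H_inner H x y = (\<Sum>i\<in>UNIV. cnj (x $ i) * (H *v y) $ i)"

text \<open>Taking the real part loses nothing for the Hermitian positive definite \<open>H\<close> for which
  the norm is used: there \<open>H_inner H x x\<close> is a nonnegative real.\<close>

definition H_norm :: "complex^'n^'n \<Rightarrow> complex^'n \<Rightarrow> real" where
  "H_norm H x = sqrt (Re (H_inner H x x))"

definition numerical_range :: "complex^'n^'n \<Rightarrow> complex^'n^'n \<Rightarrow> complex set" where
  "numerical_range H A = {H_inner H (A *v x) x | x. H_norm H x = 1}"

text \<open>The order on matrices given by quadratic forms: the form of \<open>B - A\<close> takes nonnegative
  real values on all of \<open>\<complex>\<^sup>N\<close>. A scalar \<open>c\<close> enters as the matrix \<open>mat c\<close>.\<close>

definition form_le :: "complex^'n^'n \<Rightarrow> complex^'n^'n \<Rightarrow> bool" where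
  "form_le A B \<longleftrightarrow> (\<forall>x. H_inner (B - A) x x \<in> \<real>\<^sub>\<ge>\<^sub>0)"

text \<open>The real coefficients are \<open>a 0, \<dots>, a s\<close>; the values \<open>a k\<close> for \<open>k > s\<close> are never used.\<close>

definition rk_poly :: "(nat \<Rightarrow> real) \<Rightarrow> nat \<Rightarrow> complex \<Rightarrow> complex" where
  "rk_poly a s z = (\<Sum>k\<le>s. complex_of_real (a k) * z ^ k)"

definition stability_region :: "(nat \<Rightarrow> real) \<Rightarrow> nat \<Rightarrow> complex set" where
  "stability_region a s = {z. norm (rk_poly a s z) \<le> 1}"

text \<open>The powers are those of the matrix product \<open>(**)\<close>: on the type \<open>complex^'n^'n\<close> the
  operator \<open>*\<close> is componentwise multiplication, and so is not what \<open>P(A)\<close> refers to.\<close>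

definition matrix_pow :: "complex^'n^'n \<Rightarrow> nat \<Rightarrow> complex^'n^'n" where
  "matrix_pow A k = (((**) A) ^^ k) (mat 1)"

definition rk_poly_matrix :: "(nat \<Rightarrow> real) \<Rightarrow> nat \<Rightarrow> complex^'n^'n \<Rightarrow> complex^'n^'n" where
  "rk_poly_matrix a s A = (\<Sum>k\<le>s. a k *\<^sub>R matrix_pow A k)"

end

theory Submission
  imports Defs "HOL-Complex_Analysis.Conformal_Mappings"
begin

text \<open>The theorem is the Crouzeix--Palencia inequality \<open>\<parallel>\<phi>(T)\<parallel> \<le> (1 + \<surd>2) sup {|\<phi>(z)| : z \<in> W(T)}\<close>
  applied to \<open>\<phi> = P\<^sup>n\<close> and \<open>T = \<Delta>t L\<close>. The CFL condition says that \<open>|P| \<le> 1\<close> on the numerical range of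
  \<open>T\<close>, hence \<open>|P\<^sup>n| \<le> 1\<close> there, and the \<open>H\<close>-norm of \<open>P(T)\<^sup>n\<close> is at most \<open>1 + \<surd>2\<close> for every \<open>n\<close>. Passing from
  the Euclidean norm to the \<open>H\<close>-norm and back costs the factor \<open>\<surd>K \<sqdot> \<surd>K = K\<close>.

  For the inequality, let \<open>W(T)\<close> lie inside a convex polygon on which \<open>|\<phi>| \<le> 1\<close>, let \<open>\<nu>\<close> be the outward
  unit normal and \<open>ds\<close> the arc length on its boundary, and let
  \<open>g(z) = (2\<pi>)\<^sup>-\<^sup>1 \<integral> cnj (\<phi>(w)) \<nu> / (w - z) ds\<close> be the Cauchy transform of the conjugate of \<open>\<phi>\<close>.
  Two facts carry the proof. First, \<open>|g| \<le> 1\<close> inside the polygon (\<open>cauchy_conj_bound\<close>).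
  Secondly, \<open>\<phi>(T) + g(T)\<^sup>* = (2\<pi>)\<^sup>-\<^sup>1 \<integral> \<phi>(w) (\<nu> R(w) + (\<nu> R(w))\<^sup>*) ds\<close>, where \<open>R\<close> is the resolvent of \<open>T\<close>;
  the matrix weight is positive, because \<open>W(T)\<close> lies on the inner side of every edge, and its total mass
  is \<open>2\<close>, so \<open>\<parallel>\<phi>(T) + g(T)\<^sup>*\<parallel> \<le> 2\<close> (\<open>conjugate_partner\<close>). Now let \<open>M\<close> be the supremum of \<open>\<parallel>\<phi>(T)\<parallel>\<close>
  over all \<open>\<phi>\<close> that are holomorphic and bounded by \<open>1\<close> near the polygon. If \<open>\<parallel>\<phi>(T)\<parallel> = \<sigma>\<close> is attained at \<open>x\<close>, testing the second
  fact on \<open>x\<close> and \<open>\<phi>(T) x\<close> and using \<open>\<parallel>(\<phi> g \<phi>)(T)\<parallel> \<le> M\<close> gives \<open>\<sigma>\<^sup>3 \<le> 2 \<sigma>\<^sup>2 + M\<close>; letting \<open>\<sigma>\<close> tend to \<open>M\<close>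
  yields \<open>M \<le> 1 + \<surd>2\<close> (\<open>polygon_bound\<close>). All of this is done with sesquilinear forms, so that no adjoint
  matrix is needed.

  Polygons with equally spaced normals, circumscribed about \<open>W(T)\<close> with a small margin, come arbitrarily close
  to \<open>W(T)\<close>, since \<open>W(T)\<close> is convex by the Toeplitz--Hausdorff theorem (\<open>convex_num_range\<close>). Polygons make
  everything explicit: contour integrals are finite sums over segments, the index of an interior point is a telescoping
  sum of logarithms, and the boundary behaviour of \<open>g\<close> follows from a reflection in the line that carries an edge.\<close>

section \<open>A maximum principle with limits at the frontier\<close>

text \<open>No continuity up to the frontier is assumed. The superlevel set \<open>A\<close> in the proof is compact, and on its
  frontier the modulus equals the level.\<close>

lemma norm_bound_off_frontier:
  fixes F :: "complex \<Rightarrow> complex"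
  assumes "open U" "bounded U" "F holomorphic_on U"
    and lim: "\<And>p e. p \<in> frontier U \<Longrightarrow> e > 0 \<Longrightarrow> \<exists>d>0. \<forall>z\<in>U. dist z p < d \<longrightarrow> norm (F z) \<le> Q + e"
    and z: "z \<in> U"
  shows "norm (F z) \<le> Q"
proof (rule field_le_epsilon)
  fix e :: real assume e: "e > 0"
  define A where "A = {z\<in>U. norm (F z) \<ge> Q + e}"
  have contU: "continuous_on U F" using assms(3) holomorphic_on_imp_continuous_on by blast
  have "closed A"
    unfolding closed_sequential_limits
  proof (intro allI impI, elim conjE)
    fix x l assume x: "\<forall>n. x n \<in> A" and l: "x \<longlonglongrightarrow> l"
    have lU: "l \<in> U"
    proof (rule ccontr)
      assume "l \<notin> U"
      moreover have "l \<in> closure U"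
        using x l unfolding closure_sequential A_def by blast
      ultimately have "l \<in> frontier U" using \<open>open U\<close> by (simp add: frontier_def interior_open)
      then obtain d where d: "d > 0" "\<forall>z\<in>U. dist z l < d \<longrightarrow> norm (F z) \<le> Q + e/2"
        using lim[of l "e/2"] e by auto
      obtain n where "dist (x n) l < d"
        using l d(1) unfolding lim_sequentially by blast
      then show False using d(2) x e unfolding A_def by force
    qed
    have "isCont F l" using contU lU \<open>open U\<close> continuous_on_eq_continuous_at by blast
    then have "(\<lambda>n. norm (F (x n))) \<longlonglongrightarrow> norm (F l)"
      using l isCont_tendsto_compose tendsto_norm by blast
    then have "Q + e \<le> norm (F l)"
      by (rule LIMSEQ_le_const) (use x A_def in auto)
    with lU show "l \<in> A" by (simp add: A_def)
  qed
  have AU: "A \<subseteq> U" by (auto simp: A_def)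
  show "norm (F z) \<le> Q + e"
  proof (cases "z \<in> A")
    case True
    show ?thesis
    proof (rule maximum_modulus_frontier[where S = A and f = F])
      show "F holomorphic_on interior A"
        using assms(3) AU interior_subset holomorphic_on_subset by (metis subset_trans)
      show "continuous_on (closure A) F"
        using contU AU \<open>closed A\<close> continuous_on_subset by (metis closure_closed)
      show "bounded A" using AU \<open>bounded U\<close> bounded_subset by blast
      show "z \<in> A" by fact
      fix w assume w: "w \<in> frontier A"
      then have wA: "w \<in> A" "w \<notin> interior A" using \<open>closed A\<close> by (auto simp: frontier_def)
      show "norm (F w) \<le> Q + e"
      proof (rule ccontr)
        assume "\<not> ?thesis"
        then have gt: "norm (F w) > Q + e" by simp
        have "open {z\<in>U. norm (F z) > Q + e}"
          using continuous_open_preimage[OF continuous_on_norm[OF contU] \<open>open U\<close> open_greaterThan[of "Q+e"]]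
          by (simp add: vimage_def Int_def)
        then have "w \<in> interior A"
          using gt wA AU by (intro interiorI[of "{z\<in>U. norm (F z) > Q + e}"]) (auto simp: A_def)
        with wA show False by simp
      qed
    qed
  next
    case False
    then show ?thesis using z by (auto simp: A_def)
  qed
qed

section \<open>Convex polygons and integration along the boundary\<close>

text \<open>A closed polygon with \<open>N\<close> edges, traversed counterclockwise. Edge \<open>k\<close> runs from the vertex \<open>b k\<close> to
  \<open>b (Suc k)\<close>, has length \<open>len k\<close> (zero is allowed), and lies on the line \<open>Re (cnj (nu k) * z) = c k\<close> with outward
  unit normal \<open>nu k\<close>; its direction is therefore \<open>\<i> * nu k\<close>. That the polygon has index \<open>1\<close> about each
  interior point is part of the description.\<close>

locale convex_polygon =
  fixes N :: nat and nu b :: "nat \<Rightarrow> complex" and c len :: "nat \<Rightarrow> real"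
  assumes unit: "k < N \<Longrightarrow> norm (nu k) = 1"
    and inj_nu: "inj_on nu {..<N}"
    and closed_path: "b N = b 0"
    and side: "k < N \<Longrightarrow> b (Suc k) - b k = of_real (len k) * (\<i> * nu k)"
    and len_nonneg: "k < N \<Longrightarrow> 0 \<le> len k"
    and on_line: "k < N \<Longrightarrow> Re (cnj (nu k) * b k) = c k"
    and vertex_in: "j < N \<Longrightarrow> k < N \<Longrightarrow> Re (cnj (nu k) * b j) \<le> c k"
    and winds: "(\<And>k. k < N \<Longrightarrow> Re (cnj (nu k) * z) < c k) \<Longrightarrow>
       (\<Sum>k<N. contour_integral (linepath (b k) (b (Suc k))) (\<lambda>w. 1 / (w - z))) = 2 * pi * \<i>"
    and bounded_interior: "bounded {z. \<forall>k<N. Re (cnj (nu k) * z) < c k}"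
    and ex_interior: "\<exists>z. \<forall>k<N. Re (cnj (nu k) * z) < c k"
begin

text \<open>The open interior of the polygon.\<close>

definition region :: "complex set" where
  "region = {z. \<forall>k<N. Re (cnj (nu k) * z) < c k}"

definition edge :: "nat \<Rightarrow> complex set" where
  "edge k = closed_segment (b k) (b (Suc k))"

text \<open>The integral of \<open>f\<close> with respect to arc length. The integrand may depend on the edge, because the normal
  does: \<open>bd_int (\<lambda>k w. nu k * f w)\<close> is \<open>-\<i>\<close> times the contour integral of \<open>f\<close>.\<close>

definition bd_int :: "(nat \<Rightarrow> complex \<Rightarrow> 'a::euclidean_space) \<Rightarrow> 'a" where
  "bd_int f = (\<Sum>k<N. len k *\<^sub>R integral {0..1} (\<lambda>t. f k (linepath (b k) (b (Suc k)) t)))"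

text \<open>Continuity on each edge separately; nothing is required at the vertices.\<close>

definition bd_cont :: "(nat \<Rightarrow> complex \<Rightarrow> 'a::euclidean_space) \<Rightarrow> bool" where
  "bd_cont f \<longleftrightarrow> (\<forall>k<N. continuous_on (edge k) (f k))"

lemma vertex_in': "j \<le> N \<Longrightarrow> k < N \<Longrightarrow> Re (cnj (nu k) * b j) \<le> c k"
  using vertex_in[of j k] vertex_in[of 0 k] closed_path by (cases "j = N") auto

lemma nu_cnj: "k < N \<Longrightarrow> nu k * cnj (nu k) = 1"
  using unit[of k] by (metis complex_norm_square of_real_1 one_power2)

lemma on_line': assumes "k < N" shows "Re (cnj (nu k) * b (Suc k)) = c k"
proof -
  have "cnj (nu k) * b (Suc k) = cnj (nu k) * b k + of_real (len k) * \<i> * (nu k * cnj (nu k))"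
    using side[OF assms] by (simp add: algebra_simps)
  then show ?thesis using nu_cnj[OF assms] on_line[OF assms] by simp
qed

lemma linepath_edge: "t \<in> {0..1} \<Longrightarrow> linepath (b k) (b (Suc k)) t \<in> edge k"
  unfolding edge_def by (metis linepath_image_01 imageI)

lemma edge_obtain: assumes "w \<in> edge k" obtains t where "0 \<le> t" "t \<le> 1" "w = (1-t) *\<^sub>R b k + t *\<^sub>R b (Suc k)"
  using assms unfolding edge_def closed_segment_def by auto

lemma edge_on_line: assumes "k < N" "w \<in> edge k" shows "Re (cnj (nu k) * w) = c k"
proof -
  obtain t where t: "w = (1-t) *\<^sub>R b k + t *\<^sub>R b (Suc k)" using edge_obtain assms(2) by blast
  have "Re (cnj (nu k) * w) = (1-t) * Re (cnj (nu k) * b k) + t * Re (cnj (nu k) * b (Suc k))"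
    unfolding t by (simp add: algebra_simps)
  also have "\<dots> = (1-t) * c k + t * c k" using on_line on_line' assms(1) by presburger
  finally show ?thesis by (simp add: algebra_simps)
qed

lemma edge_in_half_plane:
  assumes "j < N" "w \<in> edge j" "k < N" shows "Re (cnj (nu k) * w) \<le> c k"
proof -
  obtain t where t: "0 \<le> t" "t \<le> 1" "w = (1-t) *\<^sub>R b j + t *\<^sub>R b (Suc j)" using edge_obtain assms(2) by blast
  have "Re (cnj (nu k) * w) = (1-t) * Re (cnj (nu k) * b j) + t * Re (cnj (nu k) * b (Suc j))"
    unfolding t by (simp add: algebra_simps)
  also have "\<dots> \<le> (1-t) * c k + t * c k"
    using t vertex_in'[of j k] vertex_in'[of "Suc j" k] assms by (intro add_mono mult_left_mono) auto
  finally show ?thesis by (simp add: algebra_simps)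
qed

lemma edge_not_region: "k < N \<Longrightarrow> w \<in> edge k \<Longrightarrow> z \<in> region \<Longrightarrow> w \<noteq> z"
  using edge_on_line[of k w] unfolding region_def by fastforce

lemma bd_integrable:
  assumes "bd_cont f" "k < N"
  shows "(\<lambda>t. f k (linepath (b k) (b (Suc k)) t)) integrable_on {0..1}"
proof (rule integrable_continuous_real)
  show "continuous_on {0..1} (\<lambda>t. f k (linepath (b k) (b (Suc k)) t))"
    by (rule continuous_on_compose2[OF _ continuous_on_linepath, of "edge k" "f k"])
      (use assms linepath_edge bd_cont_def in auto)
qed

lemma bd_int_cong: "(\<And>k w. k < N \<Longrightarrow> w \<in> edge k \<Longrightarrow> f k w = g k w) \<Longrightarrow> bd_int f = bd_int g"
  unfolding bd_int_def using linepath_edge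
  by (intro sum.cong arg_cong2[of _ _ _ _ "scaleR"] refl integral_cong) auto

lemma bd_int_add:
  assumes "bd_cont f" "bd_cont g" shows "bd_int (\<lambda>k w. f k w + g k w) = bd_int f + bd_int g"
  unfolding bd_int_def sum.distrib[symmetric]
  by (intro sum.cong refl) (simp add: integral_add[OF bd_integrable[OF assms(1)] bd_integrable[OF assms(2)]] scaleR_add_right)

lemma bd_int_diff:
  assumes "bd_cont f" "bd_cont g" shows "bd_int (\<lambda>k w. f k w - g k w) = bd_int f - bd_int g"
  unfolding bd_int_def sum_subtractf[symmetric]
  by (intro sum.cong refl) (simp add: integral_diff[OF bd_integrable[OF assms(1)] bd_integrable[OF assms(2)]] scaleR_diff_right)

lemma bd_int_linear:
  assumes "bounded_linear L" "bd_cont f" shows "bd_int (\<lambda>k w. L (f k w)) = L (bd_int f)"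
proof -
  interpret L: bounded_linear L by fact
  have "integral {0..1} (\<lambda>t. L (f k (linepath (b k) (b (Suc k)) t))) = L (integral {0..1} (\<lambda>t. f k (linepath (b k) (b (Suc k)) t)))"
    if "k < N" for k
    using integral_linear[OF bd_integrable[OF assms(2) that] assms(1)] by (simp add: o_def)
  then show ?thesis unfolding bd_int_def by (simp add: L.sum L.scaleR)
qed

lemma bd_int_mult: fixes f :: "nat \<Rightarrow> complex \<Rightarrow> complex"
  shows "bd_cont f \<Longrightarrow> bd_int (\<lambda>k w. a * f k w) = a * bd_int f"
  by (rule bd_int_linear[OF bounded_linear_mult_right])

lemma bd_int_cnj: "bd_cont f \<Longrightarrow> bd_int (\<lambda>k w. cnj (f k w)) = cnj (bd_int f)"
  by (rule bd_int_linear[OF bounded_linear_cnj])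

lemma bd_int_norm:
  assumes "bd_cont f" "bd_cont g" "\<And>k w. k < N \<Longrightarrow> w \<in> edge k \<Longrightarrow> norm (f k w) \<le> g k w"
  shows "norm (bd_int f) \<le> bd_int g"
  unfolding bd_int_def
proof (rule sum_norm_le)
  fix k assume "k \<in> {..<N}"
  then have k: "k < N" by simp
  have "norm (integral {0..1} (\<lambda>t. f k (linepath (b k) (b (Suc k)) t))) \<le> integral {0..1} (\<lambda>t. g k (linepath (b k) (b (Suc k)) t))"
    by (intro integral_norm_bound_integral bd_integrable assms k linepath_edge)
  then show "norm (len k *\<^sub>R integral {0..1} (\<lambda>t. f k (linepath (b k) (b (Suc k)) t))) \<le>
      len k *\<^sub>R integral {0..1} (\<lambda>t. g k (linepath (b k) (b (Suc k)) t))"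
    using len_nonneg[OF k] by (simp add: mult_left_mono)
qed

definition perimeter :: real where "perimeter = (\<Sum>k<N. len k)"

lemma perimeter_nonneg: "0 \<le> perimeter"
  unfolding perimeter_def by (intro sum_nonneg) (use len_nonneg in auto)

lemma bd_int_const: "bd_int (\<lambda>k w. r::real) = perimeter * r"
  unfolding bd_int_def perimeter_def by (simp add: sum_distrib_right)

lemma bd_int_norm_const:
  assumes "bd_cont f" "\<And>k w. k < N \<Longrightarrow> w \<in> edge k \<Longrightarrow> norm (f k w) \<le> r"
  shows "norm (bd_int f) \<le> perimeter * r"
  using bd_int_norm[OF assms(1), of "\<lambda>k w. r"] assms(2) by (simp add: bd_int_const bd_cont_def)

lemma bd_int_contour:
  "bd_int (\<lambda>k w. nu k * f k w) = - \<i> * (\<Sum>k<N. contour_integral (linepath (b k) (b (Suc k))) (f k))"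
proof -
  have "len k *\<^sub>R integral {0..1} (\<lambda>t. nu k * f k (linepath (b k) (b (Suc k)) t)) =
     - \<i> * contour_integral (linepath (b k) (b (Suc k))) (f k)" if "k < N" for k
  proof -
    define I where "I = integral {0..1} (\<lambda>t. f k (linepath (b k) (b (Suc k)) t))"
    have "- \<i> * (I * (of_real (len k) * (\<i> * nu k))) = of_real (len k) * (nu k * I) * - (\<i> * \<i>)"
      by (simp only: mult_minus_left mult_minus_right ac_simps)
    then show ?thesis
      using side[OF that] by (simp add: contour_integral_integral scaleR_conv_of_real I_def)
  qed
  then show ?thesis unfolding bd_int_def by (simp add: sum_distrib_left)
qed

lemma bd_int_primitive:
  assumes "\<And>k w. k < N \<Longrightarrow> w \<in> edge k \<Longrightarrow> (F has_field_derivative f w) (at w within edge k)"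
  shows "bd_int (\<lambda>k w. nu k * f w) = 0"
proof -
  have "contour_integral (linepath (b k) (b (Suc k))) f = F (b (Suc k)) - F (b k)" if "k < N" for k
    using contour_integral_unique[OF contour_integral_primitive[of "edge k" F f "linepath (b k) (b (Suc k))"]] assms[OF that]
    by (simp add: edge_def)
  then have "(\<Sum>k<N. contour_integral (linepath (b k) (b (Suc k))) f) = (\<Sum>k<N. F (b (Suc k)) - F (b k))" by simp
  also have "\<dots> = 0" using sum_lessThan_telescope[of "\<lambda>k. F (b k)" N] closed_path by simp
  finally show ?thesis by (simp add: bd_int_contour)
qed

lemma bd_int_holomorphic:
  assumes "f holomorphic_on S" "open S" "convex S" "\<And>k. k < N \<Longrightarrow> edge k \<subseteq> S"
  shows "bd_int (\<lambda>k w. nu k * f w) = 0"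
proof -
  obtain F where F: "\<And>w. w \<in> S \<Longrightarrow> (F has_field_derivative f w) (at w within S)"
    using holomorphic_convex_primitive'[OF assms(3,2,1)] by metis
  show ?thesis by (rule bd_int_primitive[of F]) (use F assms(4) has_field_derivative_subset in blast)
qed

lemma bd_cont_const [intro]: "bd_cont (\<lambda>k w. f k)"
  unfolding bd_cont_def by simp

lemma bd_cont_holo: "f holomorphic_on S \<Longrightarrow> (\<And>k. k < N \<Longrightarrow> edge k \<subseteq> S) \<Longrightarrow> bd_cont (\<lambda>k. f)"
  unfolding bd_cont_def by (meson continuous_on_subset holomorphic_on_imp_continuous_on)

lemma bd_cont_kernel: "z \<in> region \<Longrightarrow> bd_cont (\<lambda>k w. 1 / (w - z))"
  unfolding bd_cont_def using edge_not_region by (auto intro!: continuous_intros)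

lemma bd_cont_mult: fixes f g :: "nat \<Rightarrow> complex \<Rightarrow> complex"
  shows "bd_cont f \<Longrightarrow> bd_cont g \<Longrightarrow> bd_cont (\<lambda>k w. f k w * g k w)"
  unfolding bd_cont_def by (auto intro!: continuous_intros)

lemma bd_cont_add: "bd_cont f \<Longrightarrow> bd_cont g \<Longrightarrow> bd_cont (\<lambda>k w. f k w + g k w)"
  unfolding bd_cont_def by (auto intro!: continuous_intros)

lemma bd_cont_diff: "bd_cont f \<Longrightarrow> bd_cont g \<Longrightarrow> bd_cont (\<lambda>k w. f k w - g k w)"
  unfolding bd_cont_def by (auto intro!: continuous_intros)

lemma bd_cont_cnj: "bd_cont f \<Longrightarrow> bd_cont (\<lambda>k w. cnj (f k w))"
  unfolding bd_cont_def by (auto intro!: continuous_intros)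

lemma bd_cont_linear: "bounded_linear L \<Longrightarrow> bd_cont f \<Longrightarrow> bd_cont (\<lambda>k w. L (f k w))"
  unfolding bd_cont_def using bounded_linear.continuous_on by blast

lemma open_region: "open region"
proof -
  have "region = (\<Inter>k\<in>{..<N}. {z. Re (cnj (nu k) * z) < c k})" by (auto simp: region_def)
  also have "open \<dots>" by (intro open_INT) (auto intro!: open_Collect_less continuous_intros)
  finally show ?thesis .
qed

lemma kernel_integral: assumes "z \<in> region" shows "bd_int (\<lambda>k w. nu k * (1 / (w - z))) = 2 * pi"
  using winds[of z] assms unfolding bd_int_contour by (simp add: region_def)

lemma Cauchy_formula:
  fixes f :: "complex \<Rightarrow> complex"
  assumes "f holomorphic_on S" "open S" "convex S" "\<And>k. k < N \<Longrightarrow> edge k \<subseteq> S" "z \<in> S" "z \<in> region"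
  shows "bd_int (\<lambda>k w. nu k * (f w / (w - z))) = 2 * pi * f z"
proof -
  define q where "q w = (if w = z then deriv f z else (f w - f z) / (w - z))" for w
  have q: "q holomorphic_on S" unfolding q_def by (rule pole_lemma_open) (use assms in auto)
  have "bd_int (\<lambda>k w. nu k * (f w / (w - z))) = bd_int (\<lambda>k w. nu k * q w + f z * (nu k * (1 / (w - z))))"
  proof (rule bd_int_cong)
    fix k w assume "k < N" "w \<in> edge k"
    then have wz: "w \<noteq> z" using edge_not_region assms(6) by blast
    then have "f w / (w - z) = q w + f z * (1 / (w - z))" by (simp add: q_def diff_divide_distrib)
    then show "nu k * (f w / (w - z)) = nu k * q w + f z * (nu k * (1 / (w - z)))"
      by (simp add: algebra_simps)
  qed
  also have "\<dots> = bd_int (\<lambda>k w. nu k * q w) + bd_int (\<lambda>k w. f z * (nu k * (1 / (w - z))))"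
    by (intro bd_int_add bd_cont_mult bd_cont_const bd_cont_kernel bd_cont_holo[OF q]) (use assms in auto)
  also have "\<dots> = f z * bd_int (\<lambda>k w. nu k * (1 / (w - z)))"
    using bd_int_holomorphic[OF q assms(2-4)]
      bd_int_mult[OF bd_cont_mult[OF bd_cont_const[of nu] bd_cont_kernel[OF assms(6)]]] by simp
  finally show ?thesis using kernel_integral[OF assms(6)] by simp
qed

end

section \<open>The Cauchy transform of a conjugate boundary function\<close>

context convex_polygon
begin

lemma bd_int_kernel_holomorphic:
  fixes h :: "nat \<Rightarrow> complex \<Rightarrow> complex"
  assumes "bd_cont h"
  shows "(\<lambda>z. bd_int (\<lambda>k w. h k w / (w - z))) holomorphic_on region"
proof -
  define G where "G k z = contour_integral (linepath (b k) (b (Suc k))) (\<lambda>w. cnj (nu k) * h k w / (w - z))" for k z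
  have eq: "bd_int (\<lambda>k w. h k w / (w - z)) = - \<i> * (\<Sum>k<N. G k z)" for z
  proof -
    have "bd_int (\<lambda>k w. h k w / (w - z)) = bd_int (\<lambda>k w. nu k * (cnj (nu k) * h k w / (w - z)))"
      using nu_cnj by (intro bd_int_cong) (simp flip: mult.assoc add: algebra_simps)
    then show ?thesis unfolding bd_int_contour G_def .
  qed
  have "G k field_differentiable at z" if k: "k < N" and z: "z \<in> region" for k z
  proof -
    have cont: "continuous_on (edge k) (\<lambda>w. cnj (nu k) * h k w)"
      using assms k unfolding bd_cont_def by (auto intro!: continuous_intros)
    have "(G k has_field_derivative
       of_nat 1 * contour_integral (linepath (b k) (b (Suc k))) (\<lambda>w. cnj (nu k) * h k w / (w - z) ^ Suc 1)) (at z)"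
    proof (rule Cauchy_next_derivative(2)[where S = region and B = "norm (b (Suc k) - b k)"])
      show "continuous_on (path_image (linepath (b k) (b (Suc k)))) (\<lambda>w. cnj (nu k) * h k w)"
        using cont by (simp add: edge_def)
      show "z \<in> region - path_image (linepath (b k) (b (Suc k)))"
        using z edge_not_region[OF k _ z] by (auto simp: edge_def)
      fix v assume "v \<in> region - path_image (linepath (b k) (b (Suc k)))"
      then have "(\<lambda>w. cnj (nu k) * h k w / (w - v) ^ 1) contour_integrable_on linepath (b k) (b (Suc k))"
        using cont by (intro contour_integrable_continuous_linepath) (auto intro!: continuous_intros simp: edge_def)
      then show "((\<lambda>w. cnj (nu k) * h k w / (w - v) ^ 1) has_contour_integral G k v) (linepath (b k) (b (Suc k)))"
        unfolding G_def using has_contour_integral_integral by fastforce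
    qed (auto simp: open_region)
    then show ?thesis using field_differentiable_def by blast
  qed
  then have "(\<lambda>z. - \<i> * (\<Sum>k<N. G k z)) holomorphic_on region"
    by (intro holomorphic_intros) (auto simp: holomorphic_on_def intro: field_differentiable_at_within)
  then show ?thesis by (simp add: eq)
qed

text \<open>The Cauchy integral of the conjugate of \<open>f\<close>; the factor \<open>\<i>\<close> of \<open>dw = \<i> nu ds\<close> cancels
  the one in \<open>2\<pi>\<i>\<close>.\<close>

definition cauchy_conj :: "(complex \<Rightarrow> complex) \<Rightarrow> complex \<Rightarrow> complex" where
  "cauchy_conj f z = bd_int (\<lambda>k w. nu k * (cnj (f w) / (w - z))) / (2 * pi)"

text \<open>Twice the density, with respect to arc length, of the angle under which the boundary is seen from \<open>z\<close>.
  It is a positive kernel with total mass \<open>4\<pi>\<close>.\<close>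

definition poisson :: "complex \<Rightarrow> nat \<Rightarrow> complex \<Rightarrow> real" where
  "poisson z k w = 2 * Re (nu k / (w - z))"

lemma poisson_eq: "of_real (poisson z k w) = nu k / (w - z) + cnj (nu k / (w - z))"
  unfolding complex_add_cnj poisson_def by simp

lemma poisson_nonneg:
  assumes "k < N" "w \<in> edge k" "Re (cnj (nu k) * z) \<le> c k"
  shows "0 \<le> poisson z k w"
proof -
  have "Re (nu k * cnj (w - z)) = Re (cnj (nu k) * w) - Re (cnj (nu k) * z)"
    by (simp add: algebra_simps)
  also have "\<dots> \<ge> 0" using edge_on_line assms by simp
  finally have "0 \<le> Re (nu k * cnj (w - z))" .
  then show ?thesis
    unfolding poisson_def by (subst complex_div_cnj) (simp add: Re_divide_of_real del: complex_cnj_diff flip: of_real_power)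
qed

lemma bd_cont_nu_kernel: "z \<in> region \<Longrightarrow> bd_cont (\<lambda>k w. nu k / (w - z))"
  using bd_cont_mult[OF bd_cont_const bd_cont_kernel, of z nu] by simp

lemma bd_cont_poisson: "z \<in> region \<Longrightarrow> bd_cont (poisson z)"
  using bd_cont_linear[OF bounded_linear_compose[OF bounded_linear_mult_right[of 2] bounded_linear_Re] bd_cont_nu_kernel]
  unfolding poisson_def[abs_def] by simp

lemma bd_int_of_real: "bd_cont f \<Longrightarrow> bd_int (\<lambda>k w. complex_of_real (f k w)) = of_real (bd_int f)"
  by (rule bd_int_linear[OF bounded_linear_of_real])

lemma poisson_integral: assumes "z \<in> region" shows "bd_int (poisson z) = 4 * pi"
proof -
  have "complex_of_real (bd_int (poisson z)) = bd_int (\<lambda>k w. nu k / (w - z) + cnj (nu k / (w - z)))"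
    unfolding bd_int_of_real[OF bd_cont_poisson[OF assms], symmetric] poisson_eq ..
  also have "\<dots> = bd_int (\<lambda>k w. nu k / (w - z)) + cnj (bd_int (\<lambda>k w. nu k / (w - z)))"
    using bd_cont_nu_kernel[OF assms] by (simp only: bd_int_add bd_cont_cnj bd_int_cnj)
  also have "\<dots> = of_real (4 * pi)" using kernel_integral[OF assms] by simp
  finally show ?thesis using of_real_eq_iff by blast
qed

lemma cnj_cauchy_conj:
  assumes "bd_cont (\<lambda>k. f)" "z \<in> region"
  shows "2 * pi * cnj (cauchy_conj f z) = bd_int (\<lambda>k w. f w * cnj (nu k / (w - z)))"
proof -
  have "bd_cont (\<lambda>k w. nu k * (cnj (f w) / (w - z)))"
    using bd_cont_mult[OF bd_cont_cnj[OF assms(1)] bd_cont_nu_kernel[OF assms(2)]] by (simp add: field_simps)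
  from bd_int_cnj[OF this] show ?thesis by (simp add: cauchy_conj_def field_simps)
qed

text \<open>The function \<open>cnj (cauchy_conj f) + f\<close> is the integral of \<open>f\<close> against a positive kernel of
  mass \<open>2\<close>. The bound \<open>3\<close> is only needed near the corners, where the sharp estimate below is not available.\<close>

lemma cauchy_conj_crude_bound:
  assumes f: "f holomorphic_on S" "open S" "convex S" "\<And>k. k < N \<Longrightarrow> edge k \<subseteq> S" "region \<subseteq> S"
    and le1: "\<And>w. w \<in> S \<Longrightarrow> norm (f w) \<le> 1" and z: "z \<in> region"
  shows "norm (cauchy_conj f z) \<le> 3"
proof -
  have cf: "bd_cont (\<lambda>k. f)" using bd_cont_holo f by blast
  note ck = bd_cont_nu_kernel[OF z]
  have "2 * pi * cnj (cauchy_conj f z) + 2 * pi * f z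
     = bd_int (\<lambda>k w. f w * cnj (nu k / (w - z))) + bd_int (\<lambda>k w. nu k * (f w / (w - z)))"
    using cnj_cauchy_conj[OF cf z] Cauchy_formula[OF f(1-4) _ z] z f(5) by auto
  also have "\<dots> = bd_int (\<lambda>k w. f w * of_real (poisson z k w))"
    unfolding poisson_eq using bd_int_add[OF bd_cont_mult[OF cf bd_cont_cnj[OF ck]] bd_cont_mult[OF cf ck]]
    by (simp add: algebra_simps)
  also have "norm \<dots> \<le> bd_int (poisson z)"
  proof (rule bd_int_norm)
    show "bd_cont (\<lambda>k w. f w * complex_of_real (poisson z k w))"
      by (intro bd_cont_mult cf bd_cont_linear[OF bounded_linear_of_real] bd_cont_poisson z)
    fix k w assume k: "k < N" "w \<in> edge k"
    have "0 \<le> poisson z k w" using poisson_nonneg k z unfolding region_def by fastforce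
    moreover have "norm (f w) \<le> 1" using le1 f(4) k by blast
    ultimately show "norm (f w * complex_of_real (poisson z k w)) \<le> poisson z k w"
      by (simp add: norm_mult mult_left_le_one_le)
  qed (use bd_cont_poisson z in auto)
  finally have "norm (of_real (2 * pi) * (cnj (cauchy_conj f z) + f z)) \<le> 4 * pi"
    unfolding poisson_integral[OF z] by (simp add: distrib_left)
  then have "norm (cnj (cauchy_conj f z) + f z) \<le> 2" by (simp add: norm_mult)
  then have "norm (cnj (cauchy_conj f z)) \<le> 2 + norm (f z)"
    by (metis add.commute norm_diff_ineq diff_le_eq order_trans add_mono order_refl)
  moreover have "norm (f z) \<le> 1" using le1 z f(5) by blast
  ultimately show ?thesis by simp
qed

text \<open>The mirror image of \<open>z\<close> in the line that carries the edge \<open>m\<close>. On that line the conjugate of the Cauchy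
  kernel with pole \<open>z\<close> is minus the Cauchy kernel with pole \<open>mirror m z\<close> (lemma \<open>mirror_kernel\<close>).\<close>

definition mirror :: "nat \<Rightarrow> complex \<Rightarrow> complex" where
  "mirror m z = z + of_real (2 * (c m - Re (cnj (nu m) * z))) * nu m"

lemma Re_mirror: assumes "m < N" shows "Re (cnj (nu m) * mirror m z) = 2 * c m - Re (cnj (nu m) * z)"
proof -
  have "cnj (nu m) * mirror m z = cnj (nu m) * z + of_real (2 * (c m - Re (cnj (nu m) * z))) * (nu m * cnj (nu m))"
    by (simp add: mirror_def algebra_simps)
  then show ?thesis using nu_cnj[OF assms] by simp
qed

lemma mirror_kernel:
  assumes m: "m < N" and w: "Re (cnj (nu m) * w) = c m"
  shows "cnj (nu m / (w - z)) + nu m / (w - mirror m z) = 0"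
proof -
  define u where "u = cnj (nu m) * (w - z)"
  have nz: "nu m \<noteq> 0" "cnj (nu m) \<noteq> 0" using unit[OF m] by auto
  have wz: "w - z = nu m * u" unfolding u_def mult.assoc[symmetric] nu_cnj[OF m] by simp
  have Reu: "Re u = c m - Re (cnj (nu m) * z)" using w by (simp add: u_def algebra_simps)
  have "w - mirror m z = nu m * (u - of_real (2 * Re u))"
    unfolding mirror_def Reu[symmetric] using wz by (simp add: algebra_simps)
  also have "u - of_real (2 * Re u) = - cnj u" by (simp add: complex_eq_iff)
  finally have "w - mirror m z = nu m * - cnj u" .
  then have "nu m / (w - mirror m z) = - (1 / cnj u)" using nz(1) by simp
  moreover have "cnj (nu m / (w - z)) = 1 / cnj u" unfolding wz using nz by simp
  ultimately show ?thesis by simp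
qed

lemma bd_cont_off: "bd_cont f \<Longrightarrow> bd_cont (\<lambda>k w. if k = m then 0 else f k w)"
  unfolding bd_cont_def
proof (intro allI impI)
  fix k assume "\<forall>k<N. continuous_on (edge k) (f k)" "k < N"
  then show "continuous_on (edge k) (\<lambda>w. if k = m then 0 else f k w)" by (cases "k = m") auto
qed

text \<open>The sum of the two kernels, which vanishes on the edge \<open>m\<close>. As \<open>z\<close> approaches an
  inner point of this edge, so does its mirror image, and on the other edges the sum tends to the positive kernel
  \<open>poisson\<close>.\<close>

definition off_edge :: "nat \<Rightarrow> complex \<Rightarrow> nat \<Rightarrow> complex \<Rightarrow> complex" where
  "off_edge m z k w = (if k = m then 0 else cnj (nu k / (w - z)) + nu k / (w - mirror m z))"

lemma mirror_not_edge:
  assumes "m < N" "k < N" "w \<in> edge k" "z \<in> region" shows "w \<noteq> mirror m z"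
proof
  assume "w = mirror m z"
  then have "2 * c m - Re (cnj (nu m) * z) \<le> c m"
    using edge_in_half_plane[OF assms(2,3,1)] Re_mirror[OF assms(1), of z] by metis
  moreover have "Re (cnj (nu m) * z) < c m" using assms by (simp add: region_def)
  ultimately show False by linarith
qed

lemma bd_cont_mirror: "m < N \<Longrightarrow> z \<in> region \<Longrightarrow> bd_cont (\<lambda>k w. 1 / (w - mirror m z))"
  unfolding bd_cont_def using mirror_not_edge by (auto intro!: continuous_intros)

text \<open>Since the mirror image lies outside the polygon, its kernel contributes zero to the integral of a holomorphic
  function. Adding it removes the edge \<open>m\<close>, where the kernel of the Cauchy transform is singular as \<open>z\<close>
  approaches the edge.\<close>

lemma cauchy_conj_off_edge:
  assumes f: "f holomorphic_on S" "open S" "convex S" "\<And>k. k < N \<Longrightarrow> edge k \<subseteq> S"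
    and m: "m < N" and z: "z \<in> region"
  shows "2 * pi * cnj (cauchy_conj f z) = bd_int (\<lambda>k w. f w * off_edge m z k w)"
proof -
  have cf: "bd_cont (\<lambda>k. f)" using bd_cont_holo f by blast
  define r where "r = 2 * c m - Re (cnj (nu m) * z)"
  have r: "c m < r" using z m unfolding r_def region_def by fastforce
  define S' where "S' = S \<inter> {w. Re (cnj (nu m) * w) < r}"
  have "convex {w. Re (cnj (nu m) * w) < r}"
    using convex_halfspace_lt[of "nu m" r] by (simp add: inner_complex_def)
  then have S': "open S'" "convex S'"
    unfolding S'_def using f(2,3)
    by (auto intro!: open_Int convex_Int open_Collect_less continuous_intros)
  have edges: "edge k \<subseteq> S'" if "k < N" for k
    using f(4)[OF that] edge_in_half_plane[OF that _ m] r unfolding S'_def by force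
  have "w \<noteq> mirror m z" if "w \<in> S'" for w
    using that Re_mirror[OF m, of z] unfolding S'_def r_def by auto
  then have "(\<lambda>w. f w / (w - mirror m z)) holomorphic_on S'"
    by (intro holomorphic_intros holomorphic_on_subset[OF f(1)]) (auto simp: S'_def)
  from bd_int_holomorphic[OF this S' edges]
  have 0: "bd_int (\<lambda>k w. nu k * (f w / (w - mirror m z))) = 0" .
  have "2 * pi * cnj (cauchy_conj f z) = bd_int (\<lambda>k w. f w * cnj (nu k / (w - z)) + nu k * (f w / (w - mirror m z)))"
  proof (subst bd_int_add)
    show "bd_cont (\<lambda>k w. f w * cnj (nu k / (w - z)))"
      by (intro bd_cont_mult cf bd_cont_cnj bd_cont_nu_kernel z)
    show "bd_cont (\<lambda>k w. nu k * (f w / (w - mirror m z)))"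
      using bd_cont_mult[OF bd_cont_const[of nu] bd_cont_mult[OF cf bd_cont_mirror[OF m z]]] by simp
  qed (use 0 cnj_cauchy_conj[OF cf z] in simp)
  also have "\<dots> = bd_int (\<lambda>k w. f w * (cnj (nu k / (w - z)) + nu k / (w - mirror m z)))"
    by (simp add: algebra_simps)
  also have "\<dots> = bd_int (\<lambda>k w. f w * off_edge m z k w)"
    using mirror_kernel edge_on_line by (intro bd_int_cong) (auto simp: off_edge_def)
  finally show ?thesis .
qed

text \<open>Near a frontier point \<open>p\<close> that lies on only one of the lines, \<open>off_edge\<close> is \<open>poisson\<close> on the
  other edges, up to an error of the order of \<open>dist z p\<close>. The case \<open>f = 1\<close>, whose transform is \<open>1\<close>, shows that
  the mass of these edges is \<open>2\<pi>\<close>, up to the same error.\<close>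

lemma cauchy_conj_frontier_bound:
  assumes f: "f holomorphic_on S" "open S" "convex S" "\<And>k. k < N \<Longrightarrow> edge k \<subseteq> S"
    and le1: "\<And>w. w \<in> S \<Longrightarrow> norm (f w) \<le> 1"
    and m: "m < N" and p: "Re (cnj (nu m) * p) = c m" "\<And>k. k < N \<Longrightarrow> k \<noteq> m \<Longrightarrow> Re (cnj (nu k) * p) < c k"
  shows "\<exists>d>0. \<exists>C\<ge>0. \<forall>z\<in>region. dist z p < d \<longrightarrow> norm (cauchy_conj f z) \<le> 1 + C * dist z p"
proof -
  have cf: "bd_cont (\<lambda>k. f)" using bd_cont_holo f by blast
  obtain r where r: "r > 0" "\<And>k. k < N \<Longrightarrow> k \<noteq> m \<Longrightarrow> r \<le> c k - Re (cnj (nu k) * p)"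
  proof
    define A where "A = insert 1 ((\<lambda>k. c k - Re (cnj (nu k) * p)) ` ({..<N} - {m}))"
    show "Min A > 0" unfolding A_def using p(2) by (subst Min_gr_iff) auto
    show "Min A \<le> c k - Re (cnj (nu k) * p)" if "k < N" "k \<noteq> m" for k
      unfolding A_def using that by (intro Min_le) auto
  qed
  have Re_le: "\<bar>Re (cnj (nu k) * a)\<bar> \<le> norm a" if "k < N" for k a
    using abs_Re_le_cmod[of "cnj (nu k) * a"] unit[OF that] by (simp add: norm_mult)
  have far: "r \<le> dist w p" if "k < N" "k \<noteq> m" "w \<in> edge k" for k w
  proof -
    have "r \<le> Re (cnj (nu k) * (w - p))"
      using r(2)[OF that(1,2)] edge_on_line[OF that(1,3)] by (simp add: algebra_simps)
    also have "\<dots> \<le> norm (w - p)" using Re_le[OF that(1), of "w - p"] by linarith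
    finally show ?thesis by (simp add: dist_norm)
  qed
  define C where "C = perimeter * 16 / (r^2 * (2 * pi))"
  have "norm (cauchy_conj f z) \<le> 1 + C * dist z p" if z: "z \<in> region" and near: "dist z p < r / 6" for z
  proof -
    define \<delta> where "\<delta> = c m - Re (cnj (nu m) * z)"
    have \<delta>: "0 < \<delta>" "\<delta> \<le> dist z p"
      using z m Re_le[OF m, of "p - z"] p(1) by (auto simp: \<delta>_def region_def dist_norm norm_minus_commute algebra_simps)
    have mz: "dist (mirror m z) z = 2 * \<delta>"
      using unit[OF m] \<delta>(1) unfolding mirror_def \<delta>_def[symmetric] by (simp add: dist_norm norm_mult)
    define D where "D = 8 * dist z p / r^2"
    define E where "E k w = (if k = m then 0 else nu k / (w - mirror m z) - nu k / (w - z))" for k w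
    define P where "P k w = (if k = m then 0 else poisson z k w)" for k w
    have off: "off_edge m z k w = of_real (P k w) + E k w" for k w
      by (simp add: off_edge_def P_def E_def poisson_eq)
    have E: "norm (E k w) \<le> D" if k: "k < N" "w \<in> edge k" for k w
    proof (cases "k = m")
      case True
      then show ?thesis using r by (simp add: E_def D_def)
    next
      case False
      note wp = far[OF k(1) False k(2)]
      have 1: "r / 2 \<le> norm (w - z)" 
        using wp near r dist_triangle[of w p z] by (simp add: dist_norm)
      have "dist w p \<le> dist w (mirror m z) + dist (mirror m z) z + dist z p"
        using dist_triangle[of w p "mirror m z"] dist_triangle[of "mirror m z" p z] by linarith
      then have 2: "r / 2 \<le> norm (w - mirror m z)"
        using wp mz near \<delta> by (simp add: dist_norm)
      have nz: "w - z \<noteq> 0" "w - mirror m z \<noteq> 0" using 1 2 r by auto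
      have "E k w = nu k * (mirror m z - z) / ((w - mirror m z) * (w - z))"
        using False nz by (simp add: E_def diff_frac_eq) (simp add: algebra_simps)
      then have "norm (E k w) = 2 * \<delta> / (norm (w - mirror m z) * norm (w - z))"
        using unit[OF k(1)] mz by (simp add: norm_mult norm_divide dist_norm)
      also have "\<dots> \<le> 2 * dist z p / (r / 2 * (r / 2))"
        using 1 2 r \<delta> by (intro frac_le mult_mono) auto
      finally show ?thesis by (simp add: D_def power2_eq_square)
    qed
    have cP: "bd_cont P" unfolding P_def[abs_def] by (rule bd_cont_off[OF bd_cont_poisson[OF z]])
    have cE: "bd_cont E"
      using bd_cont_off[OF bd_cont_diff[OF bd_cont_mult[OF bd_cont_const[of nu] bd_cont_mirror[OF m z]] bd_cont_nu_kernel[OF z]], of m]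
      unfolding E_def[abs_def] times_divide_eq_right mult_1_right .
    have cPc: "bd_cont (\<lambda>k w. complex_of_real (P k w))"
      by (rule bd_cont_linear[OF bounded_linear_of_real cP])
    have P0: "0 \<le> P k w" if "k < N" "w \<in> edge k" for k w
      using poisson_nonneg[OF that] z that by (auto simp: P_def region_def less_imp_le)
    have 1: "2 * pi = of_real (bd_int P) + bd_int E"
    proof -
      have "cauchy_conj (\<lambda>w. 1) z = 1" using kernel_integral[OF z] by (simp add: cauchy_conj_def)
      then have "2 * pi = bd_int (\<lambda>k w. off_edge m z k w)"
        using cauchy_conj_off_edge[of "\<lambda>w. 1" UNIV m z] m z by simp
      then show ?thesis unfolding off bd_int_add[OF cPc cE] bd_int_of_real[OF cP] by simp
    qed
    have "bd_int P = 2 * pi - Re (bd_int E)" using arg_cong[OF 1, of Re] by simp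
    also have "\<dots> \<le> 2 * pi + perimeter * D"
      using bd_int_norm_const[OF cE E] abs_Re_le_cmod[of "bd_int E"] by linarith
    finally have BP: "bd_int P \<le> 2 * pi + perimeter * D" .
    have "2 * pi * norm (cauchy_conj f z) = norm (2 * pi * cnj (cauchy_conj f z))" by (simp add: norm_mult)
    also have "\<dots> = norm (bd_int (\<lambda>k w. f w * off_edge m z k w))"
      by (simp only: cauchy_conj_off_edge[OF f m z])
    also have "\<dots> \<le> bd_int (\<lambda>k w. P k w + D)"
    proof (rule bd_int_norm)
      show "bd_cont (\<lambda>k w. f w * off_edge m z k w)"
        unfolding off by (intro bd_cont_mult cf bd_cont_add cPc cE)
      show "bd_cont (\<lambda>k w. P k w + D)" using cP by (auto simp: bd_cont_def intro!: continuous_intros)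
      fix k w assume k: "k < N" "w \<in> edge k"
      have "norm (f w * off_edge m z k w) \<le> 1 * norm (off_edge m z k w)"
        unfolding norm_mult using le1 f(4) k by (intro mult_right_mono) auto
      also have "\<dots> \<le> P k w + D"
        unfolding off using P0[OF k] E[OF k] norm_triangle_ineq[of "of_real (P k w)" "E k w"] by simp
      finally show "norm (f w * off_edge m z k w) \<le> P k w + D" .
    qed
    also have "\<dots> = bd_int P + perimeter * D"
      using bd_int_add[OF cP, of "\<lambda>k w. D"] bd_int_const[of D] by (simp add: bd_cont_def)
    finally have "2 * pi * norm (cauchy_conj f z) \<le> 2 * pi + 2 * perimeter * D" using BP by simp
    then have "norm (cauchy_conj f z) \<le> (2 * pi + 2 * perimeter * D) / (2 * pi)"
      by (simp add: pos_le_divide_eq mult.commute)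
    also have "\<dots> = 1 + C * dist z p" by (simp add: C_def D_def add_divide_distrib)
    finally show ?thesis .
  qed
  moreover have "C \<ge> 0" "r / 6 > 0" using perimeter_nonneg r by (auto simp: C_def)
  ultimately show ?thesis by blast
qed

text \<open>The points where two of the lines meet; they include the vertices of the polygon.\<close>

definition corners :: "complex set" where
  "corners = {p. \<exists>j<N. \<exists>k<N. j \<noteq> k \<and> Re (cnj (nu j) * p) = c j \<and> Re (cnj (nu k) * p) = c k}"

lemma finite_corners: "finite corners"
proof -
  define A where "A j k = {p. j \<noteq> k \<and> Re (cnj (nu j) * p) = c j \<and> Re (cnj (nu k) * p) = c k}" for j k
  have "finite (A j k)" if jk: "j < N" "k < N" for j k
  proof (rule ccontr)
    assume inf: "infinite (A j k)"
    then obtain p where p: "p \<in> A j k" by (metis all_not_in_conv finite.emptyI)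
    obtain q where q: "q \<in> A j k" "q \<noteq> p"
      using inf by (metis finite.emptyI finite_insert finite_subset singletonI subsetI)
    have ne: "j \<noteq> k" using p by (simp add: A_def)
    define u where "u = cnj (nu j) * (q - p)"
    have Reu: "Re u = 0" using p q by (simp add: u_def A_def algebra_simps)
    have qp: "q - p = nu j * u" unfolding u_def mult.assoc[symmetric] nu_cnj[OF jk(1)] by simp
    then have Imu: "Im u \<noteq> 0" using q Reu by (metis complex_eqI mult_zero_right right_minus_eq zero_complex.simps)
    define v where "v = cnj (nu k) * nu j"
    have "Re (cnj (nu k) * (q - p)) = 0" using p q by (simp add: A_def algebra_simps)
    then have "Re (v * u) = 0" unfolding qp v_def by (simp add: mult.assoc)
    then have "Im v = 0" using Reu Imu by simp
    moreover have "norm v = 1" unfolding v_def using unit jk by (simp add: norm_mult)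
    ultimately have "v = 1 \<or> v = -1"
      by (metis abs_of_nonneg abs_of_neg complex_is_Real_iff in_Reals_norm complex_eqI complex_eq_iff linorder_le_less_linear minus_minus of_real_Re of_real_minus one_complex.simps of_real_1)
    moreover have nuj: "nu j = nu k * v"
      unfolding v_def mult.assoc[symmetric] nu_cnj[OF jk(2)] by simp
    ultimately have "nu j = nu k \<or> nu j = - nu k" by auto
    then have opp: "nu j = - nu k" using inj_nu jk ne by (auto simp: inj_on_def)
    \<comment> \<open>Two lines that coincide and have opposite normals leave no room for an interior point.\<close>
    obtain z where "\<forall>k<N. Re (cnj (nu k) * z) < c k" using ex_interior by blast
    then have "Re (cnj (nu j) * z) < c j" "Re (cnj (nu k) * z) < c k" using jk by auto
    moreover have "c j = - c k" using p opp by (auto simp: A_def)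
    ultimately show False using opp by simp
  qed
  moreover have "corners = (\<Union>j<N. \<Union>k<N. A j k)" by (auto simp: corners_def A_def)
  ultimately show ?thesis by simp
qed

lemma closure_region: assumes "p \<in> closure region" "k < N" shows "Re (cnj (nu k) * p) \<le> c k"
proof -
  have "closed {z. Re (cnj (nu k) * z) \<le> c k}" by (intro closed_Collect_le continuous_intros)
  moreover have "region \<subseteq> {z. Re (cnj (nu k) * z) \<le> c k}" using assms(2) by (auto simp: region_def less_imp_le)
  ultimately show ?thesis using assms(1) closure_minimal by blast
qed

lemma cauchy_conj_holomorphic:
  assumes "bd_cont (\<lambda>k. f)" shows "cauchy_conj f holomorphic_on region"
proof -
  have "(\<lambda>z. bd_int (\<lambda>k w. nu k * cnj (f w) / (w - z)) / (2 * pi)) holomorphic_on region"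
    by (intro holomorphic_intros bd_int_kernel_holomorphic bd_cont_mult bd_cont_const bd_cont_cnj assms) auto
  then show ?thesis by (simp add: cauchy_conj_def[abs_def])
qed

text \<open>The corners are removed from the maximum principle by a standard device: multiply \<open>g ^ n\<close> by a fixed polynomial
  \<open>q\<close> that vanishes at the corners. The resulting bound \<open>|g| ^ n |q| \<le> Q\<close> for all \<open>n\<close> forces \<open>|g| \<le> 1\<close>.\<close>

theorem cauchy_conj_bound:
  assumes f: "f holomorphic_on S" "open S" "convex S" "\<And>k. k < N \<Longrightarrow> edge k \<subseteq> S" "region \<subseteq> S"
    and le1: "\<And>w. w \<in> S \<Longrightarrow> norm (f w) \<le> 1" and z: "z \<in> region"
  shows "norm (cauchy_conj f z) \<le> 1"
proof -
  define g where "g = cauchy_conj f"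
  define q where "q z = (\<Prod>v\<in>corners. z - v)" for z
  have g: "g holomorphic_on region" unfolding g_def by (rule cauchy_conj_holomorphic) (use bd_cont_holo f in blast)
  have g3: "norm (g z) \<le> 3" if "z \<in> region" for z
    unfolding g_def by (rule cauchy_conj_crude_bound) (use f le1 that in auto)
  have contq: "continuous_on UNIV q" unfolding q_def by (intro continuous_intros)
  have holq: "q holomorphic_on region" unfolding q_def by (intro holomorphic_intros)
  have bd: "bounded region" using bounded_interior by (simp add: region_def)
  then have "compact (closure region)" by simp
  then have "bounded (q ` closure region)" using contq
    by (meson compact_continuous_image compact_imp_bounded continuous_on_subset subset_UNIV)
  then obtain Q where Q: "Q > 0" "\<And>z. z \<in> closure region \<Longrightarrow> norm (q z) \<le> Q"
    unfolding bounded_pos by blast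
  have main: "norm (g z) ^ n * norm (q z) \<le> Q" if z: "z \<in> region" for z n
  proof -
    have "norm (g z ^ n * q z) \<le> Q"
    proof (rule norm_bound_off_frontier[OF open_region bd _ _ z])
      show "(\<lambda>z. g z ^ n * q z) holomorphic_on region" by (intro holomorphic_intros g holq)
      fix p :: complex and e :: real assume p: "p \<in> frontier region" and e: "e > 0"
      have pc: "p \<in> closure region" "p \<notin> region" using p open_region by (auto simp: frontier_def interior_open)
      show "\<exists>d>0. \<forall>z\<in>region. dist z p < d \<longrightarrow> norm (g z ^ n * q z) \<le> Q + e"
      proof (cases "p \<in> corners")
        case True
        then have q0: "q p = 0" using finite_corners by (auto simp: q_def)
        have "isCont q p" using contq by (simp add: continuous_on_eq_continuous_at)
        then obtain d where d: "d > 0" "\<And>z. dist z p < d \<Longrightarrow> dist (q z) (q p) < Q / 3 ^ n"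
          using Q(1) unfolding continuous_at_eps_delta by (metis divide_pos_pos zero_less_numeral zero_less_power)
        have "norm (g z ^ n * q z) \<le> Q + e" if "z \<in> region" "dist z p < d" for z
        proof -
          have "norm (g z ^ n * q z) \<le> 3 ^ n * (Q / 3 ^ n)"
            unfolding norm_mult norm_power using g3[OF that(1)] d(2)[OF that(2)] q0
            by (intro mult_mono power_mono) auto
          then show ?thesis using e by simp
        qed
        then show ?thesis using d by blast
      next
        case False
        from pc(2) obtain m where m: "m < N" "\<not> Re (cnj (nu m) * p) < c m" by (auto simp: region_def)
        then have pm: "Re (cnj (nu m) * p) = c m" using closure_region[OF pc(1) m(1)] by simp
        have oth: "Re (cnj (nu k) * p) < c k" if "k < N" "k \<noteq> m" for k
          using closure_region[OF pc(1) that(1)] False pm m(1) that unfolding corners_def by fastforce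
        obtain d C where d: "d > 0" "C \<ge> 0" "\<And>z. z \<in> region \<Longrightarrow> dist z p < d \<Longrightarrow> norm (g z) \<le> 1 + C * dist z p"
          unfolding g_def using cauchy_conj_frontier_bound[OF f(1-4) le1 m(1) pm oth] by metis
        have "isCont (\<lambda>t. (1 + C * t) ^ n * Q) 0" by (intro continuous_intros)
        then obtain d' where d': "d' > 0" "\<And>t. dist t 0 < d' \<Longrightarrow> dist ((1 + C * t) ^ n * Q) ((1 + C * 0) ^ n * Q) < e"
          using e unfolding continuous_at_eps_delta by metis
        have "norm (g z ^ n * q z) \<le> Q + e" if z: "z \<in> region" "dist z p < min d d'" for z
        proof -
          have "norm (g z ^ n * q z) \<le> (1 + C * dist z p) ^ n * Q"
            unfolding norm_mult norm_power using d(2,3) z Q closure_subset[of region]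
            by (intro mult_mono power_mono) auto
          also have "\<dots> \<le> Q + e" using d'(2)[of "dist z p"] z by (auto simp: dist_real_def)
          finally show ?thesis .
        qed
        then show ?thesis using d(1) d'(1) by (intro exI[of _ "min d d'"]) auto
      qed
    qed
    then show ?thesis by (simp add: norm_mult norm_power)
  qed
  have "q z \<noteq> 0"
    using z finite_corners unfolding q_def by (auto simp: corners_def region_def)
  then have qz: "norm (q z) > 0" by simp
  show ?thesis
  proof (rule ccontr)
    assume "\<not> ?thesis"
    then have "norm (g z) > 1" by (simp add: g_def)
    then obtain n where "Q / norm (q z) < norm (g z) ^ n" using real_arch_pow by blast
    then show False using main[OF z, of n] qz by (simp add: field_simps)
  qed
qed

end

section \<open>Matrices, linear functionals and positive forms\<close>

lemma scaleR_eq_scale: "r *\<^sub>R x = complex_of_real r *s (x :: complex^'n)"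
  by (simp add: vec_eq_iff) (simp add: scaleR_conv_of_real)

lemma matrix_vector_scale: "A *v (a *s x) = a *s (A *v (x :: complex^'n))" for A :: "complex^'n^'m"
  by (simp add: vec_eq_iff matrix_vector_mult_def sum_distrib_left algebra_simps)

lemma mat_vector_mult: "mat a *v x = a *s (x :: complex^'n)"
  by (simp add: vec_eq_iff matrix_vector_mult_def mat_def if_distrib [of "\<lambda>x. x * y" for y] cong: if_cong)

lemma mat_diff: "mat (a - b) = mat a - (mat b :: complex^'n^'n)"
  by (simp add: vec_eq_iff mat_def)

lemma mat_mult_vector_diff: "(mat a - A) *v x = a *s x - A *v (x :: complex^'n)"
  by (simp add: matrix_vector_mult_diff_rdistrib mat_vector_mult)

lemma mat_matrix_mult_component: "(mat a ** A) $ i $ j = a * (A $ i $ j)" for A :: "complex^'n^'n"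
  by (simp add: matrix_matrix_mult_def mat_def if_distrib [of "\<lambda>x. x * y" for y] cong: if_cong)

lemma matrix_mat_mult_component: "(A ** mat a) $ i $ j = a * (A $ i $ j)" for A :: "complex^'n^'n"
  by (simp add: matrix_matrix_mult_def mat_def if_distrib [of "\<lambda>x. y * x" for y] algebra_simps cong: if_cong)

lemma mat_commute: "mat a ** A = A ** mat a" for A :: "complex^'n^'n"
  by (simp add: vec_eq_iff mat_matrix_mult_component matrix_mat_mult_component)

lemma matrix_mult_diff_left: "A ** (B - C) = A ** B - A ** C" for A :: "complex^'n^'n"
  by (simp add: vec_eq_iff matrix_matrix_mult_def algebra_simps sum_subtractf)

lemma matrix_mult_diff_right: "(A - B) ** C = A ** C - B ** C" for A :: "complex^'n^'n"
  by (simp add: vec_eq_iff matrix_matrix_mult_def algebra_simps sum_subtractf)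

text \<open>A linear functional over the complex numbers, with respect to the scalar multiplication \<open>*s\<close>.\<close>

definition clinear_fun :: "(complex^'n \<Rightarrow> complex) \<Rightarrow> bool" where
  "clinear_fun l \<longleftrightarrow> (\<forall>x y. l (x + y) = l x + l y) \<and> (\<forall>a x. l (a *s x) = a * l x)"

lemma clinear_fun_bounded: "clinear_fun l \<Longrightarrow> bounded_linear l"
  unfolding linear_conv_bounded_linear[symmetric]
  by (rule linearI) (simp_all add: clinear_fun_def scaleR_eq_scale, simp add: scaleR_conv_of_real)

lemma clinear_fun_diff: "clinear_fun l \<Longrightarrow> l (x - y) = l x - l y"
  using bounded_linear.linear[OF clinear_fun_bounded] linear_diff by blast

lemma clinear_fun_scale: "clinear_fun l \<Longrightarrow> l (a *s x) = a * l x"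
  by (simp add: clinear_fun_def)

lemma clinear_fun_component: "clinear_fun (\<lambda>v. v $ i)"
  by (simp add: clinear_fun_def)

lemma clinear_fun_expand: 
  assumes "clinear_fun l" shows "l v = (\<Sum>i\<in>UNIV. v $ i * l (axis i 1))"
proof -
  have "v = (\<Sum>i\<in>UNIV. v $ i *s axis i 1)" using basis_expansion[of v] by simp
  then have "l v = l (\<Sum>i\<in>UNIV. v $ i *s axis i 1)" by simp
  also have "\<dots> = (\<Sum>i\<in>UNIV. l (v $ i *s axis i 1))"
    using linear_sum[OF bounded_linear.linear[OF clinear_fun_bounded[OF assms]]] .
  finally show ?thesis using assms by (simp add: clinear_fun_scale)
qed

text \<open>A positive semidefinite Hermitian form, linear in the first argument.\<close>

locale psd_form =
  fixes B :: "complex^'n \<Rightarrow> complex^'n \<Rightarrow> complex"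
  assumes add_left: "B (x + y) z = B x z + B y z"
    and scale_left: "B (a *s x) z = a * B x z"
    and cnj_swap: "cnj (B x y) = B y x"
    and nonneg: "0 \<le> Re (B x x)"
begin

lemma add_right: "B x (y + z) = B x y + B x z"
  using cnj_swap add_left by (metis complex_cnj_add)

lemma scale_right: "B x (a *s y) = cnj a * B x y"
  using cnj_swap scale_left by (metis complex_cnj_mult)

lemma diff_left: "B (x - y) z = B x z - B y z"
  using add_left[of "x - y" y z] by simp

lemma diff_right: "B x (y - z) = B x y - B x z"
  using add_right[of x "y - z" z] by simp

lemma zero_left [simp]: "B 0 z = 0" using diff_left[of 0 0 z] by simp
lemma zero_right [simp]: "B z 0 = 0" using diff_right[of z 0 0] by simp

lemma self_real: "B x x = of_real (Re (B x x))"
  using cnj_swap[of x x] by (simp add: complex_eq_iff)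

text \<open>The positivity of the form at \<open>x - u y\<close>, where \<open>u\<close> is \<open>t\<close> times the phase of \<open>B x y\<close>.\<close>

lemma quadratic: "0 \<le> Re (B x x) - 2 * t * norm (B x y) + t^2 * Re (B y y)"
proof -
  define u where "u = of_real t * sgn (B x y)"
  have "sgn (B x y) * cnj (B x y) = of_real (norm (B x y))"
    by (cases "B x y = 0") (simp_all add: sgn_eq complex_norm_square[symmetric] power2_eq_square)
  then have 1: "u * B y x = of_real (t * norm (B x y))"
    unfolding u_def cnj_swap[symmetric, of x y] by simp
  then have 2: "cnj u * B x y = of_real (t * norm (B x y))"
    by (metis cnj_swap complex_cnj_complex_of_real complex_cnj_mult complex_cnj_cnj)
  have 3: "Re (u * (cnj u * B y y)) \<le> t^2 * Re (B y y)"
  proof -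
    have "norm (sgn (B x y))^2 \<le> 1" by (simp add: norm_sgn)
    then have "(norm u)^2 \<le> t^2" by (auto simp: u_def norm_mult norm_sgn)
    moreover have "Re (u * (cnj u * B y y)) = (norm u)^2 * Re (B y y)"
      by (simp add: mult.assoc[symmetric] flip: complex_norm_square of_real_power)
    ultimately show ?thesis using nonneg[of y] by (simp add: mult_right_mono)
  qed
  have "B (x - u *s y) (x - u *s y) = B x x - cnj u * B x y - u * B y x + u * (cnj u * B y y)"
    by (simp add: diff_left diff_right scale_left scale_right algebra_simps)
  then have "Re (B (x - u *s y) (x - u *s y)) = Re (B x x) - 2 * (t * norm (B x y)) + Re (u * (cnj u * B y y))"
    unfolding 1 2 by simp
  then show ?thesis using nonneg[of "x - u *s y"] 3 by simp
qed

lemma norm_le_average: "norm (B x y) \<le> (Re (B x x) + Re (B y y)) / 2"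
  using quadratic[of x 1 y] by simp

lemma null_vector: assumes "Re (B x x) = 0" shows "B y x = 0"
proof (rule ccontr)
  assume "B y x \<noteq> 0"
  then have n: "norm (B y x) > 0" by simp
  define t where "t = (Re (B y y) + 1) / (2 * norm (B y x))"
  show False using quadratic[of y t x] assms n by (simp add: t_def)
qed

lemma Cauchy_Schwarz: "norm (B x y) \<le> sqrt (Re (B x x)) * sqrt (Re (B y y))"
proof (cases "Re (B y y) = 0")
  case True
  then show ?thesis using null_vector by simp
next
  case False
  then have p: "Re (B y y) > 0" using nonneg[of y] by simp
  have "0 \<le> Re (B x x) - (norm (B x y))^2 / Re (B y y)"
    using quadratic[of x "norm (B x y) / Re (B y y)" y] p by (simp add: field_simps power2_eq_square)
  then have "(norm (B x y))^2 \<le> Re (B x x) * Re (B y y)" using p by (simp add: field_simps)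
  then show ?thesis by (metis real_le_rsqrt real_sqrt_mult)
qed

end

text \<open>A positive definite form whose norm is equivalent to the Euclidean one, with constant \<open>\<surd>K\<close> both ways.\<close>

locale inner_product = psd_form B for B :: "complex^'n \<Rightarrow> complex^'n \<Rightarrow> complex" +
  fixes K :: real
  assumes K_pos: "K > 0"
    and lower: "(norm x)^2 \<le> K * Re (B x x)"
    and upper: "Re (B x x) \<le> K * (norm x)^2"
begin

text \<open>The norm of the inner product \<open>B\<close>.\<close>

definition nm :: "complex^'n \<Rightarrow> real" where "nm x = sqrt (Re (B x x))"

lemma nm_nonneg [simp]: "0 \<le> nm x" using nonneg by (simp add: nm_def)

lemma nm_sq: "(nm x)^2 = Re (B x x)" using nonneg by (simp add: nm_def)

lemma nm_sq_complex: "of_real ((nm x)^2) = B x x"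
  using self_real[of x] unfolding nm_sq by simp

lemma norm_B_le: "norm (B x y) \<le> nm x * nm y"
  unfolding nm_def by (rule Cauchy_Schwarz)

lemma norm_le_nm: "norm x \<le> sqrt K * nm x"
  using lower[of x] unfolding nm_sq[symmetric]
  by (metis nm_nonneg real_le_rsqrt real_sqrt_mult real_sqrt_abs abs_of_nonneg)

lemma nm_le_norm: "nm x \<le> sqrt K * norm x"
  using upper[of x] unfolding nm_def
  by (metis norm_ge_zero real_sqrt_le_mono real_sqrt_mult real_sqrt_abs abs_of_nonneg)

lemma nm_eq_0: "nm x = 0 \<longleftrightarrow> x = 0"
  using norm_le_nm[of x] nm_def by auto

lemma nm_scale: "nm (a *s x) = norm a * nm x"
proof -
  have "B (a *s x) (a *s x) = of_real ((norm a)^2) * B x x"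
    unfolding scale_left scale_right complex_norm_square by simp
  then have "Re (B (a *s x) (a *s x)) = (norm a)^2 * Re (B x x)" by simp
  then show ?thesis by (simp add: nm_def real_sqrt_mult)
qed

lemma clinear_fun_B: "clinear_fun (\<lambda>v. B v y)"
  by (simp add: clinear_fun_def add_left scale_left)

lemma clinear_fun_B_matrix: "clinear_fun (\<lambda>v. B (M *v v) y)"
  by (simp add: clinear_fun_def matrix_vector_right_distrib matrix_vector_scale add_left scale_left)

lemma nm_matrix_bound: "\<exists>C\<ge>0. \<forall>x. nm (M *v x) \<le> C * nm x"
proof -
  obtain D where D: "\<And>x. norm (M *v x) \<le> norm x * D"
    using bounded_linear.bounded[OF matrix_vector_mul_bounded_linear[of M]] by blast
  have "nm (M *v x) \<le> (sqrt K * \<bar>D\<bar> * sqrt K) * nm x" for x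
  proof -
    have "nm (M *v x) \<le> sqrt K * norm (M *v x)" by (rule nm_le_norm)
    also have "\<dots> \<le> sqrt K * (norm x * \<bar>D\<bar>)"
      using D[of x] K_pos by (intro mult_left_mono order_trans[OF D] mult_left_mono) auto
    also have "\<dots> \<le> sqrt K * (sqrt K * nm x * \<bar>D\<bar>)"
      using norm_le_nm[of x] K_pos by (intro mult_left_mono mult_right_mono) auto
    finally show ?thesis by (simp only: ac_simps)
  qed
  moreover have "sqrt K * \<bar>D\<bar> * sqrt K \<ge> 0" using K_pos by simp
  ultimately show ?thesis by blast
qed

text \<open>The resolvent \<open>(w - A)\<^sup>-\<^sup>1\<close>, meaningful only when \<open>w\<close> is not an eigenvalue of \<open>A\<close>.\<close>

definition resolvent :: "complex^'n^'n \<Rightarrow> complex \<Rightarrow> complex^'n^'n" where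
  "resolvent A w = matrix_inv (mat w - A)"

end

section \<open>The resolvent on the boundary of a polygon\<close>

text \<open>A polygon together with an inner product; \<open>\<delta>\<close> is the margin that is kept between the numerical ranges of
  the matrices under consideration and the edges.\<close>

locale polygon_operator = convex_polygon N nu b c len + inner_product B K
  for N :: nat and nu b :: "nat \<Rightarrow> complex" and c len :: "nat \<Rightarrow> real"
  and B :: "complex^'n \<Rightarrow> complex^'n \<Rightarrow> complex" and K :: real +
  fixes \<delta> :: real
  assumes \<delta>_pos: "\<delta> > 0"
begin

text \<open>The numerical range of \<open>A\<close> lies inside the polygon, at distance at least \<open>\<delta>\<close> from the line of
  each edge.\<close>

definition strip :: "complex^'n^'n \<Rightarrow> bool" where
  "strip A \<longleftrightarrow> (\<forall>k<N. \<forall>x. Re (cnj (nu k) * B (A *v x) x) \<le> (c k - \<delta>) * (nm x)^2)"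

lemma Re_resolvent_form:
  assumes "strip A" "k < N" "w \<in> edge k"
  shows "\<delta> * (nm x)^2 \<le> Re (cnj (nu k) * B ((mat w - A) *v x) x)"
proof -
  have "cnj (nu k) * B ((mat w - A) *v x) x = of_real ((nm x)^2) * (cnj (nu k) * w) - cnj (nu k) * B (A *v x) x"
    unfolding mat_mult_vector_diff diff_left scale_left nm_sq_complex by (simp add: algebra_simps)
  also have "Re \<dots> = (nm x)^2 * Re (cnj (nu k) * w) - Re (cnj (nu k) * B (A *v x) x)"
    by (simp only: minus_complex.simps times_complex.simps Re_complex_of_real Im_complex_of_real mult_zero_left diff_0_right)
  finally have "Re (cnj (nu k) * B ((mat w - A) *v x) x) = (nm x)^2 * c k - Re (cnj (nu k) * B (A *v x) x)"
    unfolding edge_on_line[OF assms(2,3)] .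
  moreover have "Re (cnj (nu k) * B (A *v x) x) \<le> (c k - \<delta>) * (nm x)^2"
    using assms unfolding strip_def by blast
  ultimately show ?thesis by (simp add: algebra_simps)
qed

text \<open>Consequently \<open>w - A\<close> is injective on the boundary, and the norm of its inverse is at most \<open>1 / \<delta>\<close>.\<close>

lemma lower_resolvent:
  assumes "strip A" "k < N" "w \<in> edge k"
  shows "\<delta> * nm x \<le> nm ((mat w - A) *v x)"
proof (cases "nm x = 0")
  case False
  have "\<delta> * (nm x)^2 \<le> norm (cnj (nu k) * B ((mat w - A) *v x) x)"
    using Re_resolvent_form[OF assms, of x] complex_Re_le_cmod order_trans by blast
  also have "\<dots> \<le> nm ((mat w - A) *v x) * nm x"
    using unit[OF assms(2)] norm_B_le by (simp add: norm_mult)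
  finally show ?thesis
    using False nm_nonneg[of x] by (simp add: power2_eq_square order.not_eq_order_implies_strict)
qed auto

lemma resolvent_inverse:
  assumes "strip A" "k < N" "w \<in> edge k"
  shows "(mat w - A) ** resolvent A w = mat 1" "resolvent A w ** (mat w - A) = mat 1"
proof -
  have "inj ((*v) (mat w - A))"
  proof (rule injI)
    fix x y assume "(mat w - A) *v x = (mat w - A) *v y"
    then have "nm ((mat w - A) *v (x - y)) = 0" by (simp add: matrix_vector_mult_diff_distrib nm_eq_0)
    then have "nm (x - y) \<le> 0" using lower_resolvent[OF assms, of "x - y"] \<delta>_pos
      by (simp add: mult_le_0_iff)
    then show "x = y" using nm_nonneg[of "x - y"] nm_eq_0[of "x - y"] by simp
  qed
  then have "invertible (mat w - A)"
    using invertible_left_inverse matrix_left_invertible_injective by blast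
  then show "(mat w - A) ** resolvent A w = mat 1" "resolvent A w ** (mat w - A) = mat 1"
    using someI_ex[of "\<lambda>A'. (mat w - A) ** A' = mat 1 \<and> A' ** (mat w - A) = mat 1"]
    unfolding resolvent_def matrix_inv_def invertible_def by blast+
qed

lemma resolvent_apply:
  assumes "strip A" "k < N" "w \<in> edge k"
  shows "(mat w - A) *v (resolvent A w *v x) = x" "resolvent A w *v ((mat w - A) *v x) = x"
  using resolvent_inverse[OF assms] by (simp_all add: matrix_vector_mul_assoc)

lemma nm_resolvent:
  assumes "strip A" "k < N" "w \<in> edge k"
  shows "nm (resolvent A w *v x) \<le> nm x / \<delta>"
  using lower_resolvent[OF assms, of "resolvent A w *v x"] \<delta>_pos resolvent_apply[OF assms]
  by (simp add: field_simps)

lemma resolvent_difference: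
  assumes "strip A" "strip A'" "k < N" "w \<in> edge k" "v \<in> edge k"
  shows "resolvent A w *v x - resolvent A' v *v x
    = resolvent A w *v (((mat v - A') - (mat w - A)) *v (resolvent A' v *v x))"
  using resolvent_apply[OF assms(1,3,4)] resolvent_apply[OF assms(2,3,5)]
  by (simp add: matrix_vector_mult_diff_rdistrib[of "mat v - A'"] matrix_vector_mult_diff_distrib)

lemma resolvent_identity:
  assumes "strip A" "k < N" "w \<in> edge k" "v \<in> edge k"
  shows "resolvent A w *v x - resolvent A v *v x = (v - w) *s (resolvent A w *v (resolvent A v *v x))"
proof -
  have "(mat v - A) - (mat w - A) = mat (v - w)" by (simp add: mat_diff)
  then show ?thesis using resolvent_difference[OF assms(1,1-4), of x] by (simp only: mat_vector_mult matrix_vector_scale)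
qed

lemma continuous_resolvent:
  assumes A: "strip A" and k: "k < N" and z: "continuous_on (edge k) z"
  shows "continuous_on (edge k) (\<lambda>w. resolvent A w *v z w)"
  unfolding continuous_on_def
proof
  fix v assume v: "v \<in> edge k"
  have "((\<lambda>w. resolvent A w *v z w - resolvent A v *v z v) \<longlongrightarrow> 0) (at v within edge k)"
  proof (rule Lim_null_comparison)
    define C where "C = nm (resolvent A v *v z v)"
    show "\<forall>\<^sub>F w in at v within edge k. norm (resolvent A w *v z w - resolvent A v *v z v)
        \<le> sqrt K * (sqrt K * norm (z w - z v) / \<delta>) + sqrt K * (norm (v - w) * (C / \<delta>))"
      unfolding eventually_at_filter
    proof (intro always_eventually allI impI)
      fix w assume w: "w \<in> edge k"
      have "resolvent A w *v z w - resolvent A v *v z v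
        = resolvent A w *v (z w - z v) + (v - w) *s (resolvent A w *v (resolvent A v *v z v))"
        unfolding resolvent_identity[OF A k w v, symmetric] by (simp add: matrix_vector_mult_diff_distrib)
      then have "norm (resolvent A w *v z w - resolvent A v *v z v)
        \<le> norm (resolvent A w *v (z w - z v)) + norm ((v - w) *s (resolvent A w *v (resolvent A v *v z v)))"
        by (metis norm_triangle_ineq)
      also have "\<dots> \<le> sqrt K * nm (resolvent A w *v (z w - z v)) + sqrt K * nm ((v - w) *s (resolvent A w *v (resolvent A v *v z v)))"
        by (intro add_mono norm_le_nm)
      also have "\<dots> \<le> sqrt K * (sqrt K * norm (z w - z v) / \<delta>) + sqrt K * (norm (v - w) * (C / \<delta>))"
        unfolding nm_scale C_def
      proof (intro add_mono mult_left_mono)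
        show "nm (resolvent A w *v (z w - z v)) \<le> sqrt K * norm (z w - z v) / \<delta>"
          using nm_resolvent[OF A k w] nm_le_norm \<delta>_pos by (meson divide_right_mono less_imp_le order_trans)
      qed (use nm_resolvent[OF A k w] K_pos in auto)
      finally show "norm (resolvent A w *v z w - resolvent A v *v z v)
        \<le> sqrt K * (sqrt K * norm (z w - z v) / \<delta>) + sqrt K * (norm (v - w) * (C / \<delta>))" .
    qed
    have zt: "(z \<longlongrightarrow> z v) (at v within edge k)" using z v continuous_on_def by blast
    have "((\<lambda>w. sqrt K * (sqrt K * norm (z w - z v) / \<delta>) + sqrt K * (norm (v - w) * (C / \<delta>))) \<longlongrightarrow>
       sqrt K * (sqrt K * norm (z v - z v) / \<delta>) + sqrt K * (norm (v - v) * (C / \<delta>))) (at v within edge k)"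
      by (intro tendsto_intros zt) (use \<delta>_pos in auto)
    then show "((\<lambda>w. sqrt K * (sqrt K * norm (z w - z v) / \<delta>) + sqrt K * (norm (v - w) * (C / \<delta>))) \<longlongrightarrow> 0) (at v within edge k)"
      by simp
  qed
  then show "((\<lambda>w. resolvent A w *v z w) \<longlongrightarrow> resolvent A v *v z v) (at v within edge k)"
    using Lim_null by blast
qed

lemma resolvent_derivative:
  assumes A: "strip A" and k: "k < N" and v: "v \<in> edge k" and l: "clinear_fun l"
  shows "((\<lambda>w. l (resolvent A w *v x)) has_field_derivative - l (resolvent A v *v (resolvent A v *v x))) (at v within edge k)"
  unfolding has_field_derivative_iff
proof (rule Lim_transform_eventually)
  have "continuous_on (edge k) (\<lambda>w. l (resolvent A w *v (resolvent A v *v x)))"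
    by (intro bounded_linear.continuous_on[OF clinear_fun_bounded[OF l]] continuous_resolvent A k continuous_on_const)
  then show "((\<lambda>w. - l (resolvent A w *v (resolvent A v *v x))) \<longlongrightarrow> - l (resolvent A v *v (resolvent A v *v x))) (at v within edge k)"
    using v unfolding continuous_on_def by (intro tendsto_minus) blast
  show "\<forall>\<^sub>F w in at v within edge k. - l (resolvent A w *v (resolvent A v *v x)) =
      (l (resolvent A w *v x) - l (resolvent A v *v x)) / (w - v)"
    unfolding eventually_at_filter
  proof (intro always_eventually allI impI)
    fix w assume w: "w \<noteq> v" "w \<in> edge k"
    have "l (resolvent A w *v x) - l (resolvent A v *v x) = (v - w) * l (resolvent A w *v (resolvent A v *v x))"
      unfolding clinear_fun_diff[OF l, symmetric] resolvent_identity[OF A k w(2) v] clinear_fun_scale[OF l] ..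
    then show "- l (resolvent A w *v (resolvent A v *v x)) = (l (resolvent A w *v x) - l (resolvent A v *v x)) / (w - v)"
      using w(1) by (simp add: field_simps)
  qed
qed

lemma bd_cont_resolvent:
  assumes "strip A" "clinear_fun l"
  shows "bd_cont (\<lambda>k w. l (resolvent A w *v x))"
  unfolding bd_cont_def using assms
  by (intro allI impI bounded_linear.continuous_on[OF clinear_fun_bounded] continuous_resolvent continuous_on_const)

end

section \<open>The integral of the resolvent\<close>

context polygon_operator
begin

text \<open>The integral of the resolvent is constant along a segment of commuting matrices. The formal
  derivative of the resolvent in the direction \<open>D\<close> is \<open>R D R = D R R\<close>, which is minus the derivative of \<open>D R\<close> in the
  spectral variable and integrates to zero over a closed path. Instead of differentiating under the integral sign,
  the proof estimates the increment of the integral by the square of the parameter increment.\<close>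

lemma resolvent_integral_homotopy:
  assumes strip: "\<And>s. s \<in> {0..1} \<Longrightarrow> strip (A s)"
    and A: "\<And>s t. A s - A t = mat (of_real (s - t)) ** D"
    and comm: "\<And>s. A s ** D = D ** A s"
  shows "bd_int (\<lambda>k w. nu k * B (resolvent (A 0) w *v x) y) = bd_int (\<lambda>k w. nu k * B (resolvent (A 1) w *v x) y)"
proof -
  define J where "J s = bd_int (\<lambda>k w. nu k * B (resolvent (A s) w *v x) y)" for s :: real
  obtain CD where CD: "CD \<ge> 0" "\<And>v. nm (D *v v) \<le> CD * nm v" using nm_matrix_bound by blast
  define C where "C = CD / \<delta> * (CD / \<delta> * (nm x / \<delta>)) * nm y"
  have C: "C \<ge> 0" using CD \<delta>_pos by (simp add: C_def)
  have ADv: "(mat w - A s) *v (D *v v) = D *v ((mat w - A s) *v v)" for s w v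
  proof -
    have "A s *v (D *v v) = D *v (A s *v v)" unfolding matrix_vector_mul_assoc comm ..
    then show ?thesis by (simp add: mat_mult_vector_diff matrix_vector_mult_diff_distrib matrix_vector_scale)
  qed
  have RD: "resolvent (A s) w *v (D *v v) = D *v (resolvent (A s) w *v v)"
    if "s \<in> {0..1}" "k < N" "w \<in> edge k" for s k w v
    using resolvent_apply[OF strip[OF that(1)] that(2,3)] ADv by metis
  have step: "resolvent (A s) w *v v - resolvent (A t) w *v v
      = of_real (s - t) *s (resolvent (A s) w *v (D *v (resolvent (A t) w *v v)))"
    if "s \<in> {0..1}" "t \<in> {0..1}" "k < N" "w \<in> edge k" for s t k w v
  proof -
    have "(mat w - A t) - (mat w - A s) = mat (of_real (s - t)) ** D" using A[of s t] by simp
    then show ?thesis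
      using resolvent_difference[OF strip[OF that(1)] strip[OF that(2)] that(3,4,4), of v]
      by (simp only: matrix_vector_mul_assoc[symmetric] mat_vector_mult matrix_vector_scale)
  qed
  have quad: "norm (J s - J t) \<le> perimeter * C * (s - t)^2" if s: "s \<in> {0..1}" and t: "t \<in> {0..1}" for s t
  proof -
    define l where "l v = B (D *v v) y" for v
    have l: "clinear_fun l" unfolding l_def by (rule clinear_fun_B_matrix)
    define e where "e w = B (resolvent (A s) w *v x) y - B (resolvent (A t) w *v x) y
       - of_real (s - t) * l (resolvent (A t) w *v (resolvent (A t) w *v x))" for w
    have cont1: "bd_cont (\<lambda>k w. B (resolvent (A r) w *v x) y)" if "r \<in> {0..1}" for r
      by (rule bd_cont_resolvent[OF strip[OF that] clinear_fun_B])
    have cont2: "bd_cont (\<lambda>k w. l (resolvent (A t) w *v (resolvent (A t) w *v x)))"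
      unfolding bd_cont_def using strip[OF t] 
      by (intro allI impI bounded_linear.continuous_on[OF clinear_fun_bounded[OF l]] continuous_resolvent continuous_on_const)
    have e: "norm (e w) \<le> C * (s - t)^2" if k: "k < N" "w \<in> edge k" for k w
    proof -
      define p where "p = D *v (resolvent (A t) w *v x)"
      have "resolvent (A t) w *v p = D *v (resolvent (A t) w *v (resolvent (A t) w *v x))"
        unfolding p_def RD[OF t k] ..
      moreover have "B (resolvent (A s) w *v x) y - B (resolvent (A t) w *v x) y = of_real (s - t) * B (resolvent (A s) w *v p) y"
        unfolding diff_left[symmetric] step[OF s t k] scale_left p_def ..
      ultimately have "e w = of_real (s - t) * B (resolvent (A s) w *v p - resolvent (A t) w *v p) y"
        unfolding e_def l_def diff_left by (simp add: right_diff_distrib)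
      also have "\<dots> = of_real ((s - t)^2) * B (resolvent (A s) w *v (D *v (resolvent (A t) w *v p))) y"
        unfolding step[OF s t k] scale_left by (simp add: power2_eq_square)
      also have "norm \<dots> \<le> (s - t)^2 * C"
      proof -
        have "nm (resolvent (A s) w *v (D *v (resolvent (A t) w *v p))) \<le> CD * (nm p / \<delta>) / \<delta>"
          using nm_resolvent[OF strip[OF s] k] nm_resolvent[OF strip[OF t] k] CD \<delta>_pos
          by (meson divide_right_mono less_imp_le mult_left_mono order_trans)
        also have "\<dots> \<le> CD * (CD * (nm x / \<delta>) / \<delta>) / \<delta>"
          unfolding p_def using nm_resolvent[OF strip[OF t] k] CD \<delta>_pos
          by (intro divide_right_mono mult_left_mono order_trans[OF CD(2)]) auto
        finally have "nm (resolvent (A s) w *v (D *v (resolvent (A t) w *v p))) * nm y \<le> C"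
          unfolding C_def by (intro mult_right_mono) auto
        then have "norm (B (resolvent (A s) w *v (D *v (resolvent (A t) w *v p))) y) \<le> C"
          using norm_B_le order_trans by blast
        then show ?thesis unfolding norm_mult norm_of_real by (simp add: mult_left_mono)
      qed
      finally show ?thesis by (simp add: mult.commute)
    qed
    have "bd_int (\<lambda>k w. nu k * l (resolvent (A t) w *v (resolvent (A t) w *v x))) = 0"
    proof (rule bd_int_primitive)
      fix k w assume "k < N" "w \<in> edge k"
      from DERIV_minus[OF resolvent_derivative[OF strip[OF t] this l]]
      show "((\<lambda>w. - l (resolvent (A t) w *v x)) has_field_derivative l (resolvent (A t) w *v (resolvent (A t) w *v x))) (at w within edge k)"
        by simp
    qed
    then have 0: "bd_int (\<lambda>k w. of_real (s - t) * (nu k * l (resolvent (A t) w *v (resolvent (A t) w *v x)))) = 0"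
      by (subst bd_int_mult) (auto intro!: bd_cont_mult cont2)
    have conte: "bd_cont (\<lambda>k w. nu k * e w)"
      unfolding e_def by (intro bd_cont_mult bd_cont_const bd_cont_diff cont1 cont2 s t)
    have "J s - J t = bd_int (\<lambda>k w. nu k * B (resolvent (A s) w *v x) y - nu k * B (resolvent (A t) w *v x) y)"
      unfolding J_def by (intro bd_int_diff[symmetric] bd_cont_mult bd_cont_const cont1 s t)
    also have "\<dots> = bd_int (\<lambda>k w. nu k * e w + of_real (s - t) * (nu k * l (resolvent (A t) w *v (resolvent (A t) w *v x))))"
      unfolding e_def by (simp add: algebra_simps)
    also have "\<dots> = bd_int (\<lambda>k w. nu k * e w)"
      unfolding 0[symmetric] using 0 by (subst bd_int_add) (auto intro!: bd_cont_mult cont2 conte)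
    also have "norm \<dots> \<le> perimeter * (C * (s - t)^2)"
      using unit e by (intro bd_int_norm_const conte) (simp add: norm_mult)
    finally show ?thesis by (simp add: mult.assoc)
  qed
  have "\<exists>c. \<forall>s\<in>{0..1::real}. J s = c"
  proof (rule has_derivative_zero_constant)
    fix t :: real assume t: "t \<in> {0..1}"
    have "((\<lambda>s. (J s - J t) /\<^sub>R norm (s - t)) \<longlongrightarrow> 0) (at t within {0..1})"
    proof (rule Lim_null_comparison)
      show "\<forall>\<^sub>F s in at t within {0..1}. norm ((J s - J t) /\<^sub>R norm (s - t)) \<le> perimeter * C * \<bar>s - t\<bar>"
        unfolding eventually_at_filter
      proof (intro always_eventually allI impI)
        fix s assume s: "s \<noteq> t" "s \<in> {0..1}"
        have "norm ((J s - J t) /\<^sub>R norm (s - t)) \<le> (perimeter * C * (s - t)^2) / \<bar>s - t\<bar>"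
          using quad[OF s(2) t] s(1) by (simp add: divide_simps)
        also have "\<dots> = perimeter * C * \<bar>s - t\<bar>"
          unfolding power2_eq_square abs_mult_self_eq[of "s - t", symmetric] using s(1) by (simp del: abs_mult_self_eq)
        finally show "norm ((J s - J t) /\<^sub>R norm (s - t)) \<le> perimeter * C * \<bar>s - t\<bar>" .
      qed
      have "((\<lambda>s. perimeter * C * \<bar>s - t\<bar>) \<longlongrightarrow> perimeter * C * \<bar>t - t\<bar>) (at t within {0..1})"
        by (intro tendsto_intros)
      then show "((\<lambda>s. perimeter * C * \<bar>s - t\<bar>) \<longlongrightarrow> 0) (at t within {0..1})" by simp
    qed
    then show "(J has_derivative (\<lambda>h. 0)) (at t within {0..1})"
      by (simp add: has_derivative_within divide_inverse)
  qed auto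
  then have "J 0 = J 1" by (metis atLeastAtMost_iff order_refl zero_le_one)
  then show ?thesis by (simp add: J_def)
qed

text \<open>The matrix is contracted to a scalar matrix \<open>mat z\<close> with \<open>z\<close> in the numerical range; for that one the
  integral is the index of the polygon about \<open>z\<close>.\<close>

lemma resolvent_integral:
  assumes T: "strip T" shows "bd_int (\<lambda>k w. nu k * B (resolvent T w *v x) y) = 2 * pi * B x y"
proof (cases "x = 0")
  case True
  then show ?thesis by (simp add: bd_int_def)
next
  case False
  then have nx: "nm x > 0" using nm_eq_0 nm_nonneg[of x] by (metis order_le_less)
  define z where "z = B (T *v x) x / of_real ((nm x)^2)"
  have z: "Re (cnj (nu k) * z) \<le> c k - \<delta>" if "k < N" for k
  proof -
    have "Re (cnj (nu k) * B (T *v x) x) \<le> (c k - \<delta>) * (nm x)^2" using T that unfolding strip_def by blast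
    moreover have "Re (cnj (nu k) * z) = Re (cnj (nu k) * B (T *v x) x) / (nm x)^2"
      unfolding z_def times_divide_eq_right by (rule Re_divide_of_real)
    ultimately show ?thesis using nx by (simp add: pos_divide_le_eq)
  qed
  then have zr: "z \<in> region" using \<delta>_pos unfolding region_def by fastforce
  define A where "A s = mat z + mat (of_real s) ** (T - mat z)" for s :: real
  have Av: "A s *v v = of_real (1 - s) *s (z *s v) + of_real s *s (T *v v)" for s v
    unfolding A_def by (simp add: matrix_vector_mult_add_rdistrib matrix_vector_mul_assoc[symmetric] mat_vector_mult
      matrix_vector_mult_diff_rdistrib vec_eq_iff algebra_simps)
  have stripA: "strip (A s)" if s: "s \<in> {0..1}" for s
    unfolding strip_def
  proof (intro allI impI)
    fix k v assume k: "k < N"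
    have "cnj (nu k) * B (A s *v v) v = of_real ((1 - s) * (nm v)^2) * (cnj (nu k) * z) + of_real s * (cnj (nu k) * B (T *v v) v)"
      unfolding Av add_left scale_left nm_sq_complex of_real_mult by (simp add: algebra_simps)
    then have "Re (cnj (nu k) * B (A s *v v) v) = (1 - s) * (nm v)^2 * Re (cnj (nu k) * z) + s * Re (cnj (nu k) * B (T *v v) v)"
      by (simp only: plus_complex.simps times_complex.simps Re_complex_of_real Im_complex_of_real mult_zero_left diff_0_right)
    also have "\<dots> \<le> (1 - s) * (nm v)^2 * (c k - \<delta>) + s * ((c k - \<delta>) * (nm v)^2)"
      using s z[OF k] T k unfolding strip_def by (intro add_mono mult_left_mono) auto
    finally show "Re (cnj (nu k) * B (A s *v v) v) \<le> (c k - \<delta>) * (nm v)^2" by (simp add: algebra_simps)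
  qed
  have A1: "A 1 = T" by (simp add: A_def)
  have A0: "A 0 = mat z" by (simp add: A_def vec_eq_iff mat_matrix_mult_component)
  have "resolvent (mat z) w *v x = (1 / (w - z)) *s x" if k: "k < N" "w \<in> edge k" for k w
  proof -
    have wz: "w \<noteq> z" using edge_not_region[OF k zr] .
    have "(mat w - mat z) *v ((1 / (w - z)) *s x) = x"
      using wz by (simp add: mat_vector_mult flip: mat_diff)
    moreover have "strip (mat z)" using stripA[of 0] A0 by simp
    ultimately show ?thesis using resolvent_apply(2)[OF _ k, of "mat z" "(1 / (w - z)) *s x"] by simp
  qed
  then have "bd_int (\<lambda>k w. nu k * B (resolvent (A 0) w *v x) y) = bd_int (\<lambda>k w. B x y * (nu k * (1 / (w - z))))"
    unfolding A0 by (intro bd_int_cong) (simp add: scale_left)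
  also have "\<dots> = B x y * (2 * pi)"
    using bd_int_mult[OF bd_cont_mult[OF bd_cont_const[of nu] bd_cont_kernel[OF zr]], of "B x y"] kernel_integral[OF zr] by simp
  finally have 0: "bd_int (\<lambda>k w. nu k * B (resolvent (A 0) w *v x) y) = 2 * pi * B x y" by simp
  have "A s - A t = mat (of_real (s - t)) ** (T - mat z)" for s t
    unfolding A_def by (simp add: vec_eq_iff mat_matrix_mult_component algebra_simps)
  moreover have "A s ** (T - mat z) = (T - mat z) ** A s" for s
  proof -
    have "A s ** (T - mat z) = mat z ** (T - mat z) + mat (of_real s) ** (T - mat z) ** (T - mat z)"
      by (simp add: A_def vec_eq_iff matrix_matrix_mult_def[of "_ + _"] matrix_matrix_mult_def[of _ "T - mat z"] distrib_right sum.distrib)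
    also have "\<dots> = (T - mat z) ** mat z + (T - mat z) ** (mat (of_real s) ** (T - mat z))"
      by (metis mat_commute matrix_mul_assoc)
    also have "\<dots> = (T - mat z) ** A s" by (simp add: A_def matrix_add_ldistrib)
    finally show ?thesis .
  qed
  ultimately show ?thesis using resolvent_integral_homotopy[of A "T - mat z" x y] stripA 0 A1 by simp
qed

end

section \<open>Holomorphic functions of a matrix\<close>

text \<open>The relation "\<open>F\<close> is a value of \<open>\<phi>\<close> at \<open>T\<close>": the function \<open>\<phi> - F\<close> is a multiple of \<open>z - T\<close> with
  holomorphic entries. It is visibly compatible with sums and products, and the Cauchy integral formula follows
  from it (lemma \<open>fun_calc_Cauchy\<close>). Uniqueness of \<open>F\<close> and a general existence result are not needed.\<close>

definition fun_calc :: "complex set \<Rightarrow> complex^'n^'n \<Rightarrow> (complex \<Rightarrow> complex) \<Rightarrow> complex^'n^'n \<Rightarrow> bool" where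
  "fun_calc S T \<phi> F \<longleftrightarrow> \<phi> holomorphic_on S \<and>
     (\<exists>G. (\<forall>i j. (\<lambda>z. G z $ i $ j) holomorphic_on S) \<and>
          (\<forall>z\<in>S. mat (\<phi> z) - F = (mat z - T) ** G z))"

lemma matrix_vector_axis: "(A *v axis j 1) $ i = A $ i $ j" for A :: "complex^'n^'m"
  by (simp add: matrix_vector_mult_def axis_def if_distrib [of "\<lambda>x. y * x" for y] cong: if_cong)

lemma fun_calc_subset: "fun_calc S T \<phi> F \<Longrightarrow> S' \<subseteq> S \<Longrightarrow> fun_calc S' T \<phi> F"
  unfolding fun_calc_def by (meson holomorphic_on_subset subsetD)

lemma fun_calc_const: "fun_calc S T (\<lambda>z. a) (mat a)"
  unfolding fun_calc_def
  by (intro conjI exI[of _ "\<lambda>z. 0"]) (auto simp: vec_eq_iff matrix_matrix_mult_def intro: holomorphic_on_const)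

lemma fun_calc_ident: "fun_calc S T (\<lambda>z. z) T"
  unfolding fun_calc_def
  by (intro conjI exI[of _ "\<lambda>z. mat 1"]) (auto intro!: holomorphic_intros)

lemma fun_calc_add:
  assumes "fun_calc S T \<phi> F" "fun_calc S T \<psi> F'"
  shows "fun_calc S T (\<lambda>z. \<phi> z + \<psi> z) (F + F')"
proof -
  obtain G G' where G: "\<forall>i j. (\<lambda>z. G z $ i $ j) holomorphic_on S" "\<forall>z\<in>S. mat (\<phi> z) - F = (mat z - T) ** G z"
    and G': "\<forall>i j. (\<lambda>z. G' z $ i $ j) holomorphic_on S" "\<forall>z\<in>S. mat (\<psi> z) - F' = (mat z - T) ** G' z"
    using assms unfolding fun_calc_def by blast
  have "mat (\<phi> z + \<psi> z) - (F + F') = (mat z - T) ** (G z + G' z)" if "z \<in> S" for z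
    unfolding matrix_add_ldistrib using bspec[OF G(2) that, symmetric] bspec[OF G'(2) that, symmetric]
    by (simp add: vec_eq_iff mat_def)
  then show ?thesis
    unfolding fun_calc_def using G(1) G'(1) assms
    by (intro conjI exI[of _ "\<lambda>z. G z + G' z"]) (auto simp: fun_calc_def intro!: holomorphic_intros)
qed

lemma fun_calc_mult:
  assumes "fun_calc S T \<phi> F" "fun_calc S T \<psi> F'"
  shows "fun_calc S T (\<lambda>z. \<phi> z * \<psi> z) (F ** F')"
proof -
  obtain G G' where G: "\<forall>i j. (\<lambda>z. G z $ i $ j) holomorphic_on S" "\<forall>z\<in>S. mat (\<phi> z) - F = (mat z - T) ** G z"
    and G': "\<forall>i j. (\<lambda>z. G' z $ i $ j) holomorphic_on S" "\<forall>z\<in>S. mat (\<psi> z) - F' = (mat z - T) ** G' z"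
    using assms unfolding fun_calc_def by blast
  define M where "M z = mat (\<phi> z) ** G' z + G z ** F'" for z
  have "mat (\<phi> z * \<psi> z) - F ** F' = (mat z - T) ** M z" if z: "z \<in> S" for z
  proof -
    have "(mat z - T) ** M z = mat (\<phi> z) ** ((mat z - T) ** G' z) + ((mat z - T) ** G z) ** F'"
      unfolding M_def matrix_add_ldistrib matrix_mul_assoc mat_commute[of "\<phi> z" "mat z - T"] ..
    also have "\<dots> = mat (\<phi> z) ** (mat (\<psi> z) - F') + (mat (\<phi> z) - F) ** F'"
      using G(2) G'(2) z by simp
    also have "\<dots> = mat (\<phi> z) ** mat (\<psi> z) - F ** F'"
      unfolding matrix_mult_diff_left matrix_mult_diff_right by simp
    also have "mat (\<phi> z) ** mat (\<psi> z) = (mat (\<phi> z * \<psi> z) :: complex^'a^'a)"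
      by (simp add: vec_eq_iff mat_matrix_mult_component) (simp add: mat_def)
    finally show ?thesis by simp
  qed
  moreover have "(\<lambda>z. M z $ i $ j) holomorphic_on S" for i j
  proof -
    have "(\<lambda>z. \<phi> z * G' z $ i $ j + (\<Sum>k\<in>UNIV. G z $ i $ k * F' $ k $ j)) holomorphic_on S"
      using G(1) G'(1) assms(1) by (intro holomorphic_intros) (auto simp: fun_calc_def)
    then show ?thesis unfolding M_def by (simp add: mat_matrix_mult_component) (simp add: matrix_matrix_mult_def)
  qed
  ultimately show ?thesis
    using assms unfolding fun_calc_def by (intro conjI exI[of _ M]) (auto intro!: holomorphic_intros)
qed

context polygon_operator
begin

lemma bd_cont_sum: "(\<And>i. i \<in> I \<Longrightarrow> bd_cont (f i)) \<Longrightarrow> bd_cont (\<lambda>k w. \<Sum>i\<in>I. f i k w)"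
  unfolding bd_cont_def by (auto intro!: continuous_intros)

lemma bd_int_sum:
  assumes "finite I" "\<And>i. i \<in> I \<Longrightarrow> bd_cont (f i)"
  shows "bd_int (\<lambda>k w. \<Sum>i\<in>I. f i k w) = (\<Sum>i\<in>I. bd_int (f i))"
  using assms
proof (induction I rule: finite_induct)
  case empty
  then show ?case by (simp add: bd_int_def)
next
  case (insert i I)
  then show ?case by (simp add: bd_int_add bd_cont_sum)
qed

lemma fun_calc_Cauchy:
  assumes T: "strip T" and calc: "fun_calc S T \<phi> F" and S: "open S" "convex S" "\<And>k. k < N \<Longrightarrow> edge k \<subseteq> S"
  shows "bd_int (\<lambda>k w. nu k * (\<phi> w * B (resolvent T w *v x) y)) = 2 * pi * B (F *v x) y"
proof -
  obtain G where G: "\<forall>i j. (\<lambda>z. G z $ i $ j) holomorphic_on S" "\<forall>z\<in>S. mat (\<phi> z) - F = (mat z - T) ** G z"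
    using calc unfolding fun_calc_def by blast
  have "B (G w *v x) y = (\<Sum>i\<in>UNIV. (\<Sum>j\<in>UNIV. G w $ i $ j * x $ j) * B (axis i 1) y)" for w
    by (subst clinear_fun_expand[OF clinear_fun_B]) (simp add: matrix_vector_mult_def)
  moreover have "(\<lambda>w. \<Sum>i\<in>UNIV. (\<Sum>j\<in>UNIV. G w $ i $ j * x $ j) * B (axis i 1) y) holomorphic_on S"
    using G(1) by (intro holomorphic_intros) auto
  ultimately have hol: "(\<lambda>w. B (G w *v x) y) holomorphic_on S" by simp
  have "\<phi> w * B (resolvent T w *v x) y = B (resolvent T w *v (F *v x)) y + B (G w *v x) y"
    if k: "k < N" "w \<in> edge k" for k w
  proof -
    have "mat (\<phi> w) - F = (mat w - T) ** G w" using G(2) S(3)[OF k(1)] k(2) by blast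
    then have "(mat w - T) *v (G w *v x) = \<phi> w *s x - F *v x"
      by (metis matrix_vector_mul_assoc mat_mult_vector_diff)
    then have "G w *v x = resolvent T w *v (\<phi> w *s x - F *v x)"
      using resolvent_apply(2)[OF T k, of "G w *v x"] by simp
    also have "\<dots> = \<phi> w *s (resolvent T w *v x) - resolvent T w *v (F *v x)"
      by (simp add: matrix_vector_mult_diff_distrib matrix_vector_scale)
    finally show ?thesis by (simp add: diff_left scale_left)
  qed
  then have "bd_int (\<lambda>k w. nu k * (\<phi> w * B (resolvent T w *v x) y))
    = bd_int (\<lambda>k w. nu k * B (resolvent T w *v (F *v x)) y + nu k * B (G w *v x) y)"
    by (intro bd_int_cong) (simp add: distrib_left)
  also have "\<dots> = 2 * pi * B (F *v x) y"
    using bd_int_holomorphic[OF hol S] resolvent_integral[OF T] bd_cont_holo[OF hol S(3)]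
    by (subst bd_int_add) (auto intro!: bd_cont_mult bd_cont_const bd_cont_resolvent[OF T clinear_fun_B])
  finally show ?thesis .
qed

text \<open>A bound that depends on the polygon, used only to see that a supremum is finite.\<close>

lemma fun_calc_bounded:
  assumes T: "strip T" and calc: "fun_calc S T \<phi> F" and S: "open S" "convex S" "\<And>k. k < N \<Longrightarrow> edge k \<subseteq> S"
    and le1: "\<And>w. w \<in> S \<Longrightarrow> norm (\<phi> w) \<le> 1"
  shows "nm (F *v x) \<le> perimeter / (2 * pi * \<delta>) * nm x"
proof (cases "nm (F *v x) = 0")
  case True
  then show ?thesis using perimeter_nonneg \<delta>_pos by simp
next
  case False
  then have pos: "nm (F *v x) > 0" using nm_nonneg[of "F *v x"] by linarith
  define y where "y = F *v x"
  have cf: "bd_cont (\<lambda>k. \<phi>)" using calc S bd_cont_holo unfolding fun_calc_def by blast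
  have "2 * pi * (nm y)^2 = norm (2 * pi * B (F *v x) y)"
    using nm_sq_complex[of y, symmetric] by (simp add: norm_mult y_def norm_power)
  also have "\<dots> = norm (bd_int (\<lambda>k w. nu k * (\<phi> w * B (resolvent T w *v x) y)))"
    by (simp add: fun_calc_Cauchy[OF T calc S])
  also have "\<dots> \<le> perimeter * (nm x / \<delta> * nm y)"
  proof (rule bd_int_norm_const)
    show "bd_cont (\<lambda>k w. nu k * (\<phi> w * B (resolvent T w *v x) y))"
      by (intro bd_cont_mult bd_cont_const cf bd_cont_resolvent[OF T clinear_fun_B])
    fix k w assume k: "k < N" "w \<in> edge k"
    have "norm (B (resolvent T w *v x) y) \<le> nm x / \<delta> * nm y"
      using norm_B_le nm_resolvent[OF T k] by (meson mult_right_mono nm_nonneg order_trans)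
    moreover have "norm (\<phi> w) \<le> 1" using le1 S(3) k by blast
    ultimately show "norm (nu k * (\<phi> w * B (resolvent T w *v x) y)) \<le> nm x / \<delta> * nm y"
      using unit[OF k(1)] mult_mono[of "norm (\<phi> w)" 1] by (simp add: norm_mult)
  qed
  finally have "2 * pi * nm y * nm y \<le> perimeter * (nm x / \<delta>) * nm y" by (simp add: power2_eq_square mult.assoc)
  then have "2 * pi * nm y \<le> perimeter * (nm x / \<delta>)"
    by (rule mult_right_le_imp_le) (use pos in \<open>simp add: y_def\<close>)
  then show ?thesis using \<delta>_pos by (simp add: y_def field_simps)
qed

text \<open>The central estimate. The function \<open>g\<close> is the Cauchy transform of the conjugate of \<open>\<phi>\<close>, and \<open>G\<close> is its value
  at \<open>T\<close>. The last property says that \<open>F\<close> plus the adjoint of \<open>G\<close> has norm at most \<open>2\<close>. It is obtained by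
  integrating \<open>\<phi>\<close> against the positive semidefinite forms \<open>P k w\<close> given by twice the Hermitian part of \<open>nu k * resolvent T w\<close>.\<close>

lemma conjugate_partner:
  assumes T: "strip T" and calc: "fun_calc S T \<phi> F" and S: "open S" "convex S" "\<And>k. k < N \<Longrightarrow> edge k \<subseteq> S" "region \<subseteq> S"
    and le1: "\<And>w. w \<in> S \<Longrightarrow> norm (\<phi> w) \<le> 1"
  obtains g G where "fun_calc region T g G" "\<And>z. z \<in> region \<Longrightarrow> norm (g z) \<le> 1"
    "\<And>x y. norm (B (F *v x) y + B x (G *v y)) \<le> (nm x)^2 + (nm y)^2"
proof
  define g where "g = cauchy_conj \<phi>"
  define G :: "complex^'n^'n" where "G = (\<chi> i j. bd_int (\<lambda>k w. nu k * (cnj (\<phi> w) * resolvent T w $ i $ j)) / (2 * pi))"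
  define H :: "complex \<Rightarrow> complex^'n^'n" where
    "H z = (\<chi> i j. bd_int (\<lambda>k w. nu k * (cnj (\<phi> w) * resolvent T w $ i $ j) / (w - z)) / (2 * pi))" for z
  have hol: "\<phi> holomorphic_on S" using calc by (simp add: fun_calc_def)
  have cf: "bd_cont (\<lambda>k. \<phi>)" by (rule bd_cont_holo[OF hol S(3)])
  have cR: "bd_cont (\<lambda>k w. resolvent T w $ i $ j)" for i j
    using bd_cont_resolvent[OF T clinear_fun_component[of i], of "axis j 1"] by (simp add: matrix_vector_axis)
  have cnR: "bd_cont (\<lambda>k w. nu k * (cnj (\<phi> w) * resolvent T w $ i $ j))" for i j
    by (intro bd_cont_mult bd_cont_const bd_cont_cnj cf cR)
  show "fun_calc region T g G"
    unfolding fun_calc_def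
  proof (intro conjI exI[of _ H] allI ballI)
    show "g holomorphic_on region" unfolding g_def by (rule cauchy_conj_holomorphic[OF cf])
    show "(\<lambda>z. H z $ i $ j) holomorphic_on region" for i j
      unfolding H_def vec_lambda_beta by (intro holomorphic_intros bd_int_kernel_holomorphic cnR) auto
    fix z assume z: "z \<in> region"
    have cH: "bd_cont (\<lambda>k w. nu k * (cnj (\<phi> w) * resolvent T w $ i $ j) / (w - z))" for i j
      using bd_cont_mult[OF cnR bd_cont_kernel[OF z]] by simp
    have cg: "bd_cont (\<lambda>k w. nu k * (cnj (\<phi> w) / (w - z)))"
      using bd_cont_mult[OF bd_cont_const[of nu] bd_cont_mult[OF bd_cont_cnj[OF cf] bd_cont_kernel[OF z]]] by simp
    show "mat (g z) - G = (mat z - T) ** H z"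
      unfolding vec_eq_iff
    proof (intro allI)
      fix i j
      define M where "M = mat z - T"
      have "((mat z - T) ** H z) $ i $ j = (\<Sum>l\<in>UNIV. M $ i $ l * bd_int (\<lambda>k w. nu k * (cnj (\<phi> w) * resolvent T w $ l $ j) / (w - z))) / (2 * pi)"
        by (simp add: matrix_matrix_mult_def H_def M_def sum_divide_distrib)
      also have "\<dots> = bd_int (\<lambda>k w. \<Sum>l\<in>UNIV. M $ i $ l * (nu k * (cnj (\<phi> w) * resolvent T w $ l $ j) / (w - z))) / (2 * pi)"
        by (simp only: bd_int_sum[OF finite bd_cont_mult[OF bd_cont_const cH]] bd_int_mult[OF cH])
      also have "\<dots> = bd_int (\<lambda>k w. mat 1 $ i $ j * (nu k * (cnj (\<phi> w) / (w - z))) - nu k * (cnj (\<phi> w) * resolvent T w $ i $ j)) / (2 * pi)"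
      proof -
        have "bd_int (\<lambda>k w. \<Sum>l\<in>UNIV. M $ i $ l * (nu k * (cnj (\<phi> w) * resolvent T w $ l $ j) / (w - z)))
          = bd_int (\<lambda>k w. mat 1 $ i $ j * (nu k * (cnj (\<phi> w) / (w - z))) - nu k * (cnj (\<phi> w) * resolvent T w $ i $ j))"
        proof (rule bd_int_cong)
          fix k w assume k: "k < N" "w \<in> edge k"
          have wz: "w \<noteq> z" using edge_not_region[OF k z] .
          have "M = (mat w - T) - mat (w - z)" by (simp add: M_def mat_diff)
          then have "M ** resolvent T w = mat 1 - mat (w - z) ** resolvent T w"
            using resolvent_inverse(1)[OF T k] by (simp add: matrix_mult_diff_right)
          then have "(M ** resolvent T w) $ i $ j = mat 1 $ i $ j - (w - z) * resolvent T w $ i $ j"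
            by (simp add: mat_matrix_mult_component)
          then have MR: "(\<Sum>l\<in>UNIV. M $ i $ l * resolvent T w $ l $ j) = mat 1 $ i $ j - (w - z) * resolvent T w $ i $ j"
            by (simp add: matrix_matrix_mult_def)
          have "(\<Sum>l\<in>UNIV. M $ i $ l * (nu k * (cnj (\<phi> w) * resolvent T w $ l $ j) / (w - z)))
            = nu k * cnj (\<phi> w) / (w - z) * (\<Sum>l\<in>UNIV. M $ i $ l * resolvent T w $ l $ j)"
            unfolding sum_distrib_left by (intro sum.cong) auto
          also have "\<dots> = mat 1 $ i $ j * (nu k * (cnj (\<phi> w) / (w - z))) - nu k * (cnj (\<phi> w) * resolvent T w $ i $ j)"
            unfolding MR right_diff_distrib using wz by simp
          finally show "(\<Sum>l\<in>UNIV. M $ i $ l * (nu k * (cnj (\<phi> w) * resolvent T w $ l $ j) / (w - z)))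
            = mat 1 $ i $ j * (nu k * (cnj (\<phi> w) / (w - z))) - nu k * (cnj (\<phi> w) * resolvent T w $ i $ j)" .
        qed
        then show ?thesis by (simp only:)
      qed
      also have "\<dots> = mat 1 $ i $ j * g z - G $ i $ j"
        unfolding bd_int_diff[OF bd_cont_mult[OF bd_cont_const cg] cnR] bd_int_mult[OF cg] g_def cauchy_conj_def
        by (simp add: G_def diff_divide_distrib)
      finally show "(mat (g z) - G) $ i $ j = ((mat z - T) ** H z) $ i $ j" by (simp add: mat_def)
    qed
  qed
  show "norm (g z) \<le> 1" if "z \<in> region" for z
    unfolding g_def by (rule cauchy_conj_bound[OF hol S le1 that])
  fix x y
  note cB = bd_cont_resolvent[OF T clinear_fun_B]
  have GB: "2 * pi * B (G *v u) v = bd_int (\<lambda>k w. nu k * (cnj (\<phi> w) * B (resolvent T w *v u) v))" for u v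
  proof -
    have ex: "B (A *v u) v = (\<Sum>i\<in>UNIV. \<Sum>j\<in>UNIV. (u $ j * B (axis i 1) v) * A $ i $ j)" for A
      by (subst clinear_fun_expand[OF clinear_fun_B]) (simp add: matrix_vector_mult_def sum_distrib_right sum_distrib_left algebra_simps)
    have "bd_int (\<lambda>k w. nu k * (cnj (\<phi> w) * B (resolvent T w *v u) v))
      = bd_int (\<lambda>k w. \<Sum>i\<in>UNIV. \<Sum>j\<in>UNIV. (u $ j * B (axis i 1) v) * (nu k * (cnj (\<phi> w) * resolvent T w $ i $ j)))"
      unfolding ex by (simp add: sum_distrib_left algebra_simps)
    also have "\<dots> = (\<Sum>i\<in>UNIV. \<Sum>j\<in>UNIV. (u $ j * B (axis i 1) v) * bd_int (\<lambda>k w. nu k * (cnj (\<phi> w) * resolvent T w $ i $ j)))"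
      by (simp only: bd_int_sum[OF finite bd_cont_sum[OF bd_cont_mult[OF bd_cont_const cnR]]]
        bd_int_sum[OF finite bd_cont_mult[OF bd_cont_const cnR]] bd_int_mult[OF cnR])
    also have "\<dots> = 2 * pi * B (G *v u) v"
      unfolding ex by (simp add: G_def sum_distrib_left algebra_simps)
    finally show ?thesis ..
  qed
  define P where "P k w u v = nu k * B (resolvent T w *v u) v + cnj (nu k * B (resolvent T w *v v) u)" for k w u v
  have cP1: "bd_cont (\<lambda>k w. nu k * B (resolvent T w *v u) v)" for u v
    by (intro bd_cont_mult bd_cont_const cB)
  have cP: "bd_cont (\<lambda>k w. P k w u v)" for u v
    unfolding P_def by (intro bd_cont_add bd_cont_cnj cP1)
  have psd: "psd_form (P k w)" if k: "k < N" "w \<in> edge k" for k w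
  proof
    show "P k w (x + y) z = P k w x z + P k w y z" for x y z
      by (simp add: P_def matrix_vector_right_distrib add_left add_right algebra_simps)
    show "P k w (a *s x) z = a * P k w x z" for a x z
      by (simp add: P_def matrix_vector_scale scale_left scale_right algebra_simps)
    show "cnj (P k w x y) = P k w y x" for x y by (simp add: P_def)
    fix x
    define r where "r = resolvent T w *v x"
    have "0 \<le> \<delta> * (nm r)^2" using \<delta>_pos by simp
    also have "\<dots> \<le> Re (cnj (nu k) * B ((mat w - T) *v r) r)" by (rule Re_resolvent_form[OF T k])
    also have "(mat w - T) *v r = x" unfolding r_def by (rule resolvent_apply(1)[OF T k])
    also have "Re (cnj (nu k) * B x r) = Re (cnj (cnj (nu k) * B x r))" by simp
    also have "cnj (cnj (nu k) * B x r) = nu k * B r x" by (simp add: cnj_swap)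
    finally show "0 \<le> Re (P k w x x)" by (simp add: P_def r_def)
  qed
  have P_int: "bd_int (\<lambda>k w. P k w u u) = 4 * pi * B u u" for u
    unfolding P_def using resolvent_integral[OF T, of u u]
    by (simp add: bd_int_add[OF cP1 bd_cont_cnj[OF cP1]] bd_int_cnj[OF cP1] cnj_swap del: complex_cnj_mult)
       (simp add: cnj_swap)
  have cRe: "bd_cont (\<lambda>k w. Re (P k w u v))" for u v
    by (rule bd_cont_linear[OF bounded_linear_Re cP])
  have P_int_Re: "bd_int (\<lambda>k w. Re (P k w u u)) = 4 * pi * (nm u)^2" for u
    unfolding bd_int_linear[OF bounded_linear_Re cP] P_int nm_sq by simp
  have "2 * pi * (B (F *v x) y + B x (G *v y)) = 2 * pi * B (F *v x) y + cnj (2 * pi * B (G *v y) x)"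
    by (simp add: cnj_swap distrib_left)
  also have "\<dots> = bd_int (\<lambda>k w. nu k * (\<phi> w * B (resolvent T w *v x) y)) + bd_int (\<lambda>k w. cnj (nu k * (cnj (\<phi> w) * B (resolvent T w *v y) x)))"
    unfolding GB by (subst bd_int_cnj)
      (auto intro!: bd_cont_mult bd_cont_const bd_cont_cnj cf cB simp: fun_calc_Cauchy[OF T calc S(1-3)])
  also have "\<dots> = bd_int (\<lambda>k w. nu k * (\<phi> w * B (resolvent T w *v x) y) + cnj (nu k * (cnj (\<phi> w) * B (resolvent T w *v y) x)))"
    by (intro bd_int_add[symmetric] bd_cont_mult bd_cont_const bd_cont_cnj cf cB)
  also have "\<dots> = bd_int (\<lambda>k w. \<phi> w * P k w x y)"
    by (simp add: P_def algebra_simps)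
  finally have eq: "2 * pi * (B (F *v x) y + B x (G *v y)) = bd_int (\<lambda>k w. \<phi> w * P k w x y)" .
  have "norm (bd_int (\<lambda>k w. \<phi> w * P k w x y)) \<le> bd_int (\<lambda>k w. (Re (P k w x x) + Re (P k w y y)) / 2)"
  proof (rule bd_int_norm)
    show "bd_cont (\<lambda>k w. \<phi> w * P k w x y)" by (intro bd_cont_mult cf cP)
    show "bd_cont (\<lambda>k w. (Re (P k w x x) + Re (P k w y y)) / 2)"
      by (intro bd_cont_linear[OF bounded_linear_divide] bd_cont_add cRe)
    fix k w assume k: "k < N" "w \<in> edge k"
    have "norm (\<phi> w) \<le> 1" using le1 S(3) k by blast
    then have "norm (\<phi> w * P k w x y) \<le> norm (P k w x y)" by (simp add: norm_mult mult_left_le_one_le)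
    also have "\<dots> \<le> (Re (P k w x x) + Re (P k w y y)) / 2"
      by (rule psd_form.norm_le_average[OF psd[OF k]])
    finally show "norm (\<phi> w * P k w x y) \<le> (Re (P k w x x) + Re (P k w y y)) / 2" .
  qed
  also have "\<dots> = (bd_int (\<lambda>k w. Re (P k w x x)) + bd_int (\<lambda>k w. Re (P k w y y))) / 2"
    by (subst bd_int_linear[OF bounded_linear_divide]) (auto intro!: bd_cont_add cRe simp: bd_int_add[OF cRe cRe])
  also have "\<dots> = 2 * pi * ((nm x)^2 + (nm y)^2)" unfolding P_int_Re by (simp add: algebra_simps)
  finally have "norm (complex_of_real (2 * pi) * (B (F *v x) y + B x (G *v y))) \<le> 2 * pi * ((nm x)^2 + (nm y)^2)"
    using eq by simp
  then show "norm (B (F *v x) y + B x (G *v y)) \<le> (nm x)^2 + (nm y)^2"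
    unfolding norm_mult norm_of_real by simp
qed

end

section \<open>The extremal argument\<close>

context inner_product
begin

lemma bounded_bilinear_B: "bounded_bilinear B"
proof
  show "B (r *\<^sub>R x) y = r *\<^sub>R B x y" for r x y
    by (simp add: scaleR_eq_scale scale_left scaleR_conv_of_real)
  show "B x (r *\<^sub>R y) = r *\<^sub>R B x y" for r x y
    by (simp add: scaleR_eq_scale scale_right scaleR_conv_of_real)
  have "norm (B x y) \<le> norm x * norm y * K" for x y
  proof -
    have "norm (B x y) \<le> (sqrt K * norm x) * (sqrt K * norm y)"
      using norm_B_le nm_le_norm by (meson mult_mono nm_nonneg order_trans)
    also have "\<dots> = norm x * norm y * (sqrt K * sqrt K)" by (simp only: ac_simps)
    finally show ?thesis using K_pos by simp
  qed
  then show "\<exists>K. \<forall>x y. norm (B x y) \<le> norm x * norm y * K" by blast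
qed (auto simp: add_left add_right)

lemma continuous_nm: "continuous_on S nm"
  unfolding nm_def by (intro continuous_intros bounded_bilinear.continuous_on[OF bounded_bilinear_B])

lemma compact_unit_sphere: "compact {x. nm x = 1}"
  unfolding compact_eq_bounded_closed
proof
  show "bounded {x. nm x = 1}"
    unfolding bounded_iff using norm_le_nm by (metis mem_Collect_eq mult.right_neutral)
  show "closed {x. nm x = 1}"
    by (intro closed_Collect_eq continuous_nm continuous_on_const)
qed

lemma normalize: assumes "x \<noteq> 0" shows "nm (of_real (1 / nm x) *s x) = 1"
  using assms nm_eq_0[of x] unfolding nm_scale norm_of_real by simp

lemma ex_unit_vector: "\<exists>x. nm x = 1"
proof -
  have "axis undefined 1 \<noteq> (0 :: complex^'n)" by (simp add: axis_eq_0_iff)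
  then show ?thesis using normalize by blast
qed

lemma maximal_vector:
  obtains x where "nm x = 1" "\<And>y. nm (F *v y) \<le> nm (F *v x) * nm y"
proof -
  have "continuous_on {x. nm x = 1} (\<lambda>x. nm (F *v x))"
    by (intro continuous_on_compose2[OF continuous_nm[of UNIV]] linear_continuous_on matrix_vector_mul_bounded_linear) auto
  then obtain x where x: "nm x = 1" "\<And>y. nm y = 1 \<Longrightarrow> nm (F *v y) \<le> nm (F *v x)"
    using continuous_attains_sup[OF compact_unit_sphere] ex_unit_vector by blast
  have "nm (F *v y) \<le> nm (F *v x) * nm y" for y
  proof (cases "y = 0")
    case True
    then show ?thesis using nm_eq_0[of 0] by simp
  next
    case False
    then have "nm y > 0" using nm_eq_0[of y] nm_nonneg[of y] by linarith
    then show ?thesis using x(2)[OF normalize[OF False]]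
      unfolding matrix_vector_scale nm_scale norm_of_real by (simp add: field_simps)
  qed
  then show thesis using that x(1) by blast
qed

text \<open>At a vector \<open>x\<close> where the operator norm is attained, \<open>F\<^sup>* F x = \<sigma>\<^sup>2 x\<close> in weak form: \<open>x\<close> is a null vector of
  the positive semidefinite form \<open>\<sigma>\<^sup>2 B u v - B (F u) (F v)\<close>.\<close>

lemma maximal_vector_eigen:
  assumes "nm x = 1" "\<And>y. nm (F *v y) \<le> nm (F *v x) * nm y"
  shows "B (F *v y) (F *v x) = of_real ((nm (F *v x))^2) * B y x"
proof -
  define s where "s = nm (F *v x)"
  interpret D: psd_form "\<lambda>u v. of_real (s^2) * B u v - B (F *v u) (F *v v)"
  proof
    fix u
    have "(nm (F *v u))^2 \<le> (s * nm u)^2" using assms(2) nm_nonneg by (intro power_mono) (auto simp: s_def)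
    then show "0 \<le> Re (of_real (s^2) * B u u - B (F *v u) (F *v u))"
      unfolding nm_sq_complex[symmetric] by (simp add: power_mult_distrib flip: of_real_power of_real_mult)
  qed (auto simp: add_left scale_left matrix_vector_right_distrib matrix_vector_scale algebra_simps cnj_swap)
  have "of_real (s^2) * B y x - B (F *v y) (F *v x) = 0"
    by (rule D.null_vector) (use nm_sq_complex[of x] nm_sq_complex[of "F *v x"] assms(1) in \<open>simp add: s_def flip: of_real_power\<close>)
  then show ?thesis by (simp add: s_def)
qed

end

text \<open>In the limit \<open>v \<rightarrow> M = Sup V\<close> the hypothesis becomes \<open>M\<^sup>2 (M - 2) \<le> M\<close>, that is \<open>(M - 1)\<^sup>2 \<le> 2\<close>.\<close>

lemma real_le_of_cubic_sup:
  fixes M :: real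
  assumes ne: "V \<noteq> {}" and bdd: "bdd_above V" and step: "\<And>v. v \<in> V \<Longrightarrow> v^2 * (v - 2) \<le> Sup V"
  shows "Sup V \<le> 1 + sqrt 2"
proof (rule ccontr)
  define M where "M = Sup V"
  assume "\<not> Sup V \<le> 1 + sqrt 2"
  then have M: "M > 1 + sqrt 2" by (simp add: M_def)
  then have M2: "M > 2" using real_sqrt_ge_one[of 2] by linarith
  have "M^2 * (M - 2) \<le> M"
  proof (rule ccontr)
    assume "\<not> M^2 * (M - 2) \<le> M"
    then have gt: "M^2 * (M - 2) - M > 0" by simp
    have "isCont (\<lambda>t. t^2 * (t - 2)) M" by (intro continuous_intros)
    then obtain d where d: "d > 0" "\<And>t. dist t M < d \<Longrightarrow> dist (t^2 * (t - 2)) (M^2 * (M - 2)) < M^2 * (M - 2) - M"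
      using gt unfolding continuous_at_eps_delta by metis
    obtain v where v: "v \<in> V" "M - d < v"
      using less_cSup_iff[OF ne bdd, of "M - d"] d(1) by (auto simp: M_def)
    moreover have "v \<le> M" using v(1) bdd by (simp add: M_def cSup_upper)
    ultimately have "dist (v^2 * (v - 2)) (M^2 * (M - 2)) < M^2 * (M - 2) - M" by (intro d(2)) (simp add: dist_real_def)
    then have "v^2 * (v - 2) > M" by (simp add: dist_real_def abs_less_iff)
    then show False using step[OF v(1)] by (simp add: M_def)
  qed
  then have "M * (M * (M - 2)) \<le> M * 1" by (simp add: power2_eq_square mult.assoc)
  then have "M * (M - 2) \<le> 1" using M2 by simp
  then have "(M - 1)^2 \<le> 2" by (simp add: power2_eq_square algebra_simps)
  then have "M - 1 \<le> sqrt 2" by (rule real_le_rsqrt)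
  then show False using M by simp
qed

text \<open>The polygons form a family with common normals and offset \<open>e\<close>. The supremum runs over functions that are
  holomorphic and bounded by \<open>1\<close> on the polygon with some offset greater than a fixed \<open>e0\<close>. This class is closed
  under the passage from \<open>\<phi>\<close> to \<open>\<phi> g \<phi>\<close>, although \<open>g\<close> only lives on a smaller polygon than \<open>\<phi>\<close>.\<close>

theorem (in inner_product) polygon_bound:
  assumes poly: "\<And>e. e > 0 \<Longrightarrow> convex_polygon N nu (b e) (\<lambda>k. h k + e) (len e)"
    and T: "\<And>k x. k < N \<Longrightarrow> Re (cnj (nu k) * B (T *v x) x) \<le> h k * (nm x)^2"
    and e: "0 < e"
    and calc: "fun_calc {z. \<forall>k<N. Re (cnj (nu k) * z) < h k + e} T \<phi> F"
    and le1: "\<And>z. (\<And>k. k < N \<Longrightarrow> Re (cnj (nu k) * z) < h k + e) \<Longrightarrow> norm (\<phi> z) \<le> 1"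
  shows "nm (F *v x) \<le> (1 + sqrt 2) * nm x"
proof -
  define R where "R e = {z. \<forall>k<N. Re (cnj (nu k) * z) < h k + e}" for e
  have op: "polygon_operator N nu (b e) (\<lambda>k. h k + e) (len e) B K e" if "e > 0" for e
    using poly[OF that] that by (intro polygon_operator.intro polygon_operator_axioms.intro inner_product_axioms)
  have strip: "polygon_operator.strip N nu (\<lambda>k. h k + e) B e T" if "e > 0" for e
    using T by (simp add: polygon_operator.strip_def[OF op[OF that]])
  have region: "convex_polygon.region N nu (\<lambda>k. h k + e) = R e" if "e > 0" for e
    by (simp add: convex_polygon.region_def[OF poly[OF that]] R_def)
  have R_open: "open (R e)" if "e > 0" for e
    using convex_polygon.open_region[OF poly[OF that]] region[OF that] by simp
  have R_convex: "convex (R e)" for e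
  proof -
    have "R e = (\<Inter>k\<in>{..<N}. {z. inner (nu k) z < h k + e})" by (auto simp: R_def inner_complex_def)
    then show ?thesis by (auto intro!: convex_INT convex_halfspace_lt)
  qed
  have R_mono: "R e \<subseteq> R e'" if "e \<le> e'" for e e'
    unfolding R_def using that by (auto intro: less_le_trans)
  have edges: "convex_polygon.edge (b e) k \<subseteq> R e'" if "0 < e" "e < e'" "k < N" for e e' k
    using convex_polygon.edge_in_half_plane[OF poly[OF that(1)] that(3)] that(2) unfolding R_def by fastforce
  define e0 where "e0 = e / 2"
  have e0: "0 < e0" "e0 < e" using e by (auto simp: e0_def)
  \<comment> \<open>the class over which the supremum is taken\<close>
  define admissible where "admissible e \<phi> F \<longleftrightarrow> e0 < e \<and> fun_calc (R e) T \<phi> F \<and> (\<forall>z\<in>R e. norm (\<phi> z) \<le> 1)" for e \<phi> F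
  define V where "V = {nm (F *v x) |e \<phi> F x. admissible e \<phi> F \<and> nm x = 1}"
  have inV: "nm (F *v x) \<in> V" if "admissible e \<phi> F" "nm x = 1" for e \<phi> F x
    using that unfolding V_def by blast
  have V_bdd: "bdd_above V"
  proof -
    have "v \<le> convex_polygon.perimeter N (len e0) / (2 * pi * e0)" if v: "v \<in> V" for v
    proof -
      obtain e \<phi> F x where *: "admissible e \<phi> F" "nm x = 1" "v = nm (F *v x)" using v unfolding V_def by blast
      have e': "e0 < e" "0 < e" using * e0 by (auto simp: admissible_def)
      show ?thesis
        using polygon_operator.fun_calc_bounded[OF op[OF e0(1)] strip[OF e0(1)], of "R e" \<phi> F x]
          * R_open[OF e'(2)] R_convex edges[OF e0(1) e'(1)] by (simp add: admissible_def)
    qed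
    then show ?thesis by (rule bdd_aboveI)
  qed
  have upper: "nm (F *v x) \<le> Sup V" if "admissible e \<phi> F" "nm x = 1" for e \<phi> F x
    using inV[OF that] V_bdd by (rule cSup_upper)
  have "admissible e (\<lambda>z. 1) (mat 1)" if "e0 < e" for e
    using that by (simp add: admissible_def fun_calc_const)
  then have ne: "V \<noteq> {}" using inV ex_unit_vector e0 by blast
  have cubic: "v^2 * (v - 2) \<le> Sup V" if v: "v \<in> V" for v
  proof -
    obtain e \<phi> F x0 where *: "admissible e \<phi> F" "nm x0 = 1" "v = nm (F *v x0)" using v unfolding V_def by blast
    obtain x where x: "nm x = 1" "\<And>y. nm (F *v y) \<le> nm (F *v x) * nm y" using maximal_vector by blast
    define s where "s = nm (F *v x)"
    have vs: "0 \<le> v" "v \<le> s" using *(2,3) x(2)[of x0] by (auto simp: s_def)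
    have SV: "0 \<le> Sup V" using upper[OF *(1) x(1)] nm_nonneg order_trans by blast
    show ?thesis
    proof (cases "v \<le> 2")
      case True
      then have "v^2 * (v - 2) \<le> 0" by (simp add: mult_nonneg_nonpos)
      then show ?thesis using SV by linarith
    next
      case False
      then have s2: "s > 2" using vs by simp
      have adm: "e0 < e" "fun_calc (R e) T \<phi> F" "\<And>z. z \<in> R e \<Longrightarrow> norm (\<phi> z) \<le> 1"
        using *(1) by (auto simp: admissible_def)
      define e1 where "e1 = (e0 + e) / 2"
      have e1: "e0 < e1" "e1 < e" "0 < e1" "0 < e" using adm(1) e0 by (auto simp: e1_def)
      have sub: "convex_polygon.region N nu (\<lambda>k. h k + e1) \<subseteq> R e"
        unfolding region[OF e1(3)] using R_mono e1 by simp
      obtain g G where g: "fun_calc (R e1) T g G" "\<And>z. z \<in> R e1 \<Longrightarrow> norm (g z) \<le> 1"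
        "\<And>x y. norm (B (F *v x) y + B x (G *v y)) \<le> (nm x)^2 + (nm y)^2"
        using polygon_operator.conjugate_partner[OF op[OF e1(3)] strip[OF e1(3)] adm(2) R_open[OF e1(4)] R_convex
            edges[OF e1(3,2)] sub adm(3), unfolded region[OF e1(3)]] by blast
      define y where "y = of_real (1 / s) *s (F *v x)"
      have ny: "nm y = 1" unfolding y_def nm_scale norm_of_real using s2 by (simp flip: s_def)
      have "admissible e1 (\<lambda>z. \<phi> z * g z * \<phi> z) (F ** G ** F)"
        unfolding admissible_def using R_mono[of e1 e] e1 g adm
        by (intro conjI fun_calc_mult ballI fun_calc_subset[OF adm(2)])
          (auto simp: norm_mult intro!: mult_le_one)
      from upper[OF this x(1)] have FGF: "nm (F *v (G *v (F *v x))) \<le> Sup V"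
        by (simp add: matrix_vector_mul_assoc matrix_mul_assoc)
      \<comment> \<open>The bound on \<open>\<phi> g \<phi>\<close>, tested on \<open>x\<close> and \<open>F x\<close>, controls \<open>B (G (F x)) x\<close>.\<close>
      have "s^2 * norm (B (G *v (F *v x)) x) = norm (B (F *v (G *v (F *v x))) (F *v x))"
        unfolding maximal_vector_eigen[OF x] by (simp add: norm_mult s_def norm_power)
      also have "\<dots> \<le> Sup V * s"
        unfolding s_def by (rule order_trans[OF norm_B_le mult_right_mono[OF FGF nm_nonneg]])
      finally have "s * norm (B (G *v (F *v x)) x) \<le> Sup V"
        using s2 by (simp add: power2_eq_square mult.assoc mult.commute)
      then have 1: "norm (B x (G *v (F *v x))) * s \<le> Sup V"
        by (metis cnj_swap complex_mod_cnj mult.commute)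
      \<comment> \<open>With \<open>y = F x / s\<close> both arguments of the central estimate are unit vectors.\<close>
      have "B (F *v x) y + B x (G *v y) = of_real (1 / s) * (of_real (s^2) + B x (G *v (F *v x)))"
        unfolding y_def matrix_vector_scale scale_right nm_sq_complex[of "F *v x", symmetric] s_def[symmetric]
        by (simp add: distrib_left)
      then have "norm (of_real (s^2) + B x (G *v (F *v x))) / s \<le> 2"
        using g(3)[of x y] x(1) ny s2 by (simp add: norm_mult norm_divide)
      then have "norm (of_real (s^2) + B x (G *v (F *v x))) \<le> 2 * s" using s2 by (simp add: field_simps)
      then have "s^2 - norm (B x (G *v (F *v x))) \<le> 2 * s"
        using norm_diff_ineq[of "of_real (s^2) :: complex" "B x (G *v (F *v x))"] by (simp add: norm_power)
      then have "(s^2 - 2 * s) * s \<le> norm (B x (G *v (F *v x))) * s" using s2 by (intro mult_right_mono) auto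
      then have "s^2 * (s - 2) \<le> Sup V" using 1 by (simp add: power2_eq_square algebra_simps)
      moreover have "v^2 * (v - 2) \<le> s^2 * (s - 2)"
        using vs False by (intro mult_mono power_mono) auto
      ultimately show ?thesis by linarith
    qed
  qed
  have SV: "Sup V \<le> 1 + sqrt 2" by (rule real_le_of_cubic_sup[OF ne V_bdd cubic])
  have adm: "admissible e \<phi> F" using calc le1 e0 by (simp add: admissible_def R_def)
  show ?thesis
  proof (cases "x = 0")
    case True
    then show ?thesis using nm_eq_0[of 0] by simp
  next
    case False
    then have "nm x > 0" using nm_eq_0[of x] nm_nonneg[of x] by linarith
    then show ?thesis using order_trans[OF upper[OF adm normalize[OF False]] SV]
      unfolding matrix_vector_scale nm_scale norm_of_real by (simp add: field_simps)
  qed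
qed

section \<open>Circumscribed polygons with equally spaced normals\<close>

lemma Re_cnj_cis_mult: "Re (cnj (u * cis t) * w) = cos t * Re (cnj u * w) + sin t * Im (cnj u * w)"
  by (simp add: cis.code algebra_simps)

lemma Re_scale_cnj: "Re (cnj (of_real r * u + of_real s * v) * w) = r * Re (cnj u * w) + s * Re (cnj v * w)"
  by (simp add: algebra_simps)

lemma Re_scale_cnj1: "Re (cnj (of_real r * u) * w) = r * Re (cnj u * w)"
  by (simp add: algebra_simps)

lemma Ln_cis_shift:
  assumes "Re x > 0" "0 < \<alpha>" "\<alpha> \<le> pi / 2"
  shows "Ln (cis (- \<alpha>) * x) = Ln x - \<i> * of_real \<alpha>"
proof (rule Ln_unique)
  have x: "x \<noteq> 0" using assms(1) by auto
  then show "exp (Ln x - \<i> * of_real \<alpha>) = cis (- \<alpha>) * x"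
    by (simp add: exp_diff cis_conv_exp exp_minus field_simps)
  have "\<bar>Im (Ln x)\<bar> < pi / 2" using Re_Ln_pos_lt[OF x] assms(1) by simp
  then show "- pi < Im (Ln x - \<i> * of_real \<alpha>)" "Im (Ln x - \<i> * of_real \<alpha>) \<le> pi" using assms(2,3) by auto
qed

text \<open>A sublinear function \<open>p\<close> on the plane, to be thought of as the support function of a convex body with
  interior points, and \<open>4 n\<close> equally spaced outward normals. The number is a multiple of \<open>4\<close> so that the coordinate
  directions occur among the normals and the opposite of each normal is a normal.\<close>

locale circumscribed =
  fixes p :: "complex \<Rightarrow> real" and n :: nat
  assumes subadd: "p (u + v) \<le> p u + p v"
    and pos_hom: "0 \<le> r \<Longrightarrow> p (of_real r * u) = r * p u"
    and n: "2 \<le> n"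
    and interior_point: "\<exists>z. \<forall>u. norm u = 1 \<longrightarrow> Re (cnj u * z) < p u"
begin

text \<open>The angle between consecutive normals.\<close>

definition \<alpha> :: real where "\<alpha> = pi / (2 * real n)"

text \<open>The outward normals.\<close>

definition dir :: "nat \<Rightarrow> complex" where "dir k = cis (real k * \<alpha>)"

text \<open>The intersection of the support lines with normals \<open>u * cis (- \<alpha>)\<close> and \<open>u\<close>, in the frame of \<open>u\<close>.\<close>

definition vertex :: "complex \<Rightarrow> complex" where
  "vertex u = u * Complex (p u) ((cos \<alpha> * p u - p (u * cis (- \<alpha>))) / sin \<alpha>)"

text \<open>The signed length of the side with normal \<open>dir k\<close>.\<close>

definition side_length :: "nat \<Rightarrow> real" where
  "side_length k = (p (dir k * cis \<alpha>) + p (dir k * cis (- \<alpha>)) - 2 * cos \<alpha> * p (dir k)) / sin \<alpha>"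

lemma \<alpha>_bounds: "0 < \<alpha>" "\<alpha> \<le> pi / 4" "\<alpha> < pi"
proof -
  show "0 < \<alpha>" using n by (simp add: \<alpha>_def)
  have "4 \<le> 2 * real n" using n by linarith
  then show "\<alpha> \<le> pi / 4" unfolding \<alpha>_def by (intro divide_left_mono) auto
  then show "\<alpha> < pi" using pi_gt_zero by linarith
qed

lemma sin_cos_\<alpha>: "0 < sin \<alpha>" "0 \<le> cos \<alpha>"
  using \<alpha>_bounds by (auto intro!: sin_gt_zero cos_ge_zero)

lemma total_angle: "real (4 * n) * \<alpha> = 2 * pi"
  using n by (simp add: \<alpha>_def)

lemma norm_dir: "norm (dir k) = 1" by (simp add: dir_def)

lemma dir_add: "dir (j + k) = dir j * dir k"
  by (simp add: dir_def cis_mult algebra_simps)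

lemma dir_Suc: "dir (Suc k) = dir k * cis \<alpha>"
  by (simp add: dir_def cis_mult algebra_simps)

lemma dir_periodic: "dir (4 * n) = 1"
  unfolding dir_def total_angle by simp

lemma cnj_unit_mult: "norm u = 1 \<Longrightarrow> cnj u * (u * w) = w"
  unfolding mult.assoc[symmetric] by (metis complex_norm_square mult.commute mult.left_neutral of_real_1 one_power2)

lemma Re_vertex: assumes "norm u = 1" shows "Re (cnj u * vertex u) = p u"
  unfolding vertex_def cnj_unit_mult[OF assms] by simp

lemma Re_vertex_prev: assumes "norm u = 1" shows "Re (cnj (u * cis (- \<alpha>)) * vertex u) = p (u * cis (- \<alpha>))"
  unfolding Re_cnj_cis_mult vertex_def cnj_unit_mult[OF assms] using sin_cos_\<alpha> by simp

lemma vertex_next: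
  assumes "norm u = 1"
  shows "vertex (u * cis \<alpha>) = u * Complex (p u) ((p (u * cis \<alpha>) - cos \<alpha> * p u) / sin \<alpha>)"
proof -
  define q where "q = p (u * cis \<alpha>)"
  have s: "sin \<alpha> \<noteq> 0" using sin_cos_\<alpha> by simp
  have rot: "u * cis \<alpha> * cis (- \<alpha>) = u" by (simp add: mult.assoc cis_mult)
  have "vertex (u * cis \<alpha>) = u * (cis \<alpha> * Complex q ((cos \<alpha> * q - p u) / sin \<alpha>))"
    unfolding vertex_def rot q_def by (simp only: mult.assoc)
  also have "cis \<alpha> * Complex q ((cos \<alpha> * q - p u) / sin \<alpha>) = Complex (p u) ((q - cos \<alpha> * p u) / sin \<alpha>)"
    using s by (simp add: complex_eq_iff field_simps)
      (metis distrib_left mult.right_neutral sin_cos_squared_add3)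
  finally show ?thesis by (simp add: q_def)
qed

text \<open>The normal between two others is a nonnegative combination of them. Sublinearity of \<open>p\<close>, compared with the
  linear function given by the vertex, which agrees with \<open>p\<close> at two of the three normals, yields the inequality
  at the third.\<close>

lemma vertex_in_half_plane:
  assumes u: "norm u = 1" and \<beta>: "0 \<le> \<beta>" "\<beta> \<le> pi - \<alpha>"
  shows "Re (cnj (u * cis \<beta>) * vertex u) \<le> p (u * cis \<beta>)"
    and "Re (cnj (u * cis (- \<alpha>) * cis (- \<beta>)) * vertex u) \<le> p (u * cis (- \<alpha>) * cis (- \<beta>))"
proof -
  have s: "0 \<le> sin \<beta>" "0 \<le> sin (\<alpha> + \<beta>)" using \<beta> \<alpha>_bounds by (auto intro!: sin_ge_zero)
  have half_plane: "Re (cnj v * vertex u) \<le> p v"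
    if eq: "of_real (sin (\<alpha> + \<beta>)) * a = of_real (sin \<beta>) * a' + of_real (sin \<alpha>) * v"
      and a: "Re (cnj a * vertex u) = p a" "Re (cnj a' * vertex u) = p a'" for a a' v
  proof -
    have "sin (\<alpha> + \<beta>) * p a \<le> sin \<beta> * p a' + sin \<alpha> * p v"
      using subadd[of "of_real (sin \<beta>) * a'" "of_real (sin \<alpha>) * v"] s sin_cos_\<alpha>
      unfolding eq[symmetric] by (simp add: pos_hom)
    moreover have "sin (\<alpha> + \<beta>) * p a = sin \<beta> * p a' + sin \<alpha> * Re (cnj v * vertex u)"
      using arg_cong[OF eq, of "\<lambda>x. Re (cnj x * vertex u)"] unfolding Re_scale_cnj Re_scale_cnj1 a .
    ultimately show ?thesis using sin_cos_\<alpha> by simp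
  qed
  have 1: "complex_of_real (sin (\<alpha> + \<beta>)) = of_real (sin \<beta>) * cis (- \<alpha>) + of_real (sin \<alpha>) * cis \<beta>"
    by (simp add: complex_eq_iff sin_add)
  show "Re (cnj (u * cis \<beta>) * vertex u) \<le> p (u * cis \<beta>)"
  proof (rule half_plane[of u "u * cis (- \<alpha>)"])
    show "of_real (sin (\<alpha> + \<beta>)) * u = of_real (sin \<beta>) * (u * cis (- \<alpha>)) + of_real (sin \<alpha>) * (u * cis \<beta>)"
      unfolding 1 by (simp add: algebra_simps)
  qed (use Re_vertex[OF u] Re_vertex_prev[OF u] in auto)
  have 2: "complex_of_real (sin (\<alpha> + \<beta>)) * cis (- \<alpha>) = of_real (sin \<beta>) + of_real (sin \<alpha>) * (cis (- \<alpha>) * cis (- \<beta>))"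
  proof -
    have "complex_of_real (sin (\<alpha> + \<beta>)) = of_real (sin \<beta>) * cis \<alpha> + of_real (sin \<alpha>) * cis (- \<beta>)"
      by (simp add: complex_eq_iff sin_add)
    then have "complex_of_real (sin (\<alpha> + \<beta>)) * cis (- \<alpha>) = of_real (sin \<beta>) * (cis \<alpha> * cis (- \<alpha>)) + of_real (sin \<alpha>) * (cis (- \<alpha>) * cis (- \<beta>))"
      by (simp add: algebra_simps)
    then show ?thesis by (simp add: cis_mult)
  qed
  show "Re (cnj (u * cis (- \<alpha>) * cis (- \<beta>)) * vertex u) \<le> p (u * cis (- \<alpha>) * cis (- \<beta>))"
  proof (rule half_plane[of "u * cis (- \<alpha>)" u])
    show "of_real (sin (\<alpha> + \<beta>)) * (u * cis (- \<alpha>)) = of_real (sin \<beta>) * u + of_real (sin \<alpha>) * (u * cis (- \<alpha>) * cis (- \<beta>))"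
      using arg_cong[OF 2, of "\<lambda>x. u * x"] by (simp add: algebra_simps)
  qed (use Re_vertex[OF u] Re_vertex_prev[OF u] in auto)
qed

lemma vertex_in_polygon:
  assumes "j < 4 * n" "k < 4 * n"
  shows "Re (cnj (dir k) * vertex (dir j)) \<le> p (dir k)"
proof -
  obtain m where m: "m < 4 * n" "dir k = dir j * dir m"
  proof (cases "j \<le> k")
    case True
    then show thesis using that[of "k - j"] assms dir_add[of j "k - j"] by simp
  next
    case False
    have "j + (k + 4 * n - j) = k + 4 * n" using assms by simp
    then have "dir (j + (k + 4 * n - j)) = dir k * dir (4 * n)"
      unfolding dir_add[symmetric] by simp
    then show thesis using that[of "k + 4 * n - j"] False assms dir_add[of j "k + 4 * n - j"] by (simp add: dir_periodic)
  qed
  note half = vertex_in_half_plane[OF norm_dir]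
  have step: "real (2 * n) * \<alpha> = pi" using total_angle by simp
  show ?thesis
  proof (cases "m < 2 * n")
    case True
    then have "real m + 1 \<le> real (2 * n)" by linarith
    then have "(real m + 1) * \<alpha> \<le> real (2 * n) * \<alpha>" using \<alpha>_bounds by (intro mult_right_mono) auto
    then have "real m * \<alpha> \<le> pi - \<alpha>" unfolding step by (simp add: algebra_simps)
    then show ?thesis using half(1)[of "real m * \<alpha>" j] \<alpha>_bounds m(2) by (simp add: dir_def)
  next
    case False
    define \<beta> where "\<beta> = 2 * pi - \<alpha> - real m * \<alpha>"
    have "(real m + 1) * \<alpha> \<le> real (4 * n) * \<alpha>" using m(1) \<alpha>_bounds by (intro mult_right_mono) linarith+
    then have b0: "0 \<le> \<beta>" unfolding total_angle by (simp add: \<beta>_def algebra_simps)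
    have "real (2 * n) * \<alpha> \<le> real m * \<alpha>" using False \<alpha>_bounds by (intro mult_right_mono) linarith+
    then have b1: "\<beta> \<le> pi - \<alpha>" unfolding step by (simp add: \<beta>_def)
    have "cis (- \<alpha>) * cis (- \<beta>) = cis (real m * \<alpha> - 2 * pi)" by (simp add: cis_mult \<beta>_def)
    also have "\<dots> = dir m" unfolding dir_def by (simp add: complex_eq_iff cos_diff sin_diff)
    finally show ?thesis using half(2)[OF b0 b1, of j] m(2) by (simp add: mult.assoc)
  qed
qed

lemma side_vector:
  "vertex (dir (Suc k)) - vertex (dir k) = of_real (side_length k) * (\<i> * dir k)"
proof -
  have "Complex (p (dir k)) a - Complex (p (dir k)) b = of_real (a - b) * \<i>" for a b
    by (simp add: complex_eq_iff)
  note 1 = this[of "(p (dir k * cis \<alpha>) - cos \<alpha> * p (dir k)) / sin \<alpha>" "(cos \<alpha> * p (dir k) - p (dir k * cis (- \<alpha>))) / sin \<alpha>"]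
  have "vertex (dir (Suc k)) - vertex (dir k) = dir k *
    (Complex (p (dir k)) ((p (dir k * cis \<alpha>) - cos \<alpha> * p (dir k)) / sin \<alpha>)
      - Complex (p (dir k)) ((cos \<alpha> * p (dir k) - p (dir k * cis (- \<alpha>))) / sin \<alpha>))"
    unfolding dir_Suc vertex_next[OF norm_dir] by (simp add: vertex_def[of "dir k"] right_diff_distrib)
  also have "\<dots> = of_real (side_length k) * (\<i> * dir k)"
    unfolding 1 side_length_def diff_divide_distrib[symmetric] by (simp add: algebra_simps)
  finally show ?thesis .
qed

lemma side_length_nonneg: "0 \<le> side_length k"
proof -
  have "dir k * cis \<alpha> + dir k * cis (- \<alpha>) = of_real (2 * cos \<alpha>) * dir k"
    by (simp add: complex_eq_iff algebra_simps)
  then have "2 * cos \<alpha> * p (dir k) \<le> p (dir k * cis \<alpha>) + p (dir k * cis (- \<alpha>))"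
    using subadd[of "dir k * cis \<alpha>" "dir k * cis (- \<alpha>)"] pos_hom[of "2 * cos \<alpha>" "dir k"] sin_cos_\<alpha> by simp
  then show ?thesis using sin_cos_\<alpha> by (simp add: side_length_def)
qed

text \<open>On side \<open>k\<close> the function \<open>Ln (cnj (dir k) * (w - z))\<close> is a primitive, as its argument has positive real part.
  Passing from one side to the next turns the argument by \<open>-\<alpha>\<close>, and the \<open>4 n\<close> turns add up to \<open>2\<pi>\<close>.\<close>

lemma winding_sum:
  assumes z: "\<And>k. k < 4 * n \<Longrightarrow> Re (cnj (dir k) * z) < p (dir k)"
  shows "(\<Sum>k<4 * n. contour_integral (linepath (vertex (dir k)) (vertex (dir (Suc k)))) (\<lambda>w. 1 / (w - z))) = 2 * pi * \<i>"
proof -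
  define l where "l k = Ln (cnj (dir k) * (vertex (dir k) - z))" for k
  have seg: "contour_integral (linepath (vertex (dir k)) (vertex (dir (Suc k)))) (\<lambda>w. 1 / (w - z)) = l (Suc k) - l k + \<i> * of_real \<alpha>"
    if k: "k < 4 * n" for k
  proof -
    define S where "S = {w. Re (cnj (dir k) * (w - z)) > 0}"
    have nz: "cnj (dir k) \<noteq> 0" using norm_dir[of k] by auto
    have next_line: "Re (cnj (dir k) * vertex (dir (Suc k))) = p (dir k)"
    proof -
      have "dir (Suc k) * cis (- \<alpha>) = dir k" by (simp add: dir_Suc mult.assoc cis_mult)
      then show ?thesis using Re_vertex_prev[OF norm_dir, of "Suc k"] by simp
    qed
    have ends: "vertex (dir k) \<in> S" "vertex (dir (Suc k)) \<in> S"
      using z[OF k] Re_vertex[OF norm_dir[of k]] next_line by (simp_all add: S_def right_diff_distrib)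
    have "convex S"
    proof -
      have "S = {w. inner (dir k) w > Re (cnj (dir k) * z)}" by (auto simp: S_def inner_complex_def algebra_simps)
      then show ?thesis using convex_halfspace_gt[of "Re (cnj (dir k) * z)" "dir k"] by simp
    qed
    then have path: "path_image (linepath (vertex (dir k)) (vertex (dir (Suc k)))) \<subseteq> S"
      using ends by (simp add: closed_segment_subset)
    have deriv: "((\<lambda>w. Ln (cnj (dir k) * (w - z))) has_field_derivative 1 / (w - z)) (at w within S)" if "w \<in> S" for w
    proof -
      have "cnj (dir k) * (w - z) \<notin> \<real>\<^sub>\<le>\<^sub>0" using that by (auto simp: S_def complex_nonpos_Reals_iff)
      moreover have "w \<noteq> z" using that by (auto simp: S_def)
      ultimately show ?thesis using nz by (auto intro!: derivative_eq_intros simp: field_simps)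
    qed
    have "contour_integral (linepath (vertex (dir k)) (vertex (dir (Suc k)))) (\<lambda>w. 1 / (w - z))
       = Ln (cnj (dir k) * (vertex (dir (Suc k)) - z)) - l k"
      using contour_integral_unique[OF contour_integral_primitive[OF deriv _ path]] by (simp add: l_def)
    moreover have "l (Suc k) = Ln (cnj (dir k) * (vertex (dir (Suc k)) - z)) - \<i> * of_real \<alpha>"
    proof -
      have turn: "cnj (dir (Suc k)) * (vertex (dir (Suc k)) - z) = cis (- \<alpha>) * (cnj (dir k) * (vertex (dir (Suc k)) - z))"
        by (simp add: dir_Suc cis_cnj)
      show ?thesis
        unfolding l_def turn by (rule Ln_cis_shift) (use ends(2) \<alpha>_bounds pi_gt_zero in \<open>simp_all add: S_def\<close>)
    qed
    ultimately show ?thesis by simp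
  qed
  have "(\<Sum>k<4 * n. contour_integral (linepath (vertex (dir k)) (vertex (dir (Suc k)))) (\<lambda>w. 1 / (w - z)))
     = (\<Sum>k<4 * n. l (Suc k) - l k) + of_nat (4 * n) * (\<i> * of_real \<alpha>)"
    using seg by (simp add: sum.distrib)
  also have "(\<Sum>k<4 * n. l (Suc k) - l k) = 0"
    unfolding sum_lessThan_telescope by (simp only: l_def dir_periodic) (simp add: dir_def)
  also have "of_nat (4 * n) * (\<i> * of_real \<alpha>) = \<i> * of_real (real (4 * n) * \<alpha>)" by simp
  finally show ?thesis unfolding total_angle by simp
qed

lemma quarter_dirs: "dir 0 = 1" "dir n = \<i>" "dir (2 * n) = -1" "dir (3 * n) = -\<i>"
proof -
  have q: "real n * \<alpha> = pi / 2" using n by (simp add: \<alpha>_def)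
  show "dir 0 = 1" by (simp add: dir_def)
  show i: "dir n = \<i>" unfolding dir_def q by (simp add: cis_pi_half)
  show m: "dir (2 * n) = -1" using dir_add[of n n] i by (simp add: mult_2)
  show "dir (3 * n) = -\<i>" using dir_add[of "2 * n" n] i m by simp
qed

lemma polygon_norm_bound:
  assumes z: "\<And>k. k < 4 * n \<Longrightarrow> Re (cnj (dir k) * z) < p (dir k)" and r: "\<And>u. norm u = 1 \<Longrightarrow> p u \<le> r"
  shows "norm z \<le> 2 * r"
proof -
  have lt: "0 < 4 * n" "n < 4 * n" "2 * n < 4 * n" "3 * n < 4 * n" using n by auto
  have b: "Re (cnj (dir k) * z) \<le> r" if "k < 4 * n" for k
    using z[OF that] r[OF norm_dir, of k] by linarith
  have "\<bar>Re z\<bar> \<le> r" "\<bar>Im z\<bar> \<le> r"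
    using b[OF lt(1)] b[OF lt(2)] b[OF lt(3)] b[OF lt(4)] by (simp_all add: quarter_dirs)
  then show ?thesis using cmod_le[of z] by linarith
qed

lemma ex_bound: "\<exists>r. \<forall>u. norm u = 1 \<longrightarrow> p u \<le> r"
proof -
  have short: "p (of_real t * u) \<le> \<bar>p u\<bar>" if "0 \<le> t" "t \<le> 1" for t u
  proof -
    have "t * p u \<le> t * \<bar>p u\<bar>" using that by (intro mult_left_mono) auto
    also have "\<dots> \<le> \<bar>p u\<bar>" using that by (intro mult_left_le_one_le) auto
    finally show ?thesis using pos_hom[OF that(1)] by simp
  qed
  have part: "p (of_real t * u) \<le> \<bar>p u\<bar> + \<bar>p (- u)\<bar>" if "\<bar>t\<bar> \<le> 1" for t u
  proof (cases "0 \<le> t")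
    case True
    then show ?thesis using short[of t u] that by linarith
  next
    case False
    then show ?thesis using short[of "- t" "- u"] that by simp
  qed
  have "p u \<le> (\<bar>p 1\<bar> + \<bar>p (- 1)\<bar>) + (\<bar>p \<i>\<bar> + \<bar>p (- \<i>)\<bar>)" if "norm u = 1" for u
  proof -
    have "u = of_real (Re u) * 1 + of_real (Im u) * \<i>" by (simp add: complex_eq_iff)
    then have "p u \<le> p (of_real (Re u) * 1) + p (of_real (Im u) * \<i>)" using subadd by metis
    also have "\<dots> \<le> (\<bar>p 1\<bar> + \<bar>p (- 1)\<bar>) + (\<bar>p \<i>\<bar> + \<bar>p (- \<i>)\<bar>)"
      using abs_Re_le_cmod[of u] abs_Im_le_cmod[of u] that by (intro add_mono part) auto
    finally show ?thesis .
  qed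
  then show ?thesis by blast
qed

theorem circumscribed_polygon:
  "convex_polygon (4 * n) dir (\<lambda>k. vertex (dir k)) (\<lambda>k. p (dir k)) side_length"
proof
  show "inj_on dir {..<4 * n}"
  proof -
    have "dir = (\<lambda>k. cis (2 * pi * real k / real (4 * n)))"
      using n by (intro ext) (simp add: dir_def \<alpha>_def mult.commute)
    then show ?thesis using Complex.bij_betw_roots_unity[of "4 * n"] n unfolding bij_betw_def by simp
  qed
  show "vertex (dir (4 * n)) = vertex (dir 0)" by (simp only: dir_periodic quarter_dirs)
  obtain r where r: "\<And>u. norm u = 1 \<Longrightarrow> p u \<le> r" using ex_bound by blast
  show "bounded {z. \<forall>k<4 * n. Re (cnj (dir k) * z) < p (dir k)}"
    unfolding bounded_iff using polygon_norm_bound[OF _ r] by blast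
  show "\<exists>z. \<forall>k<4 * n. Re (cnj (dir k) * z) < p (dir k)"
    using interior_point norm_dir by blast
qed (use norm_dir side_vector side_length_nonneg Re_vertex[OF norm_dir] vertex_in_polygon winding_sum in auto)

end

section \<open>Approximation of a convex set by circumscribed polygons\<close>

text \<open>The support function of a set.\<close>

definition supp_fun :: "complex set \<Rightarrow> complex \<Rightarrow> real" where
  "supp_fun W u = (SUP w\<in>W. Re (cnj u * w))"

lemma bdd_above_supp:
  assumes "bounded W" shows "bdd_above ((\<lambda>w. Re (cnj u * w)) ` W)"
proof -
  obtain R where R: "\<And>w. w \<in> W \<Longrightarrow> norm w \<le> R" using assms bounded_iff by blast
  have "Re (cnj u * w) \<le> norm u * R" if "w \<in> W" for w
  proof -
    have "Re (cnj u * w) \<le> norm u * norm w" using complex_Re_le_cmod[of "cnj u * w"] by (simp add: norm_mult)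
    also have "\<dots> \<le> norm u * R" using R[OF that] by (intro mult_left_mono) auto
    finally show ?thesis .
  qed
  then show ?thesis by (rule bdd_aboveI2)
qed

lemma supp_fun_upper: "bounded W \<Longrightarrow> w \<in> W \<Longrightarrow> Re (cnj u * w) \<le> supp_fun W u"
  unfolding supp_fun_def by (rule cSUP_upper[OF _ bdd_above_supp])

lemma supp_fun_least: "W \<noteq> {} \<Longrightarrow> (\<And>w. w \<in> W \<Longrightarrow> Re (cnj u * w) \<le> r) \<Longrightarrow> supp_fun W u \<le> r"
  unfolding supp_fun_def by (rule cSUP_least)

lemma supp_fun_bound:
  assumes "W \<noteq> {}" "\<And>w. w \<in> W \<Longrightarrow> norm w \<le> R" shows "supp_fun W u \<le> norm u * R"
proof (rule supp_fun_least[OF assms(1)])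
  fix w assume "w \<in> W"
  have "Re (cnj u * w) \<le> norm u * norm w" using complex_Re_le_cmod[of "cnj u * w"] by (simp add: norm_mult)
  also have "\<dots> \<le> norm u * R" using assms(2)[OF \<open>w \<in> W\<close>] by (intro mult_left_mono) auto
  finally show "Re (cnj u * w) \<le> norm u * R" .
qed

lemma supp_fun_add:
  assumes "bounded W" "W \<noteq> {}" shows "supp_fun W (u + v) \<le> supp_fun W u + supp_fun W v"
proof (rule supp_fun_least[OF assms(2)])
  fix w assume w: "w \<in> W"
  have "Re (cnj (u + v) * w) = Re (cnj u * w) + Re (cnj v * w)" by (simp add: algebra_simps)
  then show "Re (cnj (u + v) * w) \<le> supp_fun W u + supp_fun W v"
    using supp_fun_upper[OF assms(1) w, of u] supp_fun_upper[OF assms(1) w, of v] by linarith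
qed

lemma supp_fun_scale:
  assumes W: "bounded W" "W \<noteq> {}" and r: "0 \<le> r" shows "supp_fun W (of_real r * u) = r * supp_fun W u"
proof (cases "r = 0")
  case True
  then show ?thesis using W(2) by (simp add: supp_fun_def)
next
  case False
  then have r: "r > 0" using r by simp
  have le: "supp_fun W (of_real t * v) \<le> t * supp_fun W v" if "t > 0" for t v
  proof (rule supp_fun_least[OF W(2)])
    fix w assume w: "w \<in> W"
    show "Re (cnj (of_real t * v) * w) \<le> t * supp_fun W v"
      unfolding Re_scale_cnj1 using supp_fun_upper[OF W(1) w] that by (intro mult_left_mono) auto
  qed
  have "supp_fun W (of_real (1 / r) * (of_real r * u)) \<le> (1 / r) * supp_fun W (of_real r * u)"
    by (rule le) (use r in simp)
  moreover have "complex_of_real (1 / r) * (of_real r * u) = u" using r by simp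
  ultimately have "supp_fun W u \<le> (1 / r) * supp_fun W (of_real r * u)" by metis
  then have "r * supp_fun W u \<le> supp_fun W (of_real r * u)" using r by (simp add: field_simps)
  then show ?thesis using le[OF r, of u] by simp
qed

text \<open>The support function of the parallel body: \<open>W\<close> enlarged by a disk of radius \<open>e\<close>.\<close>

lemma circumscribed_supp:
  assumes W: "bounded W" "W \<noteq> {}" and "e > 0" "2 \<le> n"
  shows "circumscribed (\<lambda>u. supp_fun W u + e * norm u) n"
proof
  fix u v :: complex and r :: real
  have "e * norm (u + v) \<le> e * norm u + e * norm v"
    using norm_triangle_ineq[of u v] \<open>e > 0\<close> by (metis distrib_left less_imp_le mult_left_mono)
  then show "supp_fun W (u + v) + e * norm (u + v) \<le> supp_fun W u + e * norm u + (supp_fun W v + e * norm v)"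
    using supp_fun_add[OF W, of u v] by linarith
  show "supp_fun W (of_real r * u) + e * norm (of_real r * u) = r * (supp_fun W u + e * norm u)" if "0 \<le> r"
    using supp_fun_scale[OF W that] that by (simp add: norm_mult distrib_left)
  obtain w where w: "w \<in> W" using W(2) by blast
  have "Re (cnj u * w) < supp_fun W u + e * norm u" if "norm u = 1" for u
    using supp_fun_upper[OF W(1) w, of u] that \<open>e > 0\<close> by simp
  then show "\<exists>z. \<forall>u. norm u = 1 \<longrightarrow> Re (cnj u * z) < supp_fun W u + e * norm u" by blast
qed fact

lemma norm_cis_diff_le: "norm (cis s - cis t) \<le> \<bar>s - t\<bar>"
proof -
  have "cis s - cis t = cis t * (exp (\<i> * of_real (s - t)) - 1)"
    unfolding cis_conv_exp[symmetric] by (simp add: right_diff_distrib cis_mult)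
  then have "norm (cis s - cis t) = 2 * \<bar>sin ((s - t) / 2)\<bar>" using dist_exp_i_1[of "s - t"] by (simp add: norm_mult)
  then show ?thesis using abs_sin_x_le_abs_x[of "(s - t) / 2"] by (simp add: abs_divide)
qed

lemma (in circumscribed) dir_dense:
  assumes "norm u = 1" shows "\<exists>k<4 * n. norm (u - dir k) \<le> \<alpha>"
proof -
  define t where "t = Arg2pi u"
  have t: "0 \<le> t" "t < 2 * pi" "u = cis t"
    using Arg2pi[of u] assms by (auto simp: t_def is_Arg_def cis_conv_exp)
  define k where "k = nat \<lfloor>t / \<alpha>\<rfloor>"
  have k: "real k = of_int \<lfloor>t / \<alpha>\<rfloor>" using t(1) \<alpha>_bounds by (simp add: k_def)
  have 1: "real k \<le> t / \<alpha>" "t / \<alpha> < real k + 1" unfolding k by linarith+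
  then have 2: "real k * \<alpha> \<le> t" "t < real k * \<alpha> + \<alpha>"
    using \<alpha>_bounds by (simp_all add: field_simps)
  have "real k * \<alpha> < real (4 * n) * \<alpha>" unfolding total_angle using 2(1) t(2) by linarith
  then have "real k < real (4 * n)" using \<alpha>_bounds by (simp add: mult_less_cancel_right)
  then have "k < 4 * n" by linarith
  moreover have "norm (u - dir k) \<le> \<alpha>"
    using norm_cis_diff_le[of t "real k * \<alpha>"] 2 by (simp add: t(3) dir_def)
  ultimately show ?thesis by blast
qed

text \<open>A point of the polygon at distance \<open>r\<close> from the closure of \<open>W\<close> exceeds the support function by \<open>r\<close> in the direction
  from its closest point. Some normal of the polygon is within \<open>\<alpha>\<close> of this direction, so \<open>r\<close> is at most \<open>e\<close> plus a
  constant multiple of \<open>\<alpha>\<close>.\<close>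

lemma polygon_near_convex_set:
  assumes W: "bounded W" "W \<noteq> {}" "convex W" and f: "continuous_on UNIV f"
    and le1: "\<And>w. w \<in> W \<Longrightarrow> norm (f w :: complex) \<le> 1" and \<eta>: "\<eta> > 0"
  shows "\<exists>n\<ge>2. \<exists>e>0. \<forall>z. (\<forall>k<4 * n. Re (cnj (circumscribed.dir n k) * z) < supp_fun W (circumscribed.dir n k) + e)
           \<longrightarrow> norm (f z) \<le> 1 + \<eta>"
proof -
  obtain R where R: "R > 0" "\<And>w. w \<in> W \<Longrightarrow> norm w \<le> R" using W(1) bounded_pos by blast
  define C where "C = closure W"
  have C: "closed C" "convex C" "C \<noteq> {}" using W by (auto simp: C_def convex_closure)
  have C_le1: "norm (f w) \<le> 1" if "w \<in> C" for w
  proof -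
    have "closed {w. norm (f w) \<le> 1}" by (intro closed_Collect_le continuous_intros f continuous_on_norm)
    moreover have "W \<subseteq> {w. norm (f w) \<le> 1}" using le1 by blast
    ultimately show ?thesis using that closure_minimal unfolding C_def by blast
  qed
  have C_R: "norm w \<le> R" if "w \<in> C" for w
  proof -
    have "W \<subseteq> cball 0 R" using R by auto
    then have "C \<subseteq> cball 0 R" unfolding C_def by (rule closure_minimal) simp
    then show ?thesis using that by auto
  qed
  have "uniformly_continuous_on (cball 0 (2 * (R + 1))) f"
    using f continuous_on_subset by (intro compact_uniformly_continuous) auto
  then obtain d where d: "d > 0"
    "\<And>z w. z \<in> cball 0 (2 * (R + 1)) \<Longrightarrow> w \<in> cball 0 (2 * (R + 1)) \<Longrightarrow> dist z w < d \<Longrightarrow> dist (f z) (f w) < \<eta>"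
    unfolding uniformly_continuous_on_def using \<eta> by metis
  define e where "e = min 1 (d / 2)"
  have e: "0 < e" "e \<le> 1" "e \<le> d / 2" using d by (auto simp: e_def)
  obtain n0 :: nat where n0: "pi * (3 * R + 2) / d < real n0" using reals_Archimedean2 by blast
  define n where "n = max 2 n0"
  have n: "2 \<le> n" "pi * (3 * R + 2) / d < real n" using n0 by (auto simp: n_def)
  define p where "p u = supp_fun W u + e * norm u" for u
  interpret P: circumscribed p n
    unfolding p_def by (rule circumscribed_supp) (use W e n in auto)
  have small: "P.\<alpha> * (3 * R + 2) < d / 2"
    using n d(1) by (simp add: P.\<alpha>_def field_simps)
  have "norm (f z) \<le> 1 + \<eta>" if z: "\<And>k. k < 4 * n \<Longrightarrow> Re (cnj (P.dir k) * z) < supp_fun W (P.dir k) + e" for z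
  proof (cases "z \<in> C")
    case True
    then show ?thesis using C_le1 \<eta> by fastforce
  next
    case False
    have zR: "norm z \<le> 2 * (R + 1)"
    proof (rule P.polygon_norm_bound)
      show "Re (cnj (P.dir k) * z) < p (P.dir k)" if "k < 4 * n" for k
        using z[OF that] by (simp add: p_def P.norm_dir)
      show "p u \<le> R + 1" if "norm u = 1" for u
        using supp_fun_bound[OF W(2) R(2), of u] e that by (simp add: p_def)
    qed
    define w where "w = closest_point C z"
    have wC: "w \<in> C" unfolding w_def using C by (intro closest_point_in_set)
    define r where "r = norm (z - w)"
    have r: "r > 0" using wC False by (auto simp: r_def)
    define u where "u = (z - w) / of_real r"
    have u: "norm u = 1" using r by (simp add: u_def norm_divide r_def)
    have ur: "Re (cnj u * v) = inner (z - w) v / r" for v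
      using r by (simp add: u_def inner_complex_def field_simps)
    have "supp_fun W u \<le> Re (cnj u * w)"
    proof (rule supp_fun_least[OF W(2)])
      fix v assume "v \<in> W"
      then have "v \<in> C" using closure_subset by (auto simp: C_def)
      then have "inner (z - w) (v - w) \<le> 0" unfolding w_def using C by (intro closest_point_dot)
      then show "Re (cnj u * v) \<le> Re (cnj u * w)"
        unfolding ur using r by (simp add: inner_diff_right divide_right_mono)
    qed
    moreover have "Re (cnj u * z) = Re (cnj u * w) + r"
    proof -
      have "Re (cnj u * (z - w)) = r" unfolding ur using r by (simp add: r_def power2_norm_eq_inner[symmetric] power2_eq_square)
      then show ?thesis by (simp add: right_diff_distrib)
    qed
    ultimately have 1: "r \<le> Re (cnj u * z) - supp_fun W u" by linarith
    obtain k where k: "k < 4 * n" "norm (u - P.dir k) \<le> P.\<alpha>" using P.dir_dense[OF u] by blast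
    have "Re (cnj u * z) - Re (cnj (P.dir k) * z) = Re (cnj (u - P.dir k) * z)" by (simp add: algebra_simps)
    also have "\<dots> \<le> norm (u - P.dir k) * norm z"
      using complex_Re_le_cmod[of "cnj (u - P.dir k) * z"] by (simp only: norm_mult complex_mod_cnj)
    also have "\<dots> \<le> P.\<alpha> * (2 * (R + 1))" using k zR P.\<alpha>_bounds by (intro mult_mono) auto
    finally have 2: "Re (cnj u * z) \<le> Re (cnj (P.dir k) * z) + P.\<alpha> * (2 * (R + 1))" by linarith
    have "supp_fun W (P.dir k) \<le> supp_fun W u + supp_fun W (P.dir k - u)"
      using supp_fun_add[OF W(1,2), of u "P.dir k - u"] by simp
    also have "supp_fun W (P.dir k - u) \<le> norm (P.dir k - u) * R" by (rule supp_fun_bound[OF W(2) R(2)])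
    also have "\<dots> \<le> P.\<alpha> * R" using k(2) R by (simp add: norm_minus_commute mult_right_mono)
    finally have 3: "supp_fun W (P.dir k) \<le> supp_fun W u + P.\<alpha> * R" by simp
    have "P.\<alpha> * (2 * (R + 1)) + P.\<alpha> * R = P.\<alpha> * (3 * R + 2)" by (simp add: algebra_simps)
    then have "r < d" using 1 2 3 z[OF k(1)] e small by linarith
    then have "dist (f z) (f w) < \<eta>"
      using zR C_R[OF wC] R by (intro d(2)) (auto simp: r_def dist_norm)
    then have "norm (f z) < norm (f w) + \<eta>"
      using norm_triangle_ineq2[of "f z" "f w"] by (simp add: dist_norm)
    then show ?thesis using C_le1[OF wC] by linarith
  qed
  then show ?thesis using n e by blast
qed

section \<open>The numerical range and the Crouzeix--Palencia inequality\<close>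

context inner_product
begin

text \<open>The numerical range of \<open>T\<close> with respect to the inner product \<open>B\<close>.\<close>

definition num_range :: "complex^'n^'n \<Rightarrow> complex set" where
  "num_range T = {B (T *v x) x |x. nm x = 1}"

lemma num_rangeI:
  assumes "x \<noteq> 0" "B (T *v x) x = z * B x x" shows "z \<in> num_range T"
proof -
  define r where "r = complex_of_real (1 / nm x)"
  have n: "nm x > 0" using assms(1) nm_eq_0[of x] nm_nonneg[of x] by linarith
  have "B (T *v (r *s x)) (r *s x) = r * cnj r * B (T *v x) x" by (simp add: matrix_vector_scale scale_left scale_right)
  also have "\<dots> = z * (r * cnj r * B x x)" using assms(2) by simp
  also have "r * cnj r * B x x = 1"
    unfolding nm_sq_complex[symmetric] using n by (simp add: r_def power2_eq_square)
  finally show ?thesis using normalize[OF assms(1)] unfolding num_range_def r_def by force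
qed

lemma num_range_nonempty: "num_range T \<noteq> {}"
  using ex_unit_vector by (auto simp: num_range_def)

lemma bounded_num_range: "bounded (num_range T)"
proof -
  obtain C where C: "\<And>x. nm (T *v x) \<le> C * nm x" using nm_matrix_bound by blast
  have "norm (B (T *v x) x) \<le> C" if "nm x = 1" for x
    using norm_B_le[of "T *v x" x] C[of x] that by simp
  then show ?thesis unfolding bounded_iff num_range_def by blast
qed

text \<open>The Toeplitz--Hausdorff theorem. The form \<open>Q\<close> is normalised to the values \<open>0\<close> and \<open>1\<close> at the given unit vectors
  \<open>x\<close> and \<open>y\<close>. Multiplying \<open>y\<close> by a suitable phase \<open>\<omega>\<close> makes it real on the real segment between them, and the
  intermediate value theorem applies.\<close>

theorem convex_num_range: "convex (num_range T)"
  unfolding convex_alt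
proof (intro ballI allI impI, elim conjE)
  fix a d :: complex and s :: real
  assume "a \<in> num_range T" "d \<in> num_range T" and s: "0 \<le> s" "s \<le> 1"
  then obtain x y where x: "nm x = 1" "a = B (T *v x) x" and y: "nm y = 1" "d = B (T *v y) y"
    unfolding num_range_def by blast
  show "(1 - s) *\<^sub>R a + s *\<^sub>R d \<in> num_range T"
  proof (cases "a = d")
    case True
    then show ?thesis using \<open>a \<in> num_range T\<close> by (simp add: algebra_simps)
  next
    case False
    have Bx: "B x x = 1" and By: "B y y = 1" using nm_sq_complex[of x] nm_sq_complex[of y] x y by auto
    define Q where "Q u v = (B (T *v u) v - a * B u v) / (d - a)" for u v
    have Q_add: "Q (u + u') v = Q u v + Q u' v" "Q v (u + u') = Q v u + Q v u'" for u u' v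
      by (simp_all add: Q_def matrix_vector_right_distrib add_left add_right add_divide_distrib[symmetric]) 
        (simp_all add: algebra_simps)
    have Q_scale: "Q (t *s u) v = t * Q u v" "Q u (t *s v) = cnj t * Q u v" for t u v
      by (simp_all add: Q_def matrix_vector_scale scale_left scale_right algebra_simps)
    have Qx: "Q x x = 0" and Qy: "Q y y = 1" using x y Bx By False by (simp_all add: Q_def)
    define m where "m = Q y x - cnj (Q x y)"
    define \<omega> where "\<omega> = (if m = 0 then 1 else cnj (sgn m))"
    have \<omega>: "norm \<omega> = 1" by (simp add: \<omega>_def norm_sgn)
    have \<omega>m: "Im (\<omega> * m) = 0"
    proof (cases "m = 0")
      case False
      then have "\<omega> * m = of_real (norm m)"
        by (simp add: \<omega>_def sgn_eq mult.commute[of "cnj m"] complex_norm_square[symmetric] power2_eq_square)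
      then show ?thesis by simp
    qed simp
    define v where "v = \<omega> *s y"
    have \<omega>\<omega>: "\<omega> * cnj \<omega> = 1" using \<omega> by (metis complex_norm_square of_real_1 one_power2)
    have Qv: "Q v v = 1" and Bv: "B v v = 1"
      unfolding v_def Q_scale scale_left scale_right Qy By using \<omega>\<omega> by (simp_all add: mult.commute)
    define r where "r = Re (Q x v + Q v x)"
    have "Im (Q x v + Q v x) = Im (\<omega> * m)"
      by (simp add: v_def Q_scale m_def algebra_simps)
    then have r: "Q x v + Q v x = of_real r" using \<omega>m by (simp add: r_def complex_eq_iff)
    define z where "z t = of_real (1 - t) *s x + of_real t *s v" for t :: real
    have Qz: "Q (z t) (z t) = of_real (t * (1 - t) * r + t^2)" for t
    proof -
      have "Q (z t) (z t) = of_real (1 - t) * of_real t * (Q x v + Q v x) + of_real t * of_real t * 1"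
        unfolding z_def Q_add Q_scale Qx Qv by (simp add: algebra_simps)
      then show ?thesis unfolding r by (simp add: power2_eq_square algebra_simps)
    qed
    have Bz: "B (z t) (z t) = of_real ((1 - t)^2 + t^2 + 2 * t * (1 - t) * Re (B x v))" for t
    proof -
      have "B x v + B v x = of_real (2 * Re (B x v))" using cnj_swap[of x v] complex_add_cnj[of "B x v"] by simp
      moreover have "B (z t) (z t) = of_real (1 - t) * of_real (1 - t) + of_real (1 - t) * of_real t * (B x v + B v x) + of_real t * of_real t"
        unfolding z_def add_left add_right scale_left scale_right Bx Bv by (simp add: algebra_simps)
      ultimately show ?thesis by (simp add: power2_eq_square algebra_simps)
    qed
    define f where "f t = t * (1 - t) * r + t^2 - s * ((1 - t)^2 + t^2 + 2 * t * (1 - t) * Re (B x v))" for t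
    have "\<exists>t\<ge>0. t \<le> 1 \<and> f t = 0"
      by (rule IVT') (use s in \<open>auto simp: f_def intro!: continuous_intros\<close>)
    then obtain t where t: "0 \<le> t" "t \<le> 1" "f t = 0" by blast
    then have Qz2: "Q (z t) (z t) = of_real s * B (z t) (z t)"
      unfolding Qz Bz of_real_mult[symmetric] of_real_eq_iff f_def by simp
    have nz: "z t \<noteq> 0"
    proof
      assume z0: "z t = 0"
      then have e: "of_real (1 - t) *s x = - (of_real t *s v)" by (simp add: z_def eq_neg_iff_add_eq_0)
      have neg: "- (of_real t *s v) = (- of_real t) *s v" by (simp add: vec_eq_iff)
      have "Q (of_real (1 - t) *s x) (of_real (1 - t) *s x) = Q ((- of_real t) *s v) ((- of_real t) *s v)"
        unfolding e neg ..
      then have "of_real t * of_real t = (0 :: complex)" unfolding Q_scale Qx Qv by simp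
      then have "t = 0" by simp
      then have "x = 0" using z0 by (simp add: z_def)
      then show False using x(1) nm_eq_0[of 0] by simp
    qed
    have "B (T *v z t) (z t) = (a + of_real s * (d - a)) * B (z t) (z t)"
      using Qz2 False unfolding Q_def by (simp add: field_simps)
    from num_rangeI[OF nz this] have "a + of_real s * (d - a) \<in> num_range T" .
    moreover have "a + of_real s * (d - a) = (1 - s) *\<^sub>R a + s *\<^sub>R d"
      by (simp add: scaleR_conv_of_real algebra_simps)
    ultimately show ?thesis by simp
  qed
qed

text \<open>The constant is obtained for \<open>\<phi> / (1 + \<eta>)\<close> on a polygon where \<open>|\<phi>| \<le> 1 + \<eta>\<close>, for every \<open>\<eta> > 0\<close>.\<close>

theorem Crouzeix_Palencia:
  assumes calc: "fun_calc UNIV T \<phi> F" and le1: "\<And>z. z \<in> num_range T \<Longrightarrow> norm (\<phi> z) \<le> 1"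
  shows "nm (F *v x) \<le> (1 + sqrt 2) * nm x"
proof (rule field_le_epsilon)
  fix \<epsilon> :: real assume \<epsilon>: "\<epsilon> > 0"
  define c where "c = (1 + sqrt 2) * nm x"
  have c: "c \<ge> 0" by (simp add: c_def)
  define \<eta> where "\<eta> = \<epsilon> / (c + 1)"
  have \<eta>: "\<eta> > 0" using c \<epsilon> by (simp add: \<eta>_def)
  define W where "W = num_range T"
  have W: "bounded W" "W \<noteq> {}" "convex W"
    unfolding W_def by (rule bounded_num_range num_range_nonempty convex_num_range)+
  have "continuous_on UNIV \<phi>" using calc by (auto simp: fun_calc_def holomorphic_on_imp_continuous_on)
  from polygon_near_convex_set[OF W this _ \<eta>]
  obtain n e where n: "2 \<le> n" and e: "e > 0" and
    near: "\<And>z. (\<And>k. k < 4 * n \<Longrightarrow> Re (cnj (circumscribed.dir n k) * z) < supp_fun W (circumscribed.dir n k) + e) \<Longrightarrow> norm (\<phi> z) \<le> 1 + \<eta>"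
    using le1 unfolding W_def by metis
  let ?dir = "circumscribed.dir n"
  define p where "p e u = supp_fun W u + e * norm u" for e u
  have circ: "circumscribed (p e) n" if "e > 0" for e
    unfolding p_def using circumscribed_supp[OF W(1,2) that n] .
  have norm_dir: "norm (?dir k) = 1" for k using circumscribed.norm_dir[OF circ[OF e]] .
  have poly: "convex_polygon (4 * n) ?dir (\<lambda>k. circumscribed.vertex (p e) n (?dir k)) (\<lambda>k. supp_fun W (?dir k) + e)
      (circumscribed.side_length (p e) n)" if "e > 0" for e
    using circumscribed.circumscribed_polygon[OF circ[OF that]] by (simp add: p_def norm_dir)
  have T: "Re (cnj (?dir k) * B (T *v x) x) \<le> supp_fun W (?dir k) * (nm x)^2" for k x
  proof (cases "x = 0")
    case True
    then show ?thesis using nm_eq_0[of 0] by simp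
  next
    case False
    then have nx: "nm x > 0" using nm_eq_0[of x] nm_nonneg[of x] by linarith
    define w where "w = B (T *v x) x / of_real ((nm x)^2)"
    have "w \<in> W" unfolding W_def
      by (rule num_rangeI[OF False]) (use nx in \<open>simp add: w_def flip: nm_sq_complex\<close>)
    then have "Re (cnj (?dir k) * w) \<le> supp_fun W (?dir k)" by (rule supp_fun_upper[OF W(1)])
    moreover have "Re (cnj (?dir k) * w) = Re (cnj (?dir k) * B (T *v x) x) / (nm x)^2"
      unfolding w_def times_divide_eq_right by (rule Re_divide_of_real)
    ultimately show ?thesis using nx by (simp add: pos_divide_le_eq)
  qed
  define F' where "F' = mat (complex_of_real (1 / (1 + \<eta>))) ** F"
  have calc': "fun_calc S T (\<lambda>z. of_real (1 / (1 + \<eta>)) * \<phi> z) F'" for S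
    unfolding F'_def by (intro fun_calc_mult fun_calc_const fun_calc_subset[OF calc]) auto
  have "nm (F' *v x) \<le> (1 + sqrt 2) * nm x"
  proof (rule polygon_bound[OF poly T e calc'])
    fix z assume "\<And>k. k < 4 * n \<Longrightarrow> Re (cnj (?dir k) * z) < supp_fun W (?dir k) + e"
    from near[OF this] show "norm (of_real (1 / (1 + \<eta>)) * \<phi> z) \<le> 1"
      unfolding norm_mult norm_of_real using \<eta> by simp
  qed
  moreover have "nm (F' *v x) = nm (F *v x) / (1 + \<eta>)"
    unfolding F'_def matrix_vector_mul_assoc[symmetric] mat_vector_mult nm_scale norm_of_real using \<eta> by simp
  ultimately have "nm (F *v x) \<le> c * (1 + \<eta>)" using \<eta> by (simp add: c_def pos_divide_le_eq)
  also have "\<dots> \<le> c + \<epsilon>"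
  proof -
    have "c * \<eta> \<le> (c + 1) * \<eta>" using \<eta> by (intro mult_right_mono) auto
    also have "(c + 1) * \<eta> = \<epsilon>" using c by (simp add: \<eta>_def)
    finally show ?thesis by (simp add: distrib_left)
  qed
  finally show "nm (F *v x) \<le> (1 + sqrt 2) * nm x + \<epsilon>" by (simp add: c_def)
qed

end

section \<open>Stability of the Runge--Kutta iteration\<close>

lemma rk_poly_fun_calc: "fun_calc S T (rk_poly a s) (rk_poly_matrix a s T)"
proof -
  have pow: "fun_calc S T (\<lambda>z. z ^ k) (matrix_pow T k)" for k
  proof (induction k)
    case 0
    then show ?case using fun_calc_const[of S T 1] by (simp add: matrix_pow_def)
  next
    case (Suc k)
    then show ?case using fun_calc_mult[OF fun_calc_ident Suc] by (simp add: matrix_pow_def)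
  qed
  have "fun_calc S T (\<lambda>z. of_real (a k) * z ^ k) (a k *\<^sub>R matrix_pow T k)" for k
  proof -
    have "mat (of_real (a k)) ** matrix_pow T k = a k *\<^sub>R matrix_pow T k"
      by (simp add: vec_eq_iff mat_matrix_mult_component) (simp add: scaleR_conv_of_real)
    then show ?thesis using fun_calc_mult[OF fun_calc_const[of S T "of_real (a k)"] pow[of k]] by simp
  qed
  note term_calc = this
  show ?thesis
  proof (induction s)
    case 0
    then show ?case using term_calc[of 0] by (simp add: rk_poly_def[abs_def] rk_poly_matrix_def)
  next
    case (Suc s)
    then show ?case using fun_calc_add[OF Suc term_calc[of "Suc s"]] by (simp add: rk_poly_def[abs_def] rk_poly_matrix_def)
  qed
qed

lemma fun_calc_power: "fun_calc S T \<phi> F \<Longrightarrow> fun_calc S T (\<lambda>z. \<phi> z ^ k) (matrix_pow F k)"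
proof (induction k)
  case 0
  then show ?case using fun_calc_const[of S T 1] by (simp add: matrix_pow_def)
next
  case (Suc k)
  then show ?case using fun_calc_mult[OF Suc.prems Suc.IH] by (simp add: matrix_pow_def)
qed

lemma H_inner_scale_right: "H_inner H x (a *s y) = a * H_inner H x y"
  by (simp add: H_inner_def matrix_vector_scale sum_distrib_left algebra_simps)

lemma H_inner_mat: "H_inner (mat (complex_of_real r)) x x = of_real (r * (norm x)^2)"
proof -
  have "H_inner (mat (complex_of_real r)) x x = (\<Sum>i\<in>UNIV. of_real r * of_real ((norm (x $ i))^2))"
    unfolding H_inner_def mat_vector_mult complex_norm_square by (simp add: algebra_simps)
  also have "\<dots> = of_real (r * (\<Sum>i\<in>UNIV. (norm (x $ i))^2))" by (simp add: sum_distrib_left)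
  also have "(\<Sum>i\<in>UNIV. (norm (x $ i))^2) = (norm x)^2"
    unfolding norm_vec_def L2_set_def by (simp add: sum_nonneg)
  finally show ?thesis .
qed

lemma H_inner_diff_matrix: "H_inner (A - M) x y = H_inner A x y - H_inner M x y"
  by (simp add: H_inner_def matrix_vector_mult_diff_rdistrib right_diff_distrib sum_subtractf)

text \<open>The arguments are swapped because \<open>H_inner\<close> is linear in its second argument, while the form of an
  \<open>inner_product\<close> is linear in the first. This replaces the numerical range by its conjugate.\<close>

lemma inner_product_H:
  fixes H :: "real^'n^'n"
  assumes sym: "transpose H = H" and K: "0 < K"
    and low: "form_le (mat (complex_of_real (inverse K))) (map_matrix complex_of_real H)"
    and up: "form_le (map_matrix complex_of_real H) (mat (complex_of_real K))"
  shows "inner_product (\<lambda>x y. H_inner (map_matrix complex_of_real H) y x) K"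
proof
  define Hc where "Hc = map_matrix complex_of_real H"
  have symc: "Hc $ i $ j = Hc $ j $ i" for i j
    using arg_cong[OF sym, of "\<lambda>M. M $ j $ i"] by (simp add: Hc_def transpose_def)
  have real: "cnj (Hc $ i $ j) = Hc $ i $ j" for i j by (simp add: Hc_def)
  have lower: "(norm x)^2 \<le> K * Re (H_inner Hc x x)" for x
  proof -
    have "0 \<le> Re (H_inner (Hc - mat (complex_of_real (inverse K))) x x)"
      using low unfolding form_le_def Hc_def by (simp add: complex_nonneg_Reals_iff)
    then have "inverse K * (norm x)^2 \<le> Re (H_inner Hc x x)"
      unfolding H_inner_diff_matrix H_inner_mat
      by (simp only: minus_complex.simps Re_complex_of_real diff_ge_0_iff_ge)
    then show ?thesis using K by (simp add: field_simps)
  qed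
  show "(norm x)^2 \<le> K * Re (H_inner (map_matrix complex_of_real H) x x)" for x
    using lower unfolding Hc_def .
  have "0 \<le> K * Re (H_inner Hc x x)" for x using lower[of x] zero_le_power2 order_trans by blast
  then show "0 \<le> Re (H_inner (map_matrix complex_of_real H) x x)" for x
    using K by (simp add: Hc_def zero_le_mult_iff)
  show "Re (H_inner (map_matrix complex_of_real H) x x) \<le> K * (norm x)^2" for x
  proof -
    have "0 \<le> Re (H_inner (mat (complex_of_real K) - Hc) x x)"
      using up unfolding form_le_def Hc_def by (simp add: complex_nonneg_Reals_iff)
    then show ?thesis unfolding H_inner_diff_matrix H_inner_mat Hc_def by simp
  qed
  show "H_inner (map_matrix complex_of_real H) z (x + y) = H_inner (map_matrix complex_of_real H) z x + H_inner (map_matrix complex_of_real H) z y" for x y z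
    by (simp add: H_inner_def matrix_vector_right_distrib distrib_left sum.distrib)
  show "cnj (H_inner (map_matrix complex_of_real H) y x) = H_inner (map_matrix complex_of_real H) x y" for x y
  proof -
    have "cnj (H_inner Hc y x) = (\<Sum>i\<in>UNIV. \<Sum>j\<in>UNIV. y $ i * (Hc $ i $ j * cnj (x $ j)))"
      by (simp add: H_inner_def matrix_vector_mult_def sum_distrib_left real)
    also have "\<dots> = (\<Sum>j\<in>UNIV. \<Sum>i\<in>UNIV. y $ i * (Hc $ i $ j * cnj (x $ j)))" by (rule sum.swap)
    also have "\<dots> = (\<Sum>j\<in>UNIV. \<Sum>i\<in>UNIV. cnj (x $ j) * (Hc $ j $ i * y $ i))"
      using symc by (intro sum.cong refl) (metis mult.assoc mult.commute)
    also have "\<dots> = H_inner Hc x y"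
      by (simp add: H_inner_def matrix_vector_mult_def sum_distrib_left)
    finally show ?thesis unfolding Hc_def .
  qed
qed (use K H_inner_scale_right in auto)

theorem theorem4p2:
  fixes a :: "nat \<Rightarrow> real" and s :: nat
    and K dt :: real
    and L H :: "real^'n^'n"
    and u :: "nat \<Rightarrow> complex^'n"
  assumes "a s \<noteq> 0"
    and "transpose H = H"
    and "0 < inverse K"
    and "form_le (mat (complex_of_real (inverse K))) (map_matrix complex_of_real H)"
    and "form_le (map_matrix complex_of_real H) (mat (complex_of_real K))"
    and "dt > 0"
    and "(\<lambda>z. complex_of_real dt * z) ` numerical_range (map_matrix complex_of_real H) (map_matrix complex_of_real L)
           \<subseteq> stability_region a s"
    and "\<And>n. u (Suc n) = rk_poly_matrix a s (map_matrix complex_of_real (dt *\<^sub>R L)) *v u n"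
  shows "\<forall>n\<ge>1. norm (u n) \<le> (1 + sqrt 2) * K * norm (u 0)"
proof (intro allI impI)
  fix n :: nat
  define Hc where "Hc = map_matrix complex_of_real H"
  define Lc where "Lc = map_matrix complex_of_real L"
  define T where "T = map_matrix complex_of_real (dt *\<^sub>R L)"
  define P where "P = rk_poly_matrix a s T"
  define B where "B x y = H_inner Hc y x" for x y
  have K: "0 < K" using assms(3) by simp
  interpret inner_product B K
    unfolding B_def Hc_def by (rule inner_product_H[OF assms(2) K assms(4,5)])
  have TL: "T *v x = of_real dt *s (Lc *v x)" for x
    by (simp add: T_def Lc_def vec_eq_iff matrix_vector_mult_def sum_distrib_left mult.assoc)
  have le1: "norm (rk_poly a s z ^ n) \<le> 1" if z: "z \<in> num_range T" for z
  proof -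
    obtain x where x: "nm x = 1" "z = B (T *v x) x" using z unfolding num_range_def by blast
    define w where "w = H_inner Hc (Lc *v x) x"
    have "H_norm Hc x = 1" using x(1) by (simp add: H_norm_def nm_def B_def)
    then have "w \<in> numerical_range Hc Lc" unfolding numerical_range_def w_def by blast
    then have "of_real dt * w \<in> stability_region a s" using assms(7) unfolding Hc_def Lc_def by blast
    then have 1: "norm (rk_poly a s (of_real dt * w)) \<le> 1" by (simp add: stability_region_def)
    have "z = of_real dt * B (Lc *v x) x" unfolding x(2) TL scale_left ..
    also have "B (Lc *v x) x = cnj w" unfolding w_def using cnj_swap[of x "Lc *v x"] by (simp add: B_def)
    finally have "z = cnj (of_real dt * w)" by simp
    \<comment> \<open>The coefficients are real, so conjugating the numerical range does no harm.\<close>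
    moreover have "rk_poly a s (cnj y) = cnj (rk_poly a s y)" for y by (simp add: rk_poly_def)
    ultimately have "norm (rk_poly a s z) = norm (rk_poly a s (of_real dt * w))" by (metis complex_mod_cnj)
    with 1 have "norm (rk_poly a s z) \<le> 1" by simp
    then show ?thesis by (simp add: norm_power power_le_one)
  qed
  have u: "u n = matrix_pow P n *v u 0" for n
  proof (induction n)
    case (Suc n)
    then show ?case using assms(8)[of n] by (simp add: P_def T_def matrix_pow_def matrix_vector_mul_assoc)
  qed (simp add: matrix_pow_def)
  have calc: "fun_calc UNIV T (\<lambda>z. rk_poly a s z ^ n) (matrix_pow P n)"
    unfolding P_def by (intro fun_calc_power rk_poly_fun_calc)
  have "norm (u n) \<le> sqrt K * nm (u n)" by (rule norm_le_nm)
  also have "\<dots> \<le> sqrt K * ((1 + sqrt 2) * nm (u 0))"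
    unfolding u[of n] using K by (intro mult_left_mono Crouzeix_Palencia[OF calc le1]) auto
  also have "\<dots> \<le> sqrt K * ((1 + sqrt 2) * (sqrt K * norm (u 0)))"
    using K by (intro mult_left_mono nm_le_norm) auto
  also have "\<dots> = (1 + sqrt 2) * (sqrt K * sqrt K) * norm (u 0)" by (simp only: ac_simps)
  finally show "norm (u n) \<le> (1 + sqrt 2) * K * norm (u 0)" using K by simp
qed

end
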